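(* Let $\Lambda$ be a nonempty set and let $E$ be a linear subspace of $\mathbb{R}^\Lambda$ endowed with an absolute norm. Suppose $E$ has the Radon-Nikodým property and $n(E)=1$. Then, for every family $\{X_\lambda:\lambda\in\Lambda\}$ of nonzero Banach spaces, $$n\Bigl(\Bigl[\bigoplus_{\lambda\in\Lambda}X_\lambda\Bigr]_E\Bigr)= \inf\{n(X_\lambda):\lambda\in\Lambda\}.$$
   Context: For a Banach space $X$ (real or complex), $S_X$ and $X^*$ denote its unit sphere and dual, and $L(X)$ the bounded linear operators on $X$. Put $\Pi(X)=\{(x,x^* )\in S_X\times S_{X^*}: x^*(x)=1\}$. The numerical radius of $T\in L(X)$ is $v(T)=\sup\{|x^*(Tx)|:(x,x^* )\in\Pi(X)\}$, and the numerical index of $X$ is $n(X)=\inf\{v(T): T\in L(X),\ \|T\|=1\}$. (For $E\subseteq\mathbb{R}^\Lambda$, $n(E)$ is the numerical index of $E$ as a real Banach space.) An absolute norm on a linear subspace $E$ of $\mathbb{R}^\Lambda$ is a complete norm $\|\cdot\|_E$ such that: (a) if $(a_\lambda),(b_\lambda)\in\mathbb{R}^\Lambda$ satisfy $|a_\lambda|=|b_\lambda|$ for all $\lambda$ and $(a_\lambda)\in E$, then $(b_\lambda)\in E$ and $\|(a_\lambda)\|_E=\|(b_\lambda)\|_E$; (b) for every $\lambda\in\Lambda$, the characteristic function $\chi_{\{\lambda\}}$ belongs to $E$ and has norm $1$. For a family $\{X_\lambda:\lambda\in\Lambda\}$ of Banach spaces over the same scalar field ($\mathbb{R}$ or $\mathbb{C}$),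 the $E$-sum is $\bigl[\bigoplus_{\lambda}X_\lambda\bigr]_E=\{(x_\lambda): x_\lambda\in X_\lambda\ \forall\lambda,\ (\|x_\lambda\|)\in E\}$ with norm $\|(x_\lambda)\|=\|(\|x_\lambda\|)\|_E$. *)

theory Defs
  imports "HOL-Analysis.Analysis" "HOL-Library.Function_Algebras"
begin

text \<open>
  A normed space is given by a scalar multiplication \<open>s\<close> that makes a type a vector space over
  \<open>'k\<close>, a linear subspace \<open>V\<close> of that type and a norm \<open>N\<close> on \<open>V\<close>; the values of \<open>N\<close> (and of
  operators and functionals) off \<open>V\<close> play no role. Carriers are needed because members of a
  family of spaces, and the sum of the family, must not depend on one type per space. An arbitrary
  family of Banach spaces has this form, up to isometric isomorphism, inside the product of its
  members. The scalar field \<open>'k\<close> is used only for \<open>real\<close> and \<open>complex\<close>.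
\<close>

definition normed_space_on ::
  "('k::real_normed_field \<Rightarrow> 'a::ab_group_add \<Rightarrow> 'a) \<Rightarrow> 'a set \<Rightarrow> ('a \<Rightarrow> real) \<Rightarrow> bool" where
  "normed_space_on s V N \<longleftrightarrow>
     vector_space s \<and> module.subspace s V \<and>
     (\<forall>x\<in>V. 0 \<le> N x) \<and>
     (\<forall>x\<in>V. N x = 0 \<longleftrightarrow> x = 0) \<and>
     (\<forall>c. \<forall>x\<in>V. N (s c x) = norm c * N x) \<and>
     (\<forall>x\<in>V. \<forall>y\<in>V. N (x + y) \<le> N x + N y)"

definition banach_space_on ::
  "('k::real_normed_field \<Rightarrow> 'a::ab_group_add \<Rightarrow> 'a) \<Rightarrow> 'a set \<Rightarrow> ('a \<Rightarrow> real) \<Rightarrow> bool" where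
  "banach_space_on s V N \<longleftrightarrow>
     normed_space_on s V N \<and>
     (\<forall>u::nat \<Rightarrow> 'a.
        (\<forall>n. u n \<in> V) \<and> (\<forall>e>0. \<exists>m0. \<forall>m\<ge>m0. \<forall>n\<ge>m0. N (u m - u n) < e) \<longrightarrow>
        (\<exists>x\<in>V. (\<lambda>n. N (u n - x)) \<longlonglongrightarrow> 0))"

definition bounded_linear_on ::
  "('k::real_normed_field \<Rightarrow> 'a::ab_group_add \<Rightarrow> 'a) \<Rightarrow> 'a set \<Rightarrow> ('a \<Rightarrow> real) \<Rightarrow>
   ('k \<Rightarrow> 'b::ab_group_add \<Rightarrow> 'b) \<Rightarrow> 'b set \<Rightarrow> ('b \<Rightarrow> real) \<Rightarrow> ('a \<Rightarrow> 'b) \<Rightarrow> bool" where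
  "bounded_linear_on s V N t W M f \<longleftrightarrow>
     (\<forall>x\<in>V. f x \<in> W) \<and>
     (\<forall>x\<in>V. \<forall>y\<in>V. f (x + y) = f x + f y) \<and>
     (\<forall>c. \<forall>x\<in>V. f (s c x) = t c (f x)) \<and>
     (\<exists>K. \<forall>x\<in>V. M (f x) \<le> K * N x)"

definition op_norm_on ::
  "'a set \<Rightarrow> ('a \<Rightarrow> real) \<Rightarrow> ('b \<Rightarrow> real) \<Rightarrow> ('a \<Rightarrow> 'b) \<Rightarrow> real" where
  "op_norm_on V N M f = (SUP x\<in>{x\<in>V. N x \<le> 1}. M (f x))"

definition operators_on ::
  "('k::real_normed_field \<Rightarrow> 'a::ab_group_add \<Rightarrow> 'a) \<Rightarrow> 'a set \<Rightarrow> ('a \<Rightarrow> real) \<Rightarrow> ('a \<Rightarrow> 'a) set" where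
  "operators_on s V N = {T. bounded_linear_on s V N s V N T}"

definition dual_on ::
  "('k::real_normed_field \<Rightarrow> 'a::ab_group_add \<Rightarrow> 'a) \<Rightarrow> 'a set \<Rightarrow> ('a \<Rightarrow> real) \<Rightarrow> ('a \<Rightarrow> 'k) set" where
  "dual_on s V N = {f. bounded_linear_on s V N (*) UNIV norm f}"

definition state_pairs ::
  "('k::real_normed_field \<Rightarrow> 'a::ab_group_add \<Rightarrow> 'a) \<Rightarrow> 'a set \<Rightarrow> ('a \<Rightarrow> real) \<Rightarrow> ('a \<times> ('a \<Rightarrow> 'k)) set" where
  "state_pairs s V N =
     {(x, f). x \<in> V \<and> N x = 1 \<and> f \<in> dual_on s V N \<and> op_norm_on V N norm f = 1 \<and> f x = 1}"

definition numerical_radius ::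
  "('k::real_normed_field \<Rightarrow> 'a::ab_group_add \<Rightarrow> 'a) \<Rightarrow> 'a set \<Rightarrow> ('a \<Rightarrow> real) \<Rightarrow> ('a \<Rightarrow> 'a) \<Rightarrow> real" where
  "numerical_radius s V N T = (SUP (x, f)\<in>state_pairs s V N. norm (f (T x)))"

definition numerical_index ::
  "('k::real_normed_field \<Rightarrow> 'a::ab_group_add \<Rightarrow> 'a) \<Rightarrow> 'a set \<Rightarrow> ('a \<Rightarrow> real) \<Rightarrow> real" where
  "numerical_index s V N =
     (INF T\<in>{T \<in> operators_on s V N. op_norm_on V N N T = 1}. numerical_radius s V N T)"

definition fun_scale :: "('k \<Rightarrow> 'a \<Rightarrow> 'a) \<Rightarrow> 'k \<Rightarrow> ('l \<Rightarrow> 'a) \<Rightarrow> ('l \<Rightarrow> 'a)" where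
  "fun_scale s c x = (\<lambda>l. s c (x l))"

abbreviation real_fun_scale :: "real \<Rightarrow> ('l \<Rightarrow> real) \<Rightarrow> ('l \<Rightarrow> real)" where
  "real_fun_scale \<equiv> fun_scale (*)"

definition absolute_norm :: "('l \<Rightarrow> real) set \<Rightarrow> (('l \<Rightarrow> real) \<Rightarrow> real) \<Rightarrow> bool" where
  "absolute_norm E NE \<longleftrightarrow>
     banach_space_on real_fun_scale E NE \<and>
     (\<forall>a b. (\<forall>l. \<bar>a l\<bar> = \<bar>b l\<bar>) \<and> a \<in> E \<longrightarrow> b \<in> E \<and> NE a = NE b) \<and>
     (\<forall>l. indicator {l} \<in> E \<and> NE (indicator {l}) = 1)"

definition esum :: "('l \<Rightarrow> real) set \<Rightarrow> ('l \<Rightarrow> 'a set) \<Rightarrow> ('l \<Rightarrow> 'a \<Rightarrow> real) \<Rightarrow> ('l \<Rightarrow> 'a) set" where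
  "esum E V N = {x. (\<forall>l. x l \<in> V l) \<and> (\<lambda>l. N l (x l)) \<in> E}"

definition esum_norm :: "(('l \<Rightarrow> real) \<Rightarrow> real) \<Rightarrow> ('l \<Rightarrow> 'a \<Rightarrow> real) \<Rightarrow> ('l \<Rightarrow> 'a) \<Rightarrow> real" where
  "esum_norm NE N x = NE (\<lambda>l. N l (x l))"

text \<open>
  Bochner integration in a (possibly nonseparable) carrier-based Banach space; the library integral
  covers only second-countable types. As usual, \<open>f\<close> is integrable if it is almost everywhere
  the pointwise limit of simple functions that also approximate it in the mean. The almost everywhere
  convergence makes \<open>N (f w - u n w)\<close> agree almost everywhere with a measurable function, so that its
  \<open>nn_integral\<close> is the genuine integral.
\<close>

definition simple_integral_on ::
  "(real \<Rightarrow> 'a::ab_group_add \<Rightarrow> 'a) \<Rightarrow> 'm measure \<Rightarrow> ('m \<Rightarrow> 'a) \<Rightarrow> 'a" where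
  "simple_integral_on s M u = (\<Sum>y\<in>u ` space M. s (measure M (u -` {y} \<inter> space M)) y)"

definition has_bochner_integral_on ::
  "(real \<Rightarrow> 'a::ab_group_add \<Rightarrow> 'a) \<Rightarrow> 'a set \<Rightarrow> ('a \<Rightarrow> real) \<Rightarrow> 'm measure \<Rightarrow> ('m \<Rightarrow> 'a) \<Rightarrow> 'a \<Rightarrow> bool" where
  "has_bochner_integral_on s V N M f x \<longleftrightarrow>
     (\<forall>w\<in>space M. f w \<in> V) \<and> x \<in> V \<and>
     (\<exists>u::nat \<Rightarrow> 'm \<Rightarrow> 'a.
        (\<forall>n. simple_function M (u n) \<and> (\<forall>w\<in>space M. u n w \<in> V)) \<and>
        (AE w in M. (\<lambda>n. N (f w - u n w)) \<longlonglongrightarrow> 0) \<and>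
        (\<lambda>n. \<integral>\<^sup>+ w. ennreal (N (f w - u n w)) \<partial>M) \<longlonglongrightarrow> 0 \<and>
        (\<lambda>n. N (simple_integral_on s M (u n) - x)) \<longlonglongrightarrow> 0)"

definition vector_measure_on ::
  "'a::ab_group_add set \<Rightarrow> ('a \<Rightarrow> real) \<Rightarrow> 'm measure \<Rightarrow> ('m set \<Rightarrow> 'a) \<Rightarrow> bool" where
  "vector_measure_on V N M G \<longleftrightarrow>
     (\<forall>A\<in>sets M. G A \<in> V) \<and>
     (\<forall>A::nat \<Rightarrow> 'm set. range A \<subseteq> sets M \<and> disjoint_family A \<longrightarrow>
        (\<lambda>n. N ((\<Sum>i<n. G (A i)) - G (\<Union>i. A i))) \<longlonglongrightarrow> 0)"

definition bounded_variation_on :: "('a \<Rightarrow> real) \<Rightarrow> 'm measure \<Rightarrow> ('m set \<Rightarrow> 'a) \<Rightarrow> bool" where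
  "bounded_variation_on N M G \<longleftrightarrow>
     (\<exists>K. \<forall>P. finite P \<and> P \<subseteq> sets M \<and> disjoint P \<longrightarrow> (\<Sum>A\<in>P. N (G A)) \<le> K)"

text \<open>
  The quantification over all finite measure spaces ranges over all \<open>\<sigma>\<close>-algebras and finite measures on
  sets of real numbers, since a HOL formula cannot quantify over types. This covers Lebesgue measure
  on \<open>[0,1]\<close>, and the property for that one measure space already implies it for every
  finite measure space (Diestel and Uhl, Vector Measures, Chapter V.3).
\<close>

definition radon_nikodym_property ::
  "(real \<Rightarrow> 'a::ab_group_add \<Rightarrow> 'a) \<Rightarrow> 'a set \<Rightarrow> ('a \<Rightarrow> real) \<Rightarrow> bool" where
  "radon_nikodym_property s V N \<longleftrightarrow>
     (\<forall>(M::real measure) G.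
        finite_measure M \<and> vector_measure_on V N M G \<and> bounded_variation_on N M G \<and>
        (\<forall>A\<in>null_sets M. G A = 0) \<longrightarrow>
        (\<exists>g. \<forall>A\<in>sets M. has_bochner_integral_on s V N M (\<lambda>w. s (indicator A w) (g w)) (G A)))"

end

theory Submission
  imports Defs
begin

text \<open>
  Let \<open>X\<close> be the \<open>E\<close>-sum of the spaces \<open>X l\<close>, let \<open>v\<close> denote the numerical radius and \<open>n\<close> the
  numerical index.

  Why \<open>n(X) \<le> n(X l)\<close>: an operator \<open>S\<close> on \<open>X l\<close> acts on \<open>X\<close> by \<open>R x = S (x l)\<close> in coordinate \<open>l\<close>
  and \<open>0\<close> elsewhere, with the same norm. For a state \<open>(x, f)\<close> of \<open>X\<close>, replacing \<open>x l\<close> by another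
  vector of the same norm changes neither the modulus of \<open>x\<close> nor, therefore, its norm; so the
  restriction of \<open>f\<close> to the summand \<open>X l\<close> attains its norm in the direction of \<open>x l\<close>
  (\<open>summand_functional_aligned\<close>). Up to a factor at most \<open>1\<close> it is thus the functional of a state of
  \<open>X l\<close>, and \<open>v(R) \<le> v(S)\<close>.

  Why \<open>n(X)\<close> is at least every \<open>k\<close> below all \<open>n(X l)\<close>: let \<open>T\<close> be an operator of norm one on \<open>X\<close>.
  Take \<open>x\<close> and \<open>f\<close> with \<open>f (T x)\<close> close to \<open>1\<close>, of the form \<open>x l = a l * e l\<close> and
  \<open>f w = (\<Sum>l. b l * \<phi> l (w l))\<close> with unit vectors \<open>e l\<close>, functionals \<open>\<phi> l\<close> of norm at most one, and
  \<open>a\<close>, \<open>b\<close> in the unit balls of \<open>E\<close> and its dual. Suppose that \<open>\<bar>a m * b m\<bar>\<close> is close to \<open>1\<close> for a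
  single coordinate \<open>m\<close>. Since \<open>(\<Sum>l. \<bar>a l * b l\<bar>) \<le> 1\<close>, the other products are negligible, so the
  coordinate \<open>m\<close> of \<open>x\<close> and of \<open>f\<close> can be taken from any state of \<open>X m\<close> while \<open>f x\<close> remains almost
  of modulus one.
  Coupling the remaining coordinates to coordinate \<open>m\<close> through functionals of norm one compresses
  \<open>T\<close> to an operator of norm almost one on \<open>X m\<close>. A state of \<open>X m\<close> at which the compression
  has modulus about \<open>k\<close> comes from an approximate state of \<open>X\<close> at which \<open>T\<close> has the same modulus
  (\<open>compression_to_summand\<close>). An estimate going back to Lumer replaces approximate states by states
  (\<open>almost_state_value\<close>).

  Such \<open>a\<close> and \<open>b\<close> exist because \<open>n(E) = 1\<close>. Let \<open>a\<close> lie in a slice of small diameter of the unit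
  ball of \<open>E\<close>, and \<open>b\<close> in a slice of the dual ball, defined by a vector of \<open>E\<close>, whose elements
  almost agree on the coordinates that matter for \<open>a\<close>. Rank-one operators built from these two
  slices have a state at which both factors are almost extremal; this forces
  \<open>\<bar>\<Sum>l. \<sigma> l * a l * b l\<bar>\<close> to be almost \<open>1\<close> for every choice of signs \<open>\<sigma>\<close>. If the signs are flipped
  one after another, this sum must jump across the gap between about \<open>1\<close> and about \<open>-1\<close>, and one
  single term has to account for the jump (\<open>common_unit_coordinate\<close>).

  The slices of small diameter come from the Radon-Nikodym property. An \<open>E\<close>-valued measure on the unit
  interval without a density shows that bounded sums of disjoint blocks have small blocks
  (\<open>no_bounded_block_array\<close>). Hence finitely supported elements are dense, and a slice that cannot be
  shrunk to small diameter would, by repeated perturbation of its functional and compactness of a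
  product of intervals, produce a forbidden sequence of blocks (\<open>near_max_small_tails\<close>).
\<close>

section \<open>Real and complex scalars\<close>

text \<open>
  A common interface to the real and the complex field. The imaginary unit of the reals is taken to
  be \<open>0\<close>: then the decomposition of a scalar, and the recovery \<open>F y - \<i> * F (\<i> * y)\<close> of a linear
  functional from its real part \<open>F\<close>, are one formula for both fields.
\<close>

class scalar_field = real_normed_field +
  fixes real_part :: "'a \<Rightarrow> real" and imag_unit :: 'a
  assumes real_part_add: "real_part (a + b) = real_part a + real_part b"
    and real_part_scaleR: "real_part (r *\<^sub>R a) = r * real_part a"
    and real_part_one: "real_part 1 = 1"
    and real_part_le_norm: "real_part a \<le> norm a"
    and imag_unit_square: "imag_unit = 0 \<or> imag_unit * imag_unit = - 1"
    and real_part_imag_unit: "real_part imag_unit = 0"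
    and scalar_decomposition_scaleR:
      "a = real_part a *\<^sub>R 1 - real_part (imag_unit * a) *\<^sub>R imag_unit"

instantiation real :: scalar_field
begin

definition real_part_real :: "real \<Rightarrow> real" where "real_part_real a = a"
definition imag_unit_real :: real where "imag_unit_real = 0"

instance
  by standard (auto simp: real_part_real_def imag_unit_real_def)

end

instantiation complex :: scalar_field
begin

definition real_part_complex :: "complex \<Rightarrow> real" where "real_part_complex = Re"
definition imag_unit_complex :: complex where "imag_unit_complex = \<i>"

instance
  by standard (auto simp: real_part_complex_def imag_unit_complex_def complex_Re_le_cmod complex_eq_iff)

end

lemma real_part_scale: "real_part (of_real r * a :: 'k::scalar_field) = r * real_part a"
  using real_part_scaleR[of r a] by (simp add: scaleR_conv_of_real)

lemma scalar_decomposition: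
  "(a :: 'k::scalar_field) = of_real (real_part a) - imag_unit * of_real (real_part (imag_unit * a))"
  using scalar_decomposition_scaleR[of a] by (simp add: scaleR_conv_of_real mult.commute)

lemma real_part_of_real [simp]: "real_part (of_real r :: 'k::scalar_field) = r"
  using real_part_scale[of r "1::'k"] by (simp add: real_part_one)

lemma real_part_0 [simp]: "real_part (0 :: 'k::scalar_field) = 0"
  using real_part_of_real[of 0, where 'k = 'k] by simp

lemma real_part_minus [simp]: "real_part (- a :: 'k::scalar_field) = - real_part a"
  using real_part_scale[of "-1" a] by simp

lemma abs_real_part_le: "\<bar>real_part (a :: 'k::scalar_field)\<bar> \<le> norm a"
  using real_part_le_norm[of a] real_part_le_norm[of "- a"] by simp

lemma real_part_imag_unit_mult [simp]:
  "real_part ((imag_unit :: 'k::scalar_field) * of_real r) = 0"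
  using real_part_scale[of r "imag_unit :: 'k"] by (simp add: real_part_imag_unit mult.commute)

lemma unit_phase:
  fixes c :: "'k::real_normed_field"
  obtains u :: 'k where "norm u = 1" "u * c = of_real (norm c)"
proof (cases "c = 0")
  case True
  then show ?thesis using that[of 1] by simp
next
  case False
  then show ?thesis using that[of "of_real (norm c) / c"] by (simp add: norm_divide)
qed

section \<open>Normed spaces and norming functionals\<close>

locale normed_carrier =
  fixes s :: "'k::scalar_field \<Rightarrow> 'a::ab_group_add \<Rightarrow> 'a" and V :: "'a set" and N :: "'a \<Rightarrow> real"
  assumes normed: "normed_space_on s V N"
begin

sublocale vector_space s
  using normed by (simp add: normed_space_on_def)

lemma subspace_V: "subspace V"
  using normed by (simp add: normed_space_on_def)

lemma zero_mem [simp]: "0 \<in> V"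
  using subspace_V by (rule subspace_0)

lemma add_mem [simp]: "x \<in> V \<Longrightarrow> y \<in> V \<Longrightarrow> x + y \<in> V"
  using subspace_V by (rule subspace_add)

lemma scale_mem [simp]: "x \<in> V \<Longrightarrow> s c x \<in> V"
  using subspace_V by (rule subspace_scale)

lemma minus_mem [simp]: "x \<in> V \<Longrightarrow> - x \<in> V"
  using subspace_V by (rule subspace_neg)

lemma diff_mem [simp]: "x \<in> V \<Longrightarrow> y \<in> V \<Longrightarrow> x - y \<in> V"
  using subspace_V by (rule subspace_diff)

lemma sum_mem: "(\<And>i. i \<in> I \<Longrightarrow> x i \<in> V) \<Longrightarrow> (\<Sum>i\<in>I. x i) \<in> V"
  using subspace_V by (rule subspace_sum)

lemma N_nonneg [simp]: "x \<in> V \<Longrightarrow> 0 \<le> N x"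
  using normed by (simp add: normed_space_on_def)

lemma N_eq_0: "x \<in> V \<Longrightarrow> N x = 0 \<longleftrightarrow> x = 0"
  using normed by (simp add: normed_space_on_def)

lemma N_0 [simp]: "N 0 = 0"
  using N_eq_0[of 0] by simp

lemma N_pos: "x \<in> V \<Longrightarrow> x \<noteq> 0 \<Longrightarrow> 0 < N x"
  using N_eq_0[of x] N_nonneg[of x] by linarith

lemma N_scale: "x \<in> V \<Longrightarrow> N (s c x) = norm c * N x"
  using normed by (simp add: normed_space_on_def)

lemma N_triangle: "x \<in> V \<Longrightarrow> y \<in> V \<Longrightarrow> N (x + y) \<le> N x + N y"
  using normed by (simp add: normed_space_on_def)

lemma N_minus [simp]: "x \<in> V \<Longrightarrow> N (- x) = N x"
  using N_scale[of x "-1"] by simp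

lemma N_diff_commute: "x \<in> V \<Longrightarrow> y \<in> V \<Longrightarrow> N (x - y) = N (y - x)"
  using N_minus[of "x - y"] by simp

lemma N_triangle_diff: "x \<in> V \<Longrightarrow> y \<in> V \<Longrightarrow> N (x - y) \<le> N x + N y"
  using N_triangle[of x "- y"] by simp

lemma N_triangle_via: "x \<in> V \<Longrightarrow> y \<in> V \<Longrightarrow> N x \<le> N y + N (x - y)"
  using N_triangle[of y "x - y"] by simp

lemma unit_direction:
  assumes "V \<noteq> {0}" and "x \<in> V"
  obtains q where "q \<in> V" "N q = 1" "x = s (of_real (N x)) q"
proof (cases "x = 0")
  case True
  obtain v where v: "v \<in> V" "v \<noteq> 0"
    using assms(1) zero_mem by blast
  then have "N v > 0" by (rule N_pos)
  then show ?thesis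
    using that[of "s (of_real (1 / N v)) v"] v True by (simp add: N_scale norm_divide)
next
  case False
  then have "N x > 0" using assms by (simp add: N_pos)
  then show ?thesis
    using that[of "s (of_real (1 / N x)) x"] assms
    by (simp add: N_scale norm_divide flip: of_real_mult)
qed

text \<open>
  The Hahn-Banach theorem is proved by minimising sublinear functionals instead of extending linear
  ones: a minimal sublinear functional is linear. Functionals are fixed to be \<open>0\<close> off \<open>V\<close> so that
  the pointwise order on them is antisymmetric.
\<close>

definition sublinear_below :: "('a \<Rightarrow> real) set" where
  "sublinear_below = {q. (\<forall>y. y \<notin> V \<longrightarrow> q y = 0) \<and> (\<forall>y\<in>V. q y \<le> N y) \<and>
     (\<forall>y\<in>V. \<forall>z\<in>V. q (y + z) \<le> q y + q z) \<and>
     (\<forall>r\<ge>0. \<forall>y\<in>V. q (s (of_real r) y) = r * q y)}"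

lemma sublinear_below_lower:
  assumes "q \<in> sublinear_below" "y \<in> V"
  shows "- q (- y) \<le> q y" "- N y \<le> q y"
proof -
  have "q (s (of_real 0) 0) = 0 * q 0"
    using assms zero_mem order_refl unfolding sublinear_below_def by blast
  then have "q 0 = 0" by simp
  moreover have "q (y + (- y)) \<le> q y + q (- y)"
    using assms unfolding sublinear_below_def by (metis (mono_tags, lifting) mem_Collect_eq minus_mem)
  ultimately show *: "- q (- y) \<le> q y" by simp
  have "q (- y) \<le> N (- y)"
    using assms(1) minus_mem[OF assms(2)] unfolding sublinear_below_def by blast
  with * assms show "- N y \<le> q y" by simp
qed

text \<open>
  The infimum over \<open>t \<ge> 0\<close> of \<open>q (y + t z) - t q z\<close> is sublinear and lies below \<open>q\<close>; the term for
  \<open>t = 1\<close> gives the last inequality. Applied to the norm, it yields a functional whose value at \<open>- z\<close>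
  is at most \<open>- N z\<close>; applied to a minimal \<open>q\<close>, it yields additivity of \<open>q\<close>.
\<close>

lemma sublinear_lowering:
  assumes q: "q \<in> sublinear_below" and z: "z \<in> V"
  obtains p where "p \<in> sublinear_below" "p \<le> q" "\<And>y. y \<in> V \<Longrightarrow> p y \<le> q (y + z) - q z"
proof -
  have q_add: "q (y + w) \<le> q y + q w" if "y \<in> V" "w \<in> V" for y w
    using q that by (simp add: sublinear_below_def)
  have q_scale: "q (s (of_real r) y) = r * q y" if "r \<ge> 0" "y \<in> V" for y r
    using q that by (simp add: sublinear_below_def)
  define g where "g y t = q (y + s (of_real t) z) - t * q z" for y t
  define p where "p y = (if y \<in> V then INF t\<in>{0..}. g y t else 0)" for y
  have lower: "- q (- y) \<le> g y t" if "y \<in> V" "t \<ge> 0" for y t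
  proof -
    have "q (s (of_real t) z) = q ((y + s (of_real t) z) + (- y))" by simp
    also have "\<dots> \<le> q (y + s (of_real t) z) + q (- y)"
      using that z by (intro q_add) auto
    finally show ?thesis using q_scale[OF that(2) z] by (simp add: g_def)
  qed
  then have bdd: "bdd_below (g y ` {0..})" if "y \<in> V" for y
    using that by (auto intro!: bdd_belowI2[where m = "- q (- y)"])
  have p_le: "p y \<le> g y t" if "y \<in> V" "t \<ge> 0" for y t
    using that bdd unfolding p_def by (auto intro!: cINF_lower)
  have p_ge: "c \<le> p y" if "y \<in> V" "\<And>t. t \<ge> 0 \<Longrightarrow> c \<le> g y t" for y c
    using that unfolding p_def by (auto intro!: cINF_greatest)
  have pq: "p y \<le> q y" if "y \<in> V" for y
    using p_le[OF that, of 0] by (simp add: g_def)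
  have "p \<in> sublinear_below"
    unfolding sublinear_below_def
  proof (intro CollectI conjI allI ballI impI)
    show "p y = 0" if "y \<notin> V" for y using that by (simp add: p_def)
    show "p y \<le> N y" if "y \<in> V" for y
      using pq[OF that] q that by (force simp: sublinear_below_def)
    show "p (y + w) \<le> p y + p w" if "y \<in> V" "w \<in> V" for y w
    proof -
      have "p (y + w) \<le> g y t + g w r" if "t \<ge> 0" "r \<ge> 0" for t r
      proof -
        have "p (y + w) \<le> g (y + w) (t + r)"
          using that \<open>y \<in> V\<close> \<open>w \<in> V\<close> by (intro p_le) auto
        also have "(y + w) + s (of_real (t + r)) z = (y + s (of_real t) z) + (w + s (of_real r) z)"
          by (simp add: scale_left_distrib)
        then have "g (y + w) (t + r) \<le> g y t + g w r"
          using q_add[of "y + s (of_real t) z" "w + s (of_real r) z"] \<open>y \<in> V\<close> \<open>w \<in> V\<close> z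
          by (simp add: g_def algebra_simps)
        finally show ?thesis .
      qed
      then have "p (y + w) - g w r \<le> p y" if "r \<ge> 0" for r
        using p_ge[OF \<open>y \<in> V\<close>, of "p (y + w) - g w r"] that by (simp add: diff_le_eq)
      then have "p (y + w) - p y \<le> p w"
        using p_ge[OF \<open>w \<in> V\<close>, of "p (y + w) - p y"] by (simp add: diff_le_eq add.commute)
      then show ?thesis by simp
    qed
    show "p (s (of_real r) y) = r * p y" if "0 \<le> r" "y \<in> V" for r y
    proof (cases "r = 0")
      case True
      have "p 0 \<le> q 0" using pq by simp
      moreover have "q 0 = 0" using q_scale[of 0 0] by simp
      moreover have "- q (- 0) \<le> p 0" using lower[OF zero_mem] by (intro p_ge) simp_all
      ultimately show ?thesis using True by simp
    next
      case False
      with that have r: "r > 0" by simp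
      have g_scale: "g (s (of_real r) y) (r * t) = r * g y t" if "t \<ge> 0" for t
      proof -
        have "s (of_real r) y + s (of_real (r * t)) z = s (of_real r) (y + s (of_real t) z)"
          by (simp add: scale_right_distrib)
        then show ?thesis
          using q_scale[of r "y + s (of_real t) z"] r \<open>y \<in> V\<close> z by (simp add: g_def algebra_simps)
      qed
      have "p (s (of_real r) y) / r \<le> p y"
      proof (rule p_ge[OF \<open>y \<in> V\<close>])
        fix t :: real assume "t \<ge> 0"
        then have "p (s (of_real r) y) \<le> r * g y t"
          using p_le[of "s (of_real r) y" "r * t"] r \<open>y \<in> V\<close> g_scale by simp
        then show "p (s (of_real r) y) / r \<le> g y t" using r by (simp add: field_simps)
      qed
      moreover have "r * p y \<le> p (s (of_real r) y)"
      proof (rule p_ge)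
        fix t :: real assume "t \<ge> 0"
        then have "r * p y \<le> r * g y (t / r)"
          using r p_le[OF \<open>y \<in> V\<close>, of "t / r"] by simp
        also have "\<dots> = g (s (of_real r) y) t"
          using g_scale[of "t / r"] r \<open>t \<ge> 0\<close> by simp
        finally show "r * p y \<le> g (s (of_real r) y) t" .
      qed (use \<open>y \<in> V\<close> in simp)
      ultimately show ?thesis using r by (simp add: field_simps)
    qed
  qed
  moreover have "p \<le> q"
    using pq q by (auto simp: le_fun_def p_def sublinear_below_def)
  moreover have "p y \<le> q (y + z) - q z" if "y \<in> V" for y
    using p_le[OF that, of 1] by (simp add: g_def)
  ultimately show thesis by (rule that)
qed

lemma minimal_sublinear:
  assumes q0: "q0 \<in> sublinear_below"
  obtains q where "q \<in> sublinear_below" "q \<le> q0"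
    "\<And>p. p \<in> sublinear_below \<Longrightarrow> p \<le> q \<Longrightarrow> p = q"
proof -
  let ?A = "{q \<in> sublinear_below. q \<le> q0}"
  let ?P = "\<lambda>q p :: 'a \<Rightarrow> real. p \<le> q"
  have "\<exists>m\<in>?A. \<forall>a\<in>?A. ?P m a \<longrightarrow> a = m"
  proof (rule predicate_Zorn)
    show "partial_order_on ?A (relation_of ?P ?A)"
      by (rule partial_order_on_relation_ofI) auto
    fix C assume C: "C \<in> Chains (relation_of ?P ?A)"
    then have C_A: "C \<subseteq> ?A"
      unfolding Chains_def relation_of_def by auto
    have total: "q \<le> p \<or> p \<le> q" if "q \<in> C" "p \<in> C" for q p
      using C that unfolding Chains_def relation_of_def by auto
    show "\<exists>u\<in>?A. \<forall>a\<in>C. u \<le> a"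
    proof (cases "C = {}")
      case True
      then show ?thesis using q0 by auto
    next
      case False
      define u where "u y = (if y \<in> V then INF q\<in>C. q y else 0)" for y
      have bdd: "bdd_below ((\<lambda>q. q y) ` C)" if "y \<in> V" for y
        using C_A sublinear_below_lower(2) that by (intro bdd_belowI2[where m = "- N y"]) auto
      have u_le: "u y \<le> q y" if "q \<in> C" for q y
        using that bdd C_A by (auto simp: u_def sublinear_below_def intro!: cINF_lower)
      have u_ge: "c \<le> u y" if "y \<in> V" "\<And>q. q \<in> C \<Longrightarrow> c \<le> q y" for y c
        using that False by (auto simp: u_def intro!: cINF_greatest)
      obtain q1 where q1: "q1 \<in> C" using False by blast
      have "u \<in> sublinear_below"
        unfolding sublinear_below_def
      proof (intro CollectI conjI allI ballI impI)
        show "u y = 0" if "y \<notin> V" for y using that by (simp add: u_def)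
        show "u y \<le> N y" if "y \<in> V" for y
        proof -
          have "q1 y \<le> N y" using q1 C_A that by (auto simp: sublinear_below_def)
          then show ?thesis using u_le[OF q1, of y] by linarith
        qed
        show "u (y + w) \<le> u y + u w" if yw: "y \<in> V" "w \<in> V" for y w
        proof -
          have "u (y + w) \<le> q y + p w" if "q \<in> C" "p \<in> C" for q p
          proof -
            have qp: "q (y + w) \<le> q y + q w" "p (y + w) \<le> p y + p w"
              using C_A that yw by (auto simp: sublinear_below_def)
            from total[OF that] show ?thesis
            proof
              assume "q \<le> p"
              then have "q w \<le> p w" by (simp add: le_fun_def)
              with qp u_le[OF \<open>q \<in> C\<close>, of "y + w"] show ?thesis by linarith
            next
              assume "p \<le> q"
              then have "p y \<le> q y" by (simp add: le_fun_def)
              with qp u_le[OF \<open>p \<in> C\<close>, of "y + w"] show ?thesis by linarith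
            qed
          qed
          then have "u (y + w) - p w \<le> u y" if "p \<in> C" for p
            using that by (intro u_ge[OF yw(1)]) (simp add: diff_le_eq)
          then have "u (y + w) - u y \<le> u w"
            by (intro u_ge[OF yw(2)]) (simp add: diff_le_eq add.commute)
          then show ?thesis by simp
        qed
        show "u (s (of_real r) y) = r * u y" if "0 \<le> r" "y \<in> V" for r y
        proof -
          have sc: "q (s (of_real r) y) = r * q y" if "q \<in> C" for q
            using C_A that \<open>0 \<le> r\<close> \<open>y \<in> V\<close> by (auto simp: sublinear_below_def)
          have "r * u y \<le> u (s (of_real r) y)"
          proof (rule u_ge)
            fix q assume "q \<in> C"
            then show "r * u y \<le> q (s (of_real r) y)"
              using sc[of q] u_le[of q y] \<open>0 \<le> r\<close> by (simp add: mult_left_mono)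
          qed (use \<open>y \<in> V\<close> in simp)
          moreover have "u (s (of_real r) y) \<le> r * u y"
          proof (cases "r = 0")
            case True
            then show ?thesis using sc[OF q1] u_le[OF q1, of "s (of_real r) y"] by simp
          next
            case False
            with that have "r > 0" by simp
            have "u (s (of_real r) y) / r \<le> u y"
            proof (rule u_ge[OF \<open>y \<in> V\<close>])
              fix q assume "q \<in> C"
              then show "u (s (of_real r) y) / r \<le> q y"
                using u_le[of q "s (of_real r) y"] sc \<open>r > 0\<close> by (simp add: field_simps)
            qed
            then show ?thesis using \<open>r > 0\<close> by (simp add: field_simps)
          qed
          ultimately show ?thesis by simp
        qed
      qed
      moreover have "u \<le> q0"
        using u_le[OF q1] q1 C_A by (force simp: le_fun_def intro: order_trans)
      ultimately show ?thesis using u_le by (auto simp: le_fun_def)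
    qed
  qed
  then obtain m where m: "m \<in> ?A" and min: "\<And>a. a \<in> ?A \<Longrightarrow> a \<le> m \<Longrightarrow> a = m" by blast
  show thesis
  proof (rule that)
    show "p = m" if "p \<in> sublinear_below" "p \<le> m" for p
      using that m min[of p] by (auto intro: order_trans)
  qed (use m in auto)
qed

lemma real_linear_norming:
  assumes x: "x \<in> V"
  obtains F :: "'a \<Rightarrow> real" where
    "\<And>y z. y \<in> V \<Longrightarrow> z \<in> V \<Longrightarrow> F (y + z) = F y + F z"
    "\<And>r y. y \<in> V \<Longrightarrow> F (s (of_real r) y) = r * F y"
    "\<And>y. y \<in> V \<Longrightarrow> F y \<le> N y" "F x = N x"
proof -
  define q1 where "q1 y = (if y \<in> V then N y else 0)" for y
  have "q1 \<in> sublinear_below"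
    by (auto simp: sublinear_below_def q1_def N_triangle N_scale)
  then obtain p where p: "p \<in> sublinear_below" "p \<le> q1"
    and px: "\<And>y. y \<in> V \<Longrightarrow> p y \<le> q1 (y + x) - q1 x"
    using sublinear_lowering[OF _ x] by blast
  obtain F where F: "F \<in> sublinear_below" "F \<le> p"
    and min: "\<And>p. p \<in> sublinear_below \<Longrightarrow> p \<le> F \<Longrightarrow> p = F"
    using minimal_sublinear[OF p(1)] by blast
  have add: "F (y + z) = F y + F z" if y: "y \<in> V" and z: "z \<in> V" for y z
  proof -
    obtain p where "p \<in> sublinear_below" "p \<le> F" and *: "\<And>y. y \<in> V \<Longrightarrow> p y \<le> F (y + z) - F z"
      using sublinear_lowering[OF F(1) z] by blast
    then have "p = F" by (intro min)
    with *[OF y] have "F y + F z \<le> F (y + z)" by simp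
    moreover have "F (y + z) \<le> F y + F z"
      using F(1) that by (simp add: sublinear_below_def)
    ultimately show ?thesis by simp
  qed
  have pos: "F (s (of_real r) y) = r * F y" if "y \<in> V" "r \<ge> 0" for y r
    using F(1) that by (simp add: sublinear_below_def)
  have F0: "F 0 = 0" using pos[of 0 0] by simp
  have neg: "F (- y) = - F y" if "y \<in> V" for y
    using add[of y "- y"] that F0 by simp
  show thesis
  proof (rule that)
    show "F (y + z) = F y + F z" if "y \<in> V" "z \<in> V" for y z
      using that by (rule add)
    show "F (s (of_real r) y) = r * F y" if "y \<in> V" for r y
    proof (cases "r \<ge> 0")
      case False
      then have "F (- s (of_real r) y) = (- r) * F y"
        using pos[OF that, of "- r"] by simp
      then show ?thesis using neg[of "s (of_real r) y"] that by simp
    qed (simp add: pos that)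
    show "F y \<le> N y" if "y \<in> V" for y
      using F(1) that by (simp add: sublinear_below_def)
    have "F (- x) \<le> q1 (- x + x) - q1 x"
      using px[of "- x"] F(2) x by (force simp: le_fun_def intro: order_trans)
    then have "F x \<ge> N x" using neg[OF x] x by (simp add: q1_def)
    moreover have "F x \<le> N x" using F(1) x by (simp add: sublinear_below_def)
    ultimately show "F x = N x" by simp
  qed
qed

definition dual_ball :: "('a \<Rightarrow> 'k) set" where
  "dual_ball = {f. (\<forall>x\<in>V. \<forall>y\<in>V. f (x + y) = f x + f y) \<and>
     (\<forall>c. \<forall>x\<in>V. f (s c x) = c * f x) \<and> (\<forall>x\<in>V. norm (f x) \<le> N x)}"

lemma dual_ball_add: "f \<in> dual_ball \<Longrightarrow> x \<in> V \<Longrightarrow> y \<in> V \<Longrightarrow> f (x + y) = f x + f y"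
  by (simp add: dual_ball_def)

lemma dual_ball_scale: "f \<in> dual_ball \<Longrightarrow> x \<in> V \<Longrightarrow> f (s c x) = c * f x"
  by (simp add: dual_ball_def)

lemma dual_ball_le: "f \<in> dual_ball \<Longrightarrow> x \<in> V \<Longrightarrow> norm (f x) \<le> N x"
  by (simp add: dual_ball_def)

lemma dual_ball_0: "f \<in> dual_ball \<Longrightarrow> f 0 = 0"
  using dual_ball_scale[of f 0 0] by simp

lemma dual_ball_minus: "f \<in> dual_ball \<Longrightarrow> x \<in> V \<Longrightarrow> f (- x) = - f x"
  using dual_ball_scale[of f x "-1"] by simp

lemma dual_ball_diff: "f \<in> dual_ball \<Longrightarrow> x \<in> V \<Longrightarrow> y \<in> V \<Longrightarrow> f (x - y) = f x - f y"
  using dual_ball_add[of f x "- y"] by (simp add: dual_ball_minus)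

lemma dual_ball_cmult: "f \<in> dual_ball \<Longrightarrow> norm c \<le> 1 \<Longrightarrow> (\<lambda>x. c * f x) \<in> dual_ball"
  unfolding dual_ball_def
  by (auto simp: distrib_left norm_mult intro: order_trans[OF mult_left_le_one_le])

text \<open>
  The real functional \<open>F\<close> with \<open>F x = N x\<close> is the real part of \<open>f y = F y - \<i> * F (\<i> * y)\<close>, and
  choosing a phase for each \<open>y\<close> transfers the bound by \<open>N\<close> from \<open>F\<close> to \<open>f\<close>.
\<close>

theorem norming_functional:
  assumes x: "x \<in> V"
  obtains f where "f \<in> dual_ball" "f x = of_real (N x)"
proof -
  obtain F :: "'a \<Rightarrow> real" where
    F_add: "\<And>y z. y \<in> V \<Longrightarrow> z \<in> V \<Longrightarrow> F (y + z) = F y + F z" and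
    F_scale: "\<And>r y. y \<in> V \<Longrightarrow> F (s (of_real r) y) = r * F y" and
    F_le: "\<And>y. y \<in> V \<Longrightarrow> F y \<le> N y" and Fx: "F x = N x"
    using real_linear_norming[OF x] by blast
  let ?i = "imag_unit :: 'k"
  define f :: "'a \<Rightarrow> 'k" where "f y = of_real (F y) - ?i * of_real (F (s ?i y))" for y
  have f_add: "f (y + z) = f y + f z" if "y \<in> V" "z \<in> V" for y z
    using that by (simp add: f_def F_add scale_right_distrib algebra_simps)
  have f_real: "f (s (of_real r) y) = of_real r * f y" if "y \<in> V" for r y
  proof -
    have "s ?i (s (of_real r) y) = s (of_real r) (s ?i y)" by (rule scale_left_commute)
    then have "F (s ?i (s (of_real r) y)) = r * F (s ?i y)"
      using that by (simp only: F_scale scale_mem)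
    then show ?thesis using that by (simp add: f_def F_scale right_diff_distrib mult.left_commute)
  qed
  have f_imag: "f (s ?i y) = ?i * f y" if y: "y \<in> V" for y
  proof (cases "?i = 0")
    case True
    have "F 0 = 0" using F_scale[of 0 0] by simp
    with True show ?thesis by (simp add: f_def)
  next
    case False
    then have i2: "?i * ?i = - 1" using imag_unit_square by blast
    then have "s ?i (s ?i y) = - y" by simp
    then have "F (s ?i (s ?i y)) = - F y" using F_scale[OF y, of "-1"] by simp
    moreover have "?i * (?i * c) = - c" for c using i2 by (simp flip: mult.assoc)
    ultimately show ?thesis by (simp add: f_def right_diff_distrib del: scale_scale)
  qed
  have f_scale: "f (s c y) = c * f y" if y: "y \<in> V" for c y
  proof -
    let ?a = "real_part c" and ?b = "- real_part (?i * c)"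
    have c: "c = of_real ?a + of_real ?b * ?i"
      using scalar_decomposition[of c] by (simp add: algebra_simps)
    have "s c y = s (of_real ?a) y + s (of_real ?b) (s ?i y)"
      by (subst c) (simp only: scale_left_distrib scale_scale)
    then have "f (s c y) = of_real ?a * f y + of_real ?b * (?i * f y)"
      using y f_add[of "s (of_real ?a) y" "s (of_real ?b) (s ?i y)"]
      by (simp only: f_real f_imag scale_mem)
    also have "\<dots> = c * f y" by (subst (3) c) (simp add: algebra_simps)
    finally show ?thesis .
  qed
  have real_part_f: "real_part (f y) = F y" for y
    using real_part_add[of "of_real (F y)" "- (?i * of_real (F (s ?i y)))"] by (simp add: f_def)
  have f_le: "norm (f y) \<le> N y" if y: "y \<in> V" for y
  proof -
    obtain u where u: "norm u = 1" "u * f y = of_real (norm (f y))" by (rule unit_phase)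
    have "norm (f y) = real_part (f (s u y))" using u y by (simp add: f_scale)
    also have "\<dots> \<le> N (s u y)" using real_part_f F_le[of "s u y"] y by simp
    finally show ?thesis using u y by (simp add: N_scale)
  qed
  have f: "f \<in> dual_ball" by (simp add: dual_ball_def f_add f_scale f_le)
  (* The real part of f x is already N x, so |f x| = N x and only a phase has to be removed. *)
  have "norm (f x) = N x"
    using f_le[OF x] real_part_le_norm[of "f x"] real_part_f[of x] Fx by simp
  moreover obtain u where u: "norm u = 1" "u * f x = of_real (norm (f x))" by (rule unit_phase)
  ultimately show thesis
    using that[of "\<lambda>y. u * f y"] dual_ball_cmult[OF f, of u] by simp
qed

section \<open>Operators, states and the numerical index\<close>

lemma operator_bounded:
  assumes "T \<in> operators_on s V N"
  shows "bdd_above ((\<lambda>x. N (T x)) ` {x \<in> V. N x \<le> 1})"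
proof -
  obtain K where K: "\<And>x. x \<in> V \<Longrightarrow> N (T x) \<le> K * N x"
    using assms unfolding operators_on_def bounded_linear_on_def by blast
  have "N (T x) \<le> max K 0" if "x \<in> V" "N x \<le> 1" for x
  proof -
    have "N (T x) \<le> max K 0 * N x"
      using K[OF that(1)] mult_right_mono[of K "max K 0" "N x"] that by (force intro: order_trans)
    also have "\<dots> \<le> max K 0 * 1" using that by (intro mult_left_mono) auto
    finally show ?thesis by simp
  qed
  then show ?thesis by (intro bdd_aboveI2[where M = "max K 0"]) auto
qed

lemma operator_mem: "T \<in> operators_on s V N \<Longrightarrow> x \<in> V \<Longrightarrow> T x \<in> V"
  and operator_add: "T \<in> operators_on s V N \<Longrightarrow> x \<in> V \<Longrightarrow> y \<in> V \<Longrightarrow> T (x + y) = T x + T y"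
  and operator_scale: "T \<in> operators_on s V N \<Longrightarrow> x \<in> V \<Longrightarrow> T (s c x) = s c (T x)"
  by (auto simp: operators_on_def bounded_linear_on_def)

lemma operator_0: "T \<in> operators_on s V N \<Longrightarrow> T 0 = 0"
  using operator_scale[of T 0 0] by simp

lemma operator_le_op_norm:
  assumes "T \<in> operators_on s V N" "x \<in> V"
  shows "N (T x) \<le> op_norm_on V N N T * N x"
proof (cases "x = 0")
  case True
  then show ?thesis using assms by (simp add: operator_0)
next
  case False
  then have pos: "N x > 0" using assms by (simp add: N_pos)
  let ?y = "s (of_real (1 / N x)) x"
  have "N (T ?y) \<le> op_norm_on V N N T"
    unfolding op_norm_on_def using pos assms
    by (intro cSUP_upper operator_bounded) (auto simp: N_scale norm_divide)
  moreover have "N (T ?y) = N (T x) / N x"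
    using assms pos by (simp add: operator_scale N_scale operator_mem norm_divide)
  ultimately have "N (T x) / N x \<le> op_norm_on V N N T" by (simp only:)
  then show ?thesis using pos by (simp add: field_simps)
qed

lemma op_norm_approx:
  assumes "c < op_norm_on V N N T"
  obtains x where "x \<in> V" "N x \<le> 1" "c < N (T x)"
proof -
  have "\<exists>x\<in>{x \<in> V. N x \<le> 1}. c < N (T x)"
  proof (rule ccontr)
    assume "\<not> ?thesis"
    then have "op_norm_on V N N T \<le> c"
      unfolding op_norm_on_def by (intro cSUP_least) (auto intro: exI[of _ 0])
    with assms show False by simp
  qed
  then show thesis using that by blast
qed

lemma operatorI:
  assumes "\<And>x. x \<in> V \<Longrightarrow> T x \<in> V" "\<And>x y. x \<in> V \<Longrightarrow> y \<in> V \<Longrightarrow> T (x + y) = T x + T y"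
    "\<And>c x. x \<in> V \<Longrightarrow> T (s c x) = s c (T x)" "\<And>x. x \<in> V \<Longrightarrow> N (T x) \<le> K * N x"
  shows "T \<in> operators_on s V N"
  using assms unfolding operators_on_def bounded_linear_on_def by blast

lemma state_pairs_iff:
  "(x, f) \<in> state_pairs s V N \<longleftrightarrow> x \<in> V \<and> N x = 1 \<and> f \<in> dual_ball \<and> f x = 1"
proof
  assume L: "(x, f) \<in> state_pairs s V N"
  then have x: "x \<in> V" "N x = 1" "f x = 1" and f: "f \<in> dual_on s V N"
    and nf: "op_norm_on V N norm f = 1"
    by (auto simp: state_pairs_def)
  obtain K where K: "\<And>x. x \<in> V \<Longrightarrow> norm (f x) \<le> K * N x" and
    add: "\<And>x y. x \<in> V \<Longrightarrow> y \<in> V \<Longrightarrow> f (x + y) = f x + f y" and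
    scale: "\<And>c x. x \<in> V \<Longrightarrow> f (s c x) = c * f x"
    using f unfolding dual_on_def bounded_linear_on_def by blast
  have bdd: "bdd_above ((\<lambda>x. norm (f x)) ` {x \<in> V. N x \<le> 1})"
  proof (intro bdd_aboveI2[where M = "max K 0"])
    fix x assume *: "x \<in> {x \<in> V. N x \<le> 1}"
    then have "norm (f x) \<le> max K 0 * N x"
      using K[of x] mult_right_mono[of K "max K 0" "N x"] by (force intro: order_trans)
    also have "\<dots> \<le> max K 0 * 1" using * by (intro mult_left_mono) auto
    finally show "norm (f x) \<le> max K 0" by simp
  qed
  have "norm (f y) \<le> N y" if y: "y \<in> V" for y
  proof (cases "y = 0")
    case True
    then show ?thesis using scale[of 0 0] by simp
  next
    case False
    then have pos: "N y > 0" using y by (simp add: N_pos)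
    have "norm (f (s (of_real (1 / N y)) y)) \<le> op_norm_on V N norm f"
      unfolding op_norm_on_def using pos y
      by (intro cSUP_upper bdd) (auto simp: N_scale norm_divide)
    then show ?thesis using pos y by (simp add: nf scale norm_mult norm_divide field_simps)
  qed
  then show "x \<in> V \<and> N x = 1 \<and> f \<in> dual_ball \<and> f x = 1"
    using x by (simp add: dual_ball_def add scale)
next
  assume R: "x \<in> V \<and> N x = 1 \<and> f \<in> dual_ball \<and> f x = 1"
  have "op_norm_on V N norm f = 1"
    unfolding op_norm_on_def
  proof (rule cSup_eq_maximum)
    show "1 \<in> (\<lambda>x. norm (f x)) ` {x \<in> V. N x \<le> 1}"
      using R by (intro image_eqI[where x = x]) auto
    show "r \<le> 1" if "r \<in> (\<lambda>x. norm (f x)) ` {x \<in> V. N x \<le> 1}" for r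
      using that R dual_ball_le[of f] by fastforce
  qed
  moreover have "f \<in> dual_on s V N"
    using R by (auto simp: dual_on_def bounded_linear_on_def dual_ball_def intro: exI[of _ 1])
  ultimately show "(x, f) \<in> state_pairs s V N"
    using R by (simp add: state_pairs_def)
qed

lemma state_exists:
  assumes "V \<noteq> {0}"
  obtains x f where "(x, f) \<in> state_pairs s V N"
proof -
  obtain q where q: "q \<in> V" "N q = 1" using unit_direction[OF assms zero_mem] by blast
  obtain f where "f \<in> dual_ball" "f q = of_real (N q)" using norming_functional[OF q(1)] by blast
  with q show thesis using that by (simp add: state_pairs_iff)
qed

lemma state_value_le:
  assumes "T \<in> operators_on s V N" "(x, f) \<in> state_pairs s V N"
  shows "norm (f (T x)) \<le> op_norm_on V N N T"
  using dual_ball_le[of f "T x"] operator_le_op_norm[OF assms(1), of x] assms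
  by (simp add: state_pairs_iff operator_mem)

lemma state_value_le_radius:
  assumes "T \<in> operators_on s V N" "(x, f) \<in> state_pairs s V N"
  shows "norm (f (T x)) \<le> numerical_radius s V N T"
proof -
  have "bdd_above ((\<lambda>(x, f). norm (f (T x))) ` state_pairs s V N)"
    using state_value_le[OF assms(1)] by (intro bdd_aboveI2[where M = "op_norm_on V N N T"]) auto
  from cSUP_upper[OF assms(2) this] show ?thesis
    by (simp add: numerical_radius_def)
qed

lemma numerical_radius_le:
  assumes "V \<noteq> {0}" "\<And>x f. (x, f) \<in> state_pairs s V N \<Longrightarrow> norm (f (T x)) \<le> c"
  shows "numerical_radius s V N T \<le> c"
  unfolding numerical_radius_def
proof (rule cSUP_least)
  show "state_pairs s V N \<noteq> {}" using state_exists[OF assms(1)] by blast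
qed (use assms in auto)

lemma numerical_radius_nonneg:
  assumes "V \<noteq> {0}" "T \<in> operators_on s V N"
  shows "0 \<le> numerical_radius s V N T"
proof -
  obtain x f where "(x, f) \<in> state_pairs s V N" using state_exists[OF assms(1)] .
  from state_value_le_radius[OF assms(2) this] show ?thesis using norm_ge_zero order_trans by blast
qed

lemma identity_operator:
  assumes "V \<noteq> {0}"
  shows "(\<lambda>x. x) \<in> operators_on s V N" "op_norm_on V N N (\<lambda>x. x) = 1"
proof -
  show "(\<lambda>x. x) \<in> operators_on s V N" by (rule operatorI[where K = 1]) auto
  obtain q where q: "q \<in> V" "N q = 1" using unit_direction[OF assms zero_mem] by blast
  show "op_norm_on V N N (\<lambda>x. x) = 1"
    unfolding op_norm_on_def
    by (rule cSup_eq_maximum) (use q in auto)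
qed

lemma numerical_index_le_radius:
  assumes "V \<noteq> {0}" "T \<in> operators_on s V N" "op_norm_on V N N T = 1"
  shows "numerical_index s V N \<le> numerical_radius s V N T"
  unfolding numerical_index_def
  using assms numerical_radius_nonneg[OF assms(1)]
  by (intro cINF_lower bdd_belowI2[where m = 0]) auto

lemma numerical_index_ge:
  assumes "V \<noteq> {0}"
    "\<And>T. T \<in> operators_on s V N \<Longrightarrow> op_norm_on V N N T = 1 \<Longrightarrow> c \<le> numerical_radius s V N T"
  shows "c \<le> numerical_index s V N"
  unfolding numerical_index_def
  using assms identity_operator[OF assms(1)] by (intro cINF_greatest) auto

lemma numerical_index_nonneg: "V \<noteq> {0} \<Longrightarrow> 0 \<le> numerical_index s V N"
  by (intro numerical_index_ge numerical_radius_nonneg)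

text \<open>
  The form in which a lower bound on the numerical index is used: normalising \<open>T\<close> turns it into a
  statement about operators of arbitrary norm, and \<open>y\<close> witnesses a lower bound for that norm.
\<close>

lemma state_attaining_index:
  assumes V: "V \<noteq> {0}" and T: "T \<in> operators_on s V N" and y: "y \<in> V" "N y \<le> 1" and e: "e > 0"
  obtains x f where "(x, f) \<in> state_pairs s V N"
    "numerical_index s V N * N (T y) - e < norm (f (T x))"
proof -
  let ?c = "op_norm_on V N N T" and ?n = "numerical_index s V N"
  have Ty: "N (T y) \<le> ?c"
    unfolding op_norm_on_def using y by (intro cSUP_upper operator_bounded T) auto
  have Ty0: "0 \<le> N (T y)" using T y by (simp add: operator_mem)
  show thesis
  proof (cases "?c > 0")
    case False
    then have "N (T y) = 0" using Ty Ty0 by simp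
    moreover obtain x f where xf: "(x, f) \<in> state_pairs s V N" using state_exists[OF V] .
    ultimately show thesis using that[OF xf] e norm_ge_zero[of "f (T x)"] by simp
  next
    case c: True
    define R where "R x = s (of_real (1 / ?c)) (T x)" for x
    have R: "R \<in> operators_on s V N"
    proof (rule operatorI[where K = 1])
      fix x assume "x \<in> V"
      then show "N (R x) \<le> 1 * N x"
        using operator_le_op_norm[OF T, of x] c T
        by (simp add: R_def N_scale operator_mem norm_divide field_simps)
    qed (use T in \<open>auto simp: R_def operator_mem operator_add operator_scale scale_right_distrib
        mult.commute\<close>)
    have NR: "N (R x) = N (T x) / ?c" if "x \<in> V" for x
      using that T c by (simp add: R_def N_scale operator_mem norm_divide)
    have "op_norm_on V N N R = 1"
    proof (rule antisym)
      show "op_norm_on V N N R \<le> 1"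
        unfolding op_norm_on_def
      proof (rule cSUP_least)
        fix x assume x: "x \<in> {x \<in> V. N x \<le> 1}"
        have "N (T x) \<le> ?c"
          using x by (subst op_norm_on_def) (intro cSUP_upper operator_bounded T, auto)
        then show "N (R x) \<le> 1" using NR[of x] x c by simp
      qed (auto intro: exI[of _ 0])
      show "1 \<le> op_norm_on V N N R"
      proof (rule ccontr)
        assume "\<not> ?thesis"
        then have "op_norm_on V N N R * ?c < ?c" using c by simp
        then obtain x where x: "x \<in> V" "N x \<le> 1" "op_norm_on V N N R * ?c < N (T x)"
          by (rule op_norm_approx)
        have "N (R x) \<le> op_norm_on V N N R"
          using x by (subst op_norm_on_def) (intro cSUP_upper operator_bounded R, auto)
        then show False using x NR[of x] c by (simp add: field_simps)
      qed
    qed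
    then have "?n \<le> numerical_radius s V N R" by (rule numerical_index_le_radius[OF V R])
    moreover have "\<exists>x f. (x, f) \<in> state_pairs s V N \<and> ?n - e / ?c < norm (f (R x))"
    proof (rule ccontr)
      assume "\<not> ?thesis"
      then have "numerical_radius s V N R \<le> ?n - e / ?c"
        by (intro numerical_radius_le V) (auto simp: not_less)
      with calculation have "e / ?c \<le> 0" by linarith
      then show False using e c by (simp add: field_simps)
    qed
    then obtain x f where xf: "(x, f) \<in> state_pairs s V N" "?n - e / ?c < norm (f (R x))" by blast
    have "norm (f (R x)) = norm (f (T x)) / ?c"
      using xf T c by (simp add: R_def state_pairs_iff dual_ball_scale operator_mem norm_mult norm_divide)
    then have "?n - e / ?c < norm (f (T x)) / ?c" using xf(2) by (simp only:)
    then have "(?n - e / ?c) * ?c < norm (f (T x))" using c by (simp only: pos_less_divide_eq)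
    then have "?n * ?c - e < norm (f (T x))" using c by (simp add: left_diff_distrib)
    moreover have "?n * N (T y) \<le> ?n * ?c"
      using Ty numerical_index_nonneg[OF V] by (rule mult_left_mono)
    ultimately show thesis using that[OF xf(1)] by simp
  qed
qed

text \<open>
  Lumer's argument. For a scalar \<open>c\<close> of modulus \<open>e\<close>, states show that \<open>I - c T\<close> shrinks no norm by
  more than the factor \<open>1 - e v\<close>. Applied to \<open>(I + c T) x\<close> this bounds the norm of \<open>(I + c T) x\<close> by
  \<open>(1 + e\<^sup>2) / (1 - e v)\<close>, since the terms linear in \<open>c\<close> cancel in \<open>(I - c T) (I + c T)\<close>. An almost
  norming functional \<open>f\<close> of \<open>x\<close> sees at least \<open>1 - e\<^sup>2 + e \<bar>f (T x)\<bar>\<close> there.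
\<close>

lemma almost_state_value:
  assumes T: "T \<in> operators_on s V N" "op_norm_on V N N T \<le> 1"
    and v: "\<And>x f. (x, f) \<in> state_pairs s V N \<Longrightarrow> norm (f (T x)) \<le> v" "0 \<le> v" "v \<le> 1"
    and x: "x \<in> V" "N x \<le> 1" and f: "f \<in> dual_ball" "1 - e\<^sup>2 \<le> norm (f x)" and e: "0 < e" "e < 1"
  shows "norm (f (T x)) \<le> v + 3 * e"
proof -
  have T_le: "N (T y) \<le> N y" if "y \<in> V" for y
  proof -
    have "op_norm_on V N N T * N y \<le> 1 * N y"
      using T(2) that by (intro mult_right_mono) auto
    then show ?thesis using operator_le_op_norm[OF T(1) that] by simp
  qed
  have T_mem: "T y \<in> V" if "y \<in> V" for y using operator_mem[OF T(1) that] .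
  (* A state of y shows that y - c T y is not much shorter than y. *)
  have lower: "(1 - norm c * v) * N y \<le> N (y - s c (T y))" if y: "y \<in> V" for y c
  proof (cases "y = 0")
    case True
    then show ?thesis using T(1) by (simp add: operator_0)
  next
    case False
    then have pos: "N y > 0" using y by (simp add: N_pos)
    let ?z = "s (of_real (1 / N y)) y"
    have z: "?z \<in> V" "N ?z = 1" using y pos by (simp_all add: N_scale norm_divide)
    obtain g where g: "g \<in> dual_ball" "g ?z = of_real (N ?z)"
      using norming_functional[OF z(1)] by blast
    have st: "(?z, g) \<in> state_pairs s V N" using z g by (simp add: state_pairs_iff)
    have "norm (g (T ?z)) \<le> v" by (rule v(1)[OF st])
    then have gT: "norm (g (T y)) \<le> v * N y"
      using pos y T(1) g by (simp add: operator_scale dual_ball_scale T_mem norm_mult norm_divide field_simps)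
    have gy: "g y = of_real (N y)"
      using g z pos y by (simp add: dual_ball_scale field_simps)
    have "norm (g y) - norm (c * g (T y)) \<le> norm (g y - c * g (T y))"
      by (rule norm_triangle_ineq2)
    also have "g y - c * g (T y) = g (y - s c (T y))"
      using y g by (simp add: dual_ball_diff dual_ball_scale T_mem)
    also have "norm (g (y - s c (T y))) \<le> N (y - s c (T y))"
      using y g by (intro dual_ball_le) (auto simp: T_mem)
    finally have "N y - norm c * norm (g (T y)) \<le> N (y - s c (T y))"
      using gy pos by (simp add: norm_mult)
    moreover have "norm c * norm (g (T y)) \<le> norm c * (v * N y)"
      using gT by (intro mult_left_mono) auto
    ultimately show ?thesis by (simp add: algebra_simps)
  qed
  obtain u1 where u1: "norm u1 = 1" "u1 * f x = of_real (norm (f x))" by (rule unit_phase)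
  obtain u2 where u2: "norm u2 = 1" "u2 * f (T x) = of_real (norm (f (T x)))" by (rule unit_phase)
  (* With this phase, f x and f (T x) add up without cancellation in f (x + c T x). *)
  define c where "c = of_real e * u2 / u1"
  have nc: "norm c = e" using u1 u2 e by (simp add: c_def norm_mult norm_divide)
  define y where "y = x + s c (T x)"
  have y: "y \<in> V" using x by (simp add: y_def T_mem)
  have "u1 \<noteq> 0" using u1 by auto
  have "norm (f x) + e * norm (f (T x)) \<le> N y"
  proof -
    have "u1 * f y = u1 * f x + of_real e * (u2 * f (T x))"
      using x f \<open>u1 \<noteq> 0\<close> by (simp add: y_def dual_ball_add dual_ball_scale T_mem c_def algebra_simps)
    also have "\<dots> = of_real (norm (f x) + e * norm (f (T x)))" using u1 u2 by simp
    finally have "norm (u1 * f y) = \<bar>norm (f x) + e * norm (f (T x))\<bar>" by (metis norm_of_real)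
    then have "norm (f y) = norm (f x) + e * norm (f (T x))" using u1 e by (simp add: norm_mult)
    then show ?thesis using dual_ball_le[OF f(1) y] by simp
  qed
  with f have A: "1 - e\<^sup>2 + e * norm (f (T x)) \<le> N y" by simp
  (* The first-order terms cancel in (I - cT)(I + cT). *)
  have "y - s c (T y) = x - s (c * c) (T (T x))"
    using x T(1) by (simp add: y_def operator_add operator_scale T_mem scale_right_distrib)
  then have "N (y - s c (T y)) \<le> N x + N (s (c * c) (T (T x)))"
    using N_triangle_diff[of x "s (c * c) (T (T x))"] x by (simp add: T_mem)
  also have "\<dots> \<le> 1 + e\<^sup>2"
  proof -
    have "N (T (T x)) \<le> 1" using T_le[of "T x"] T_le[of x] x T_mem by (auto intro: order_trans)
    then have "e * e * N (T (T x)) \<le> e * e * 1" using e by (intro mult_left_mono) auto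
    then show ?thesis using x nc T_mem by (simp add: N_scale norm_mult power2_eq_square)
  qed
  finally have "(1 - e * v) * N y \<le> 1 + e\<^sup>2" using lower[OF y, of c] nc by simp
  moreover have ev: "0 \<le> 1 - e * v" "e * v \<le> e"
    using e v mult_mono[of e 1 v 1] mult_left_mono[of v 1 e] by auto
  then have "(1 - e * v) * (1 - e\<^sup>2 + e * norm (f (T x))) \<le> (1 - e * v) * N y"
    using A by (intro mult_left_mono) auto
  ultimately have B: "(1 - e * v) * (1 - e\<^sup>2 + e * norm (f (T x))) \<le> 1 + e\<^sup>2" by simp
  let ?t = "norm (f (T x))"
  have t: "?t \<le> 1"
    using dual_ball_le[OF f(1) T_mem[OF x(1)]] T_le[OF x(1)] x(2) by simp
  have "e * ?t \<le> 2 * e\<^sup>2 + e * v + e * v * (e * ?t) - e * v * e\<^sup>2"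
    using B by (simp add: algebra_simps)
  moreover have "e * v * (e * ?t) \<le> e * (e * 1)"
  proof (rule mult_mono)
    show "e * ?t \<le> e * 1" using e t by (intro mult_left_mono) auto
  qed (use e ev in auto)
  moreover have "0 \<le> e * v * e\<^sup>2" using e v by simp
  ultimately have "e * ?t \<le> 2 * (e * e) + e * v + e * e"
    unfolding power2_eq_square by simp
  then have "e * ?t \<le> e * (v + 3 * e)" by (simp add: algebra_simps)
  then show ?thesis using e by simp
qed

end

section \<open>Sequence spaces with an absolute norm\<close>

definition cut :: "'l set \<Rightarrow> ('l \<Rightarrow> real) \<Rightarrow> 'l \<Rightarrow> real" where
  "cut F x = (\<lambda>l. if l \<in> F then x l else 0)"

lemma cut_apply [simp]: "cut F x l = (if l \<in> F then x l else 0)"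
  by (simp add: cut_def)

lemma cut_cut [simp]: "cut F (cut G x) = cut (F \<inter> G) x"
  by (auto simp: fun_eq_iff)

lemma cut_decompose: "x = cut F x + cut (- F) x"
  by (auto simp: fun_eq_iff)

lemma cut_empty [simp]: "cut {} x = 0"
  by (simp add: fun_eq_iff)

lemma fun_scale_apply [simp]: "fun_scale s c x l = s c (x l)"
  by (simp add: fun_scale_def)

locale absolute_space =
  fixes E :: "('l \<Rightarrow> real) set" and NE :: "('l \<Rightarrow> real) \<Rightarrow> real"
  assumes absolute: "absolute_norm E NE"
begin

sublocale normed_carrier real_fun_scale E NE
  using absolute by unfold_locales (simp add: absolute_norm_def banach_space_on_def)

lemma abs_mem: "(\<And>l. \<bar>b l\<bar> = \<bar>a l\<bar>) \<Longrightarrow> a \<in> E \<Longrightarrow> b \<in> E"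
  and abs_norm: "(\<And>l. \<bar>b l\<bar> = \<bar>a l\<bar>) \<Longrightarrow> a \<in> E \<Longrightarrow> NE b = NE a"
  using absolute unfolding absolute_norm_def by metis+

abbreviation unit_vec :: "'l \<Rightarrow> 'l \<Rightarrow> real" where
  "unit_vec l \<equiv> indicator {l}"

lemma unit_vec_mem [simp]: "unit_vec l \<in> E" and unit_vec_norm [simp]: "NE (unit_vec l) = 1"
  using absolute by (auto simp: absolute_norm_def)

lemma E_nontrivial: "E \<noteq> {0}"
  using unit_vec_mem[of undefined] unit_vec_norm[of undefined] N_0 by (metis singletonD zero_neq_one)

text \<open>
  Adding to \<open>x\<close> its copy with all signs except that of \<open>x l\<close> reversed leaves \<open>2 x l\<close> times a unit
  vector.
\<close>

lemma coordinate_le: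
  assumes x: "x \<in> E"
  shows "\<bar>x l\<bar> \<le> NE x"
proof -
  let ?y = "\<lambda>k. if k = l then x k else - x k"
  have y: "?y \<in> E" "NE ?y = NE x"
    using abs_mem[of ?y x] abs_norm[of ?y x] x by auto
  have "x + ?y = real_fun_scale (2 * x l) (unit_vec l)"
    by (auto simp: fun_eq_iff indicator_def)
  then have "NE (x + ?y) = 2 * \<bar>x l\<bar>"
    by (simp add: N_scale abs_mult)
  with N_triangle[OF x y(1)] y(2) show ?thesis by simp
qed

lemma limit_in_E:
  assumes u: "\<And>n. u n \<in> E" and r: "\<And>n m. n \<le> m \<Longrightarrow> NE (u m - u n) \<le> r n" "r \<longlonglongrightarrow> 0"
    and y: "\<And>l. (\<lambda>n. u n l) \<longlonglongrightarrow> y l"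
  shows "y \<in> E \<and> (\<lambda>n. NE (u n - y)) \<longlonglongrightarrow> 0"
proof -
  have cauchy: "\<exists>m0. \<forall>m\<ge>m0. \<forall>n\<ge>m0. NE (u m - u n) < e" if "e > 0" for e
  proof -
    obtain m0 where m0: "\<bar>r m0\<bar> < e / 2"
      using LIMSEQ_D[OF r(2), of "e / 2"] \<open>e > 0\<close> by auto
    have "NE (u m - u n) < e" if "m \<ge> m0" "n \<ge> m0" for m n
    proof -
      have "NE (u m - u n) = NE ((u m - u m0) - (u n - u m0))" by simp
      also have "\<dots> \<le> NE (u m - u m0) + NE (u n - u m0)" using u by (intro N_triangle_diff) auto
      also have "\<dots> \<le> r m0 + r m0" using r(1) that by (intro add_mono) auto
      finally show ?thesis using m0 by linarith
    qed
    then show ?thesis by blast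
  qed
  have "banach_space_on real_fun_scale E NE" using absolute by (simp add: absolute_norm_def)
  then obtain x where x: "x \<in> E" "(\<lambda>n. NE (u n - x)) \<longlonglongrightarrow> 0"
    using u cauchy unfolding banach_space_on_def by blast
  have "(\<lambda>n. u n l) \<longlonglongrightarrow> x l" for l
  proof -
    have "(\<lambda>n. u n l - x l) \<longlonglongrightarrow> 0"
    proof (rule Lim_null_comparison[OF _ x(2)])
      show "\<forall>\<^sub>F n in sequentially. norm (u n l - x l) \<le> NE (u n - x)"
        using coordinate_le[of "u n - x" l for n] u x by (intro always_eventually) simp
    qed
    then show ?thesis by (rule LIM_zero_cancel)
  qed
  with y have "x = y" by (auto simp: fun_eq_iff intro: LIMSEQ_unique)
  with x show ?thesis by simp
qed

lemma norm_limit_le: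
  assumes "\<And>n. u n \<in> E" "y \<in> E" "(\<lambda>n. NE (u n - y)) \<longlonglongrightarrow> 0" "\<And>n. NE (u n) \<le> c"
  shows "NE y \<le> c"
proof (rule LIMSEQ_le_const)
  show "(\<lambda>n. c + NE (u n - y)) \<longlonglongrightarrow> c" using tendsto_add[OF tendsto_const assms(3)] by simp
  have "NE y \<le> c + NE (u n - y)" for n
    using N_triangle_via[of y "u n"] assms(1,2) assms(4)[of n] N_diff_commute[of y "u n"] by simp
  then show "\<exists>n0. \<forall>n\<ge>n0. NE y \<le> c + NE (u n - y)" by blast
qed

text \<open>
  An expansion of \<open>y\<close> to base two with digits \<open>\<plusminus>\<bar>a\<bar>\<close>: the remainder is doubled and its sign times
  \<open>\<bar>a\<bar>\<close> is taken off, so it stays bounded by \<open>\<bar>a\<bar>\<close>.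
\<close>

fun doubling_remainder :: "('l \<Rightarrow> real) \<Rightarrow> ('l \<Rightarrow> real) \<Rightarrow> nat \<Rightarrow> 'l \<Rightarrow> real" where
  "doubling_remainder a y 0 = y"
| "doubling_remainder a y (Suc n) = (\<lambda>l. 2 * doubling_remainder a y n l -
     (if doubling_remainder a y n l \<ge> 0 then \<bar>a l\<bar> else - \<bar>a l\<bar>))"

text \<open>
  An absolute norm only compares sequences of equal modulus. Smaller moduli are reached as the sums
  of series of sign changes of \<open>a\<close> with coefficients \<open>1 / 2 ^ (n + 1)\<close>, which converge because \<open>E\<close>
  is complete.
\<close>

lemma solid:
  assumes a: "a \<in> E" and le: "\<And>l. \<bar>y l\<bar> \<le> \<bar>a l\<bar>"
  shows "y \<in> E" "NE y \<le> NE a"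
proof -
  define r where "r = doubling_remainder a y"
  define sa where "sa n = (\<lambda>l. if r n l \<ge> 0 then \<bar>a l\<bar> else - \<bar>a l\<bar>)" for n
  define u where "u n = (\<lambda>l. y l - r n l / 2 ^ n)" for n
  have r_Suc: "r (Suc n) = (\<lambda>l. 2 * r n l - sa n l)" for n by (simp add: r_def sa_def)
  have r_le: "\<bar>r n l\<bar> \<le> \<bar>a l\<bar>" for n l
  proof (induction n)
    case 0
    then show ?case using le by (simp add: r_def)
  next
    case (Suc n)
    then show ?case by (auto simp: r_Suc sa_def)
  qed
  have sa: "sa n \<in> E" "NE (sa n) = NE a" for n
    using abs_mem[of "sa n" a] abs_norm[of "sa n" a] a by (auto simp: sa_def)
  have step: "u (Suc n) = u n + real_fun_scale (1 / 2 ^ Suc n) (sa n)" for n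
    by (simp add: fun_eq_iff u_def r_Suc field_simps)
  have u0: "u 0 = 0" by (simp add: u_def r_def fun_eq_iff)
  have u: "u n \<in> E" for n
  proof (induction n)
    case 0
    show "u 0 \<in> E" unfolding u0 by (rule zero_mem)
  next
    case (Suc n)
    show "u (Suc n) \<in> E" unfolding step by (intro add_mem scale_mem sa Suc)
  qed
  have diff: "NE (u (n + k) - u n) \<le> (1 / 2 ^ n - 1 / 2 ^ (n + k)) * NE a" for n k
  proof (induction k)
    case 0
    show "NE (u (n + 0) - u n) \<le> (1 / 2 ^ n - 1 / 2 ^ (n + 0)) * NE a" by simp
  next
    case (Suc k)
    have IH: "NE (u (n + k) - u n) \<le> (1 / 2 ^ n - 1 / 2 ^ (n + k)) * NE a" by (rule Suc)
    have eq: "u (n + Suc k) - u n = (u (n + k) - u n) + real_fun_scale (1 / 2 ^ Suc (n + k)) (sa (n + k))"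
      unfolding add_Suc_right step[of "n + k"] by (simp only: algebra_simps)
    have "NE (u (n + Suc k) - u n) \<le> NE (u (n + k) - u n) + 1 / 2 ^ Suc (n + k) * NE a"
      unfolding eq using u sa
      by (intro order_trans[OF N_triangle]) (auto simp: N_scale simp del: power_Suc)
    also have "\<dots> \<le> (1 / 2 ^ n - 1 / 2 ^ (n + k)) * NE a + 1 / 2 ^ Suc (n + k) * NE a"
      using IH by simp
    also have "\<dots> = (1 / 2 ^ n - 1 / 2 ^ (n + Suc k)) * NE a"
      by (simp add: field_simps)
    finally show "NE (u (n + Suc k) - u n) \<le> (1 / 2 ^ n - 1 / 2 ^ (n + Suc k)) * NE a" .
  qed
  have "y \<in> E \<and> (\<lambda>n. NE (u n - y)) \<longlonglongrightarrow> 0"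
  proof (rule limit_in_E[where u = u and y = y and r = "\<lambda>n. (1 / 2) ^ n * NE a"], rule u)
    show "NE (u m - u n) \<le> (1 / 2) ^ n * NE a" if "n \<le> m" for n m
    proof -
      obtain k where m: "m = n + k" using le_Suc_ex[OF \<open>n \<le> m\<close>] by blast
      have "(1 / 2 ^ n - 1 / 2 ^ (n + k)) * NE a \<le> (1 / 2) ^ n * NE a"
        using a by (intro mult_right_mono) (auto simp: power_one_over)
      then show ?thesis using diff[of n k] m by simp
    qed
    show "(\<lambda>n. (1 / 2) ^ n * NE a) \<longlonglongrightarrow> 0"
      by (intro tendsto_mult_left_zero LIMSEQ_power_zero) simp
    show "(\<lambda>n. u n l) \<longlonglongrightarrow> y l" for l
    proof -
      have "(\<lambda>n. r n l / 2 ^ n) \<longlonglongrightarrow> 0"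
      proof (rule Lim_null_comparison)
        show "\<forall>\<^sub>F n in sequentially. norm (r n l / 2 ^ n) \<le> (1 / 2) ^ n * \<bar>a l\<bar>"
          using r_le by (intro always_eventually) (simp add: power_one_over field_simps)
        show "(\<lambda>n. (1 / 2) ^ n * \<bar>a l\<bar>) \<longlonglongrightarrow> 0"
          by (intro tendsto_mult_left_zero LIMSEQ_power_zero) simp
      qed
      from tendsto_diff[OF tendsto_const[of "y l"] this] show ?thesis by (simp add: u_def)
    qed
  qed
  then have y: "y \<in> E" "(\<lambda>n. NE (u n - y)) \<longlonglongrightarrow> 0" by auto
  have "NE (u n) \<le> NE a" for n
  proof -
    have "NE (u n) \<le> (1 - 1 / 2 ^ n) * NE a" using diff[of 0 n] by (simp add: u0)
    also have "\<dots> \<le> 1 * NE a" using a by (intro mult_right_mono) auto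
    finally show ?thesis by simp
  qed
  then show "y \<in> E" "NE y \<le> NE a" using y norm_limit_le[of u y] u by auto
qed

lemma cut_mem [simp]: "x \<in> E \<Longrightarrow> cut F x \<in> E"
  by (rule solid(1)[of x]) auto

lemma cut_norm_le: "x \<in> E \<Longrightarrow> NE (cut F x) \<le> NE x"
  by (rule solid(2)[of x]) auto

lemma cut_norm_mono: "cut G x \<in> E \<Longrightarrow> F \<subseteq> G \<Longrightarrow> NE (cut F x) \<le> NE (cut G x)"
  by (rule solid(2)[of "cut G x"]) auto

lemma cut_insert:
  "l \<notin> F \<Longrightarrow> cut (insert l F) x = cut F x + real_fun_scale (x l) (unit_vec l)"
  by (auto simp: fun_eq_iff indicator_def)

lemma cut_finite [simp]: "finite F \<Longrightarrow> cut F x \<in> E"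
proof (induction F rule: finite_induct)
  case empty
  show "cut {} x \<in> E" unfolding cut_empty by (rule zero_mem)
next
  case (insert l F)
  show "cut (insert l F) x \<in> E"
    unfolding cut_insert[OF insert(2)] by (intro add_mem scale_mem unit_vec_mem insert)
qed

lemma cut_norm_le_sum: "finite F \<Longrightarrow> NE (cut F x) \<le> (\<Sum>l\<in>F. \<bar>x l\<bar>)"
proof (induction F rule: finite_induct)
  case empty
  show "NE (cut {} x) \<le> (\<Sum>l\<in>{}. \<bar>x l\<bar>)" unfolding cut_empty by simp
next
  case (insert l F)
  have IH: "NE (cut F x) \<le> (\<Sum>l\<in>F. \<bar>x l\<bar>)" by (rule insert)
  have "NE (cut (insert l F) x) \<le> NE (cut F x) + \<bar>x l\<bar>"
    using N_triangle[of "cut F x" "real_fun_scale (x l) (unit_vec l)"] insert(1)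
    by (simp add: cut_insert[OF insert(2)] N_scale)
  with IH insert(1,2) show "NE (cut (insert l F) x) \<le> (\<Sum>l\<in>insert l F. \<bar>x l\<bar>)" by simp
qed

lemma dual_ball_cut:
  assumes g: "g \<in> dual_ball" and "finite F"
  shows "g (cut F x) = (\<Sum>l\<in>F. x l * g (unit_vec l))"
  using assms(2)
proof (induction F rule: finite_induct)
  case empty
  show "g (cut {} x) = (\<Sum>l\<in>{}. x l * g (unit_vec l))"
    unfolding cut_empty using g by (simp add: dual_ball_0)
next
  case (insert l F)
  have IH: "g (cut F x) = (\<Sum>l\<in>F. x l * g (unit_vec l))" by (rule insert)
  have "g (cut (insert l F) x) = g (cut F x) + x l * g (unit_vec l)"
    unfolding cut_insert[OF insert(2)] using g insert(1) by (simp add: dual_ball_add dual_ball_scale)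
  with IH insert(1,2) show "g (cut (insert l F) x) = (\<Sum>l\<in>insert l F. x l * g (unit_vec l))" by simp
qed

lemma dual_ball_abs_sum_le:
  assumes g: "g \<in> dual_ball" and x: "x \<in> E" and F: "finite F"
  shows "(\<Sum>l\<in>F. \<bar>g (unit_vec l) * x l\<bar>) \<le> NE x"
proof -
  define y where "y l = (if g (unit_vec l) * x l \<ge> 0 then x l else - x l)" for l
  have y: "y \<in> E" "NE y = NE x"
    using abs_mem[of y x] abs_norm[of y x] x by (auto simp: y_def)
  have "(\<Sum>l\<in>F. \<bar>g (unit_vec l) * x l\<bar>) = (\<Sum>l\<in>F. y l * g (unit_vec l))"
    by (intro sum.cong) (auto simp: y_def abs_if mult.commute)
  also have "\<dots> = g (cut F y)" using g F by (simp add: dual_ball_cut)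
  also have "\<dots> \<le> NE (cut F y)" using dual_ball_le[OF g, of "cut F y"] y by simp
  also have "\<dots> \<le> NE x" using cut_norm_le[of y F] y by simp
  finally show ?thesis .
qed

lemma dual_ball_coordinate_le: "g \<in> dual_ball \<Longrightarrow> \<bar>g (unit_vec l)\<bar> \<le> 1"
  using dual_ball_le[of g "unit_vec l"] by simp

lemma continuous_on_cut_norm:
  assumes "finite F"
  shows "continuous_on UNIV (\<lambda>x. NE (cut F x))"
proof -
  have "((\<lambda>x. NE (cut F x)) \<longlongrightarrow> NE (cut F v)) (at v)" for v
  proof -
    have "((\<lambda>x. NE (cut F x) - NE (cut F v)) \<longlongrightarrow> 0) (at v)"
    proof (rule Lim_null_comparison)
      have "\<bar>NE (cut F x) - NE (cut F v)\<bar> \<le> (\<Sum>l\<in>F. \<bar>x l - v l\<bar>)" for x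
      proof -
        have "cut F x - cut F v = cut F (x - v)" by (simp add: fun_eq_iff)
        then have "NE (cut F x - cut F v) \<le> (\<Sum>l\<in>F. \<bar>x l - v l\<bar>)"
          using cut_norm_le_sum[OF assms, of "x - v"] by simp
        then show ?thesis
          using assms N_triangle_via[of "cut F x" "cut F v"] N_triangle_via[of "cut F v" "cut F x"]
            N_diff_commute[of "cut F v" "cut F x"] by simp
      qed
      then show "\<forall>\<^sub>F x in at v. norm (NE (cut F x) - NE (cut F v)) \<le> (\<Sum>l\<in>F. \<bar>x l - v l\<bar>)"
        by (intro always_eventually) simp
      have coord: "((\<lambda>x. x l) \<longlongrightarrow> v l) (at v)" for l
        using continuous_on_product_coordinates[of l] unfolding continuous_on_def by auto
      have "((\<lambda>x. \<Sum>l\<in>F. \<bar>x l - v l\<bar>) \<longlongrightarrow> (\<Sum>l\<in>F. \<bar>v l - v l\<bar>)) (at v)"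
        by (intro tendsto_sum tendsto_rabs tendsto_diff coord tendsto_const)
      then show "((\<lambda>x. \<Sum>l\<in>F. \<bar>x l - v l\<bar>) \<longlongrightarrow> 0) (at v)" by simp
    qed
    then show ?thesis by (rule LIM_zero_cancel)
  qed
  then show ?thesis unfolding continuous_on_def by auto
qed

end

section \<open>Disjoint blocks and the Radon-Nikodym property\<close>

lemma sum_fun_apply: "(\<Sum>i\<in>I. f i) l = (\<Sum>i\<in>I. f i l)"
  for f :: "'i \<Rightarrow> 'l \<Rightarrow> 'a::comm_monoid_add"
proof (cases "finite I")
  case True
  then show ?thesis by (induction I rule: finite_induct) (simp_all del: sum.infinite)
qed simp

context absolute_space
begin

text \<open>
  A coordinate of a Bochner integrable function is only almost everywhere equal to a measurable
  function, because the measure space need not be complete; hence \<open>\<phi>\<close>.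
\<close>

lemma bochner_coordinate:
  assumes M: "finite_measure M" and f: "has_bochner_integral_on real_fun_scale E NE M f y"
  obtains \<phi> where "integrable M \<phi>" "AE w in M. f w l = \<phi> w" "integral\<^sup>L M \<phi> = y l"
proof -
  interpret finite_measure M by (rule M)
  obtain u where u: "\<And>n. simple_function M (u n)" "\<And>n w. w \<in> space M \<Longrightarrow> u n w \<in> E"
    and ae: "AE w in M. (\<lambda>n. NE (f w - u n w)) \<longlonglongrightarrow> 0"
    and mean: "(\<lambda>n. \<integral>\<^sup>+ w. ennreal (NE (f w - u n w)) \<partial>M) \<longlonglongrightarrow> 0"
    and int: "(\<lambda>n. NE (simple_integral_on real_fun_scale M (u n) - y)) \<longlonglongrightarrow> 0"
    using f unfolding has_bochner_integral_on_def by blast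
  have fE: "f w \<in> E" if "w \<in> space M" for w
    using f that by (simp add: has_bochner_integral_on_def)
  have yE: "y \<in> E" using f by (simp add: has_bochner_integral_on_def)
  define \<phi> where "\<phi> w = lim (\<lambda>n. u n w l)" for w
  have sf: "simple_function M (\<lambda>w. u n w l)" for n
    using simple_function_compose1[OF u(1), of "\<lambda>x. x l"] .
  then have meas_u [measurable]: "(\<lambda>w. u n w l) \<in> borel_measurable M" for n
    by (rule borel_measurable_simple_function)
  have meas [measurable]: "\<phi> \<in> borel_measurable M"
    unfolding \<phi>_def by measurable
  have int_u: "integrable M (\<lambda>w. u n w l)" for n
  proof (rule integrable_const_bound[where B = "Max ((\<lambda>x. \<bar>x l\<bar>) ` (u n ` space M))"])
    show "AE w in M. norm (u n w l) \<le> Max ((\<lambda>x. \<bar>x l\<bar>) ` (u n ` space M))"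
      using simple_functionD(1)[OF u(1)[of n]] by (intro AE_I2) (auto intro!: Max_ge)
  qed measurable
  have \<phi>: "AE w in M. f w l = \<phi> w"
  proof (rule AE_mp[OF ae], rule AE_I2, rule impI)
    fix w assume w: "w \<in> space M" "(\<lambda>n. NE (f w - u n w)) \<longlonglongrightarrow> 0"
    have "(\<lambda>n. f w l - u n w l) \<longlonglongrightarrow> 0"
      using coordinate_le[of "f w - u n w" l for n] w u fE
      by (intro Lim_null_comparison[OF _ w(2)] always_eventually) simp
    from tendsto_diff[OF tendsto_const[of "f w l"] this] have "(\<lambda>n. u n w l) \<longlonglongrightarrow> f w l" by simp
    then show "f w l = \<phi> w" unfolding \<phi>_def by (rule limI[symmetric])
  qed
  have dist: "(\<integral>\<^sup>+ w. ennreal (norm (\<phi> w - u n w l)) \<partial>M) \<le> (\<integral>\<^sup>+ w. ennreal (NE (f w - u n w)) \<partial>M)" for n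
  proof (rule nn_integral_mono_AE, rule AE_mp[OF \<phi>], rule AE_I2, rule impI)
    fix w assume "w \<in> space M" "f w l = \<phi> w"
    then show "ennreal (norm (\<phi> w - u n w l)) \<le> ennreal (NE (f w - u n w))"
      using coordinate_le[of "f w - u n w" l] u fE by (intro ennreal_leI) simp
  qed
  have lim: "(\<lambda>n. \<integral>\<^sup>+ w. ennreal (norm (\<phi> w - u n w l)) \<partial>M) \<longlonglongrightarrow> 0"
    by (rule tendsto_sandwich[OF _ _ tendsto_const mean]) (use dist in auto)
  have int_\<phi>: "integrable M \<phi>"
  proof -
    from order_tendstoD(2)[OF lim, of 1]
    obtain n where n: "(\<integral>\<^sup>+ w. ennreal (norm (\<phi> w - u n w l)) \<partial>M) < 1"
      by (auto simp: eventually_sequentially)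
    then have "(\<integral>\<^sup>+ w. ennreal (norm (\<phi> w - u n w l)) \<partial>M) < \<infinity>"
      by (rule less_trans) simp
    then have "integrable M (\<lambda>w. \<phi> w - u n w l)"
      by (intro integrableI_bounded) auto
    from Bochner_Integration.integrable_add[OF this int_u[of n]] show ?thesis by simp
  qed
  have "(\<lambda>n. integral\<^sup>L M (\<lambda>w. u n w l)) \<longlonglongrightarrow> integral\<^sup>L M \<phi>"
  proof (rule tendsto_L1_int[where F = sequentially])
    show "((\<lambda>n. \<integral>\<^sup>+ w. ennreal (norm (u n w l - \<phi> w)) \<partial>M) \<longlonglongrightarrow> 0)"
      using lim by (simp add: abs_minus_commute)
  qed (use int_u int_\<phi> in auto)
  moreover have "(\<lambda>n. integral\<^sup>L M (\<lambda>w. u n w l)) \<longlonglongrightarrow> y l"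
  proof -
    have eq: "integral\<^sup>L M (\<lambda>w. u n w l) = simple_integral_on real_fun_scale M (u n) l" for n
    proof -
      have fin: "finite (u n ` space M)" using simple_functionD(1)[OF u(1)] .
      have sets [measurable]: "u n -` {v} \<inter> space M \<in> sets M" for v
        using simple_functionD(2)[OF u(1)] .
      have "integral\<^sup>L M (\<lambda>w. u n w l) =
          integral\<^sup>L M (\<lambda>w. \<Sum>v\<in>u n ` space M. indicator (u n -` {v} \<inter> space M) w * v l)"
      proof (rule Bochner_Integration.integral_cong[OF refl])
        fix w assume w: "w \<in> space M"
        have "(\<Sum>v\<in>u n ` space M. indicator (u n -` {v} \<inter> space M) w * v l) =
            (\<Sum>v\<in>u n ` space M. if u n w = v then v l else 0)"
          using w by (intro sum.cong) (auto simp: indicator_def)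
        then show "u n w l = (\<Sum>v\<in>u n ` space M. indicator (u n -` {v} \<inter> space M) w * v l)"
          using w fin by (simp add: sum.delta')
      qed
      also have "\<dots> = (\<Sum>v\<in>u n ` space M. measure M (u n -` {v} \<inter> space M) * v l)"
        by (subst Bochner_Integration.integral_sum) (auto simp: less_top[symmetric])
      also have "\<dots> = simple_integral_on real_fun_scale M (u n) l"
        by (simp add: simple_integral_on_def sum_fun_apply)
      finally show ?thesis .
    qed
    have sE: "simple_integral_on real_fun_scale M (u n) \<in> E" for n
      unfolding simple_integral_on_def using u(2)[of _ n] by (intro sum_mem) auto
    have "(\<lambda>n. simple_integral_on real_fun_scale M (u n) l - y l) \<longlonglongrightarrow> 0"
      using coordinate_le[of "simple_integral_on real_fun_scale M (u n) - y" l for n] sE yE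
      by (intro Lim_null_comparison[OF _ int] always_eventually) simp
    then show ?thesis unfolding eq by (rule LIM_zero_cancel)
  qed
  ultimately have "integral\<^sup>L M \<phi> = y l" by (rule LIMSEQ_unique)
  with int_\<phi> \<phi> show thesis by (rule that)
qed

end

text \<open>
  The intervals with \<open>i \<le> k\<close> partition the half-open unit interval into \<open>k + 1\<close> equal parts.
\<close>

definition subinterval :: "nat \<Rightarrow> nat \<Rightarrow> real set" where
  "subinterval k i = {real i / real (Suc k)..<real (Suc i) / real (Suc k)}"

abbreviation unit_interval_measure :: "real measure" where
  "unit_interval_measure \<equiv> restrict_space lborel {0..<1}"

lemma finite_unit_interval_measure: "finite_measure unit_interval_measure"
  by (rule finite_measureI) (simp add: emeasure_restrict_space)

lemma subinterval_sets [measurable]: "subinterval k i \<in> sets borel"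
  by (simp add: subinterval_def)

lemma subinterval_subset: "i \<le> k \<Longrightarrow> subinterval k i \<subseteq> {0..<1}"
  by (auto simp: subinterval_def field_simps intro: order_trans)

lemma measure_subinterval: "i \<le> k \<Longrightarrow> measure unit_interval_measure (subinterval k i) = 1 / Suc k"
  using subinterval_subset[of i k]
  by (subst measure_restrict_space) (simp_all add: subinterval_def divide_right_mono diff_divide_distrib[symmetric])

lemma subinterval_cover:
  assumes "w \<in> {0..<1::real}"
  obtains i where "i \<le> k" "w \<in> subinterval k i"
proof -
  let ?i = "nat \<lfloor>w * Suc k\<rfloor>"
  have i: "real ?i \<le> w * Suc k" "w * Suc k < real ?i + 1"
    using assms by (simp_all add: of_nat_floor)
  have "w * Suc k < Suc k" using assms by simp
  with i(1) have "real ?i < Suc k" by linarith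
  then have "?i \<le> k" by simp
  moreover have "w \<in> subinterval k ?i"
    using i by (simp add: subinterval_def field_simps)
  ultimately show thesis by (rule that)
qed

locale absolute_rnp_space = absolute_space E NE
  for E :: "('l \<Rightarrow> real) set" and NE +
  assumes rnp: "radon_nikodym_property real_fun_scale E NE"
begin

text \<open>
  Give all coordinates in block \<open>(k, i)\<close> with \<open>i \<le> k\<close> the interval \<open>subinterval k i\<close>. The measure
  \<open>A \<mapsto> (x l * \<bar>A \<inter> H l\<bar>)\<close>, where \<open>H l\<close> is the interval given to \<open>l\<close>, has values in \<open>E\<close> because
  the lengths tend to \<open>0\<close> with \<open>k\<close>, and its variation is at most Lebesgue measure. A density would be
  \<open>w \<mapsto> (x l * indicator (H l) w)\<close>. At level \<open>k\<close>, exactly one of its \<open>k + 1\<close> blocks is nonzero, and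
  it moves with \<open>w\<close>; a fixed vector is therefore at distance at least \<open>\<delta> / 2\<close> from the density
  except for \<open>w\<close> in one interval of length \<open>1 / (k + 1)\<close>. A simple function with few values compared
  with \<open>k\<close> cannot approximate such a density in the mean.
\<close>

lemma no_bounded_block_array:
  fixes B :: "nat \<Rightarrow> nat \<Rightarrow> 'l set"
  assumes fin: "\<And>k i. finite (B k i)"
    and disj: "\<And>k i k' i' l. l \<in> B k i \<Longrightarrow> l \<in> B k' i' \<Longrightarrow> k = k' \<and> i = i'"
    and bound: "\<And>F. finite F \<Longrightarrow> F \<subseteq> (\<Union>k i. B k i) \<Longrightarrow> NE (cut F x) \<le> 1"
    and \<delta>: "\<delta> > 0" "\<And>k i. \<delta> \<le> NE (cut (B k i) x)"
  shows False
proof -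
  let ?M = unit_interval_measure
  interpret M: finite_measure ?M by (rule finite_unit_interval_measure)
  define H where "H l = (\<Union>(k, i)\<in>{(k, i). l \<in> B k i \<and> i \<le> k}. subinterval k i)" for l
  have H_eq: "H l = subinterval k i" if "l \<in> B k i" "i \<le> k" for l k i
    using that disj[OF that(1)] unfolding H_def by blast
  have H_empty: "H l = {}" if "\<And>k i. l \<in> B k i \<Longrightarrow> \<not> i \<le> k" for l
    using that unfolding H_def by blast
  have H_sub: "H l \<subseteq> {0..<1}" for l
    using subinterval_subset unfolding H_def by blast
  have H_sets: "H l \<in> sets ?M" for l
  proof -
    have "H l \<in> sets borel" unfolding H_def by (intro sets.countable_UN') auto
    then show ?thesis using H_sub by (auto simp: sets_restrict_space_iff)
  qed
  define G where "G A = (\<lambda>l. x l * measure ?M (A \<inter> H l))" for A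
  define U where "U K = (\<Union>k<K. \<Union>i\<le>k. B k i)" for K
  have U_fin: "finite (U K)" for K using fin by (auto simp: U_def)
  have U_bound: "NE (cut F x) \<le> 1" if "F \<subseteq> U K" for F K
  proof (rule bound)
    show "finite F" using that U_fin[of K] by (rule finite_subset)
    have "U K \<subseteq> (\<Union>k i. B k i)" by (auto simp: U_def)
    with that show "F \<subseteq> (\<Union>k i. B k i)" by (rule order_trans)
  qed
  have mA: "measure ?M (A \<inter> H l) \<le> measure ?M A" if "A \<in> sets ?M" for A l
    using that H_sets by (intro M.finite_measure_mono) auto
  have mH: "measure ?M (A \<inter> H l) \<le> 1 / Suc k" if "A \<in> sets ?M" "l \<in> B k i" "i \<le> k" for A l k i
    using M.finite_measure_mono[of "A \<inter> H l" "H l"] that H_sets[of l] H_eq[OF that(2,3)]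
      measure_subinterval[OF that(3)] by simp
  have G_lim: "G A \<in> E \<and> (\<lambda>K. NE (cut (U K) (G A) - G A)) \<longlonglongrightarrow> 0" if A: "A \<in> sets ?M" for A
  proof (rule limit_in_E[where r = "\<lambda>n. 1 / real (Suc n)"])
    show "cut (U K) (G A) \<in> E" for K using U_fin by simp
    show "(\<lambda>n. 1 / real (Suc n)) \<longlonglongrightarrow> 0"
      using LIMSEQ_inverse_real_of_nat by (simp add: inverse_eq_divide)
    show "NE (cut (U m) (G A) - cut (U n) (G A)) \<le> 1 / real (Suc n)" if "n \<le> m" for n m
    proof -
      have "NE (cut (U m) (G A) - cut (U n) (G A)) \<le> NE (real_fun_scale (1 / real (Suc n)) (cut (U m) x))"
      proof (rule solid(2))
        show "real_fun_scale (1 / real (Suc n)) (cut (U m) x) \<in> E" using U_fin by simp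
        fix l
        have "U n \<subseteq> U m" using that by (force simp: U_def)
        show "\<bar>(cut (U m) (G A) - cut (U n) (G A)) l\<bar> \<le> \<bar>real_fun_scale (1 / real (Suc n)) (cut (U m) x) l\<bar>"
        proof (cases "l \<in> U m - U n")
          case True
          then obtain k i where ki: "l \<in> B k i" "i \<le> k" "\<not> k < n" by (auto simp: U_def)
          have "measure ?M (A \<inter> H l) \<le> 1 / Suc k" using mH[OF A ki(1,2)] .
          also have "\<dots> \<le> 1 / Suc n" using ki by (intro divide_left_mono) auto
          finally have "measure ?M (A \<inter> H l) * \<bar>x l\<bar> \<le> 1 / Suc n * \<bar>x l\<bar>"
            by (intro mult_right_mono) auto
          then show ?thesis using True by (simp add: G_def abs_mult mult.commute)
        next
          case False
          then show ?thesis using \<open>U n \<subseteq> U m\<close> by auto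
        qed
      qed
      also have "\<dots> = 1 / real (Suc n) * NE (cut (U m) x)" using U_fin by (subst N_scale) auto
      also have "\<dots> \<le> 1 / real (Suc n) * 1" using U_bound by (intro mult_left_mono) auto
      finally show ?thesis by simp
    qed
    show "(\<lambda>n. cut (U n) (G A) l) \<longlonglongrightarrow> G A l" for l
    proof (cases "\<exists>k i. l \<in> B k i \<and> i \<le> k")
      case True
      then obtain k i where "l \<in> B k i" "i \<le> k" by blast
      then have "l \<in> U n" if "n \<ge> Suc k" for n using that unfolding U_def by force
      then have "\<forall>\<^sub>F n in sequentially. G A l = cut (U n) (G A) l"
        by (auto simp: eventually_sequentially intro!: exI[of _ "Suc k"])
      then show ?thesis by (rule Lim_transform_eventually[OF tendsto_const])
    next
      case False
      then have "G A l = 0" using H_empty[of l] by (auto simp: G_def)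
      then have "cut (U n) (G A) l = 0" for n by simp
      then show ?thesis using \<open>G A l = 0\<close> by (simp only: tendsto_const)
    qed
  qed
  then have GE: "G A \<in> E" if "A \<in> sets ?M" for A using that by blast
  have G_norm: "NE (G A) \<le> measure ?M A" if A: "A \<in> sets ?M" for A
  proof (rule norm_limit_le[where u = "\<lambda>K. cut (U K) (G A)"])
    show "NE (cut (U K) (G A)) \<le> measure ?M A" for K
    proof -
      have "NE (cut (U K) (G A)) \<le> NE (real_fun_scale (measure ?M A) (cut (U K) x))"
        using U_fin mA[OF A] by (intro solid(2)) (auto simp: G_def abs_mult mult.commute intro: mult_left_mono)
      also have "\<dots> = measure ?M A * NE (cut (U K) x)" using U_fin by (subst N_scale) auto
      also have "\<dots> \<le> measure ?M A * 1" using U_bound by (intro mult_left_mono) auto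
      finally show ?thesis by simp
    qed
  qed (use G_lim[OF A] U_fin in auto)
  have G_union: "G (A \<union> A') = G A + G A'"
    if "A \<in> sets ?M" "A' \<in> sets ?M" "A \<inter> A' = {}" for A A'
  proof
    fix l
    have "measure ?M ((A \<union> A') \<inter> H l) = measure ?M (A \<inter> H l) + measure ?M (A' \<inter> H l)"
      unfolding Int_Un_distrib2 using that H_sets by (intro M.finite_measure_Union) auto
    then show "G (A \<union> A') l = (G A + G A') l" by (simp add: G_def algebra_simps)
  qed
  have "vector_measure_on E NE ?M G"
    unfolding vector_measure_on_def
  proof (intro conjI ballI allI impI GE)
    fix A :: "nat \<Rightarrow> real set" assume "range A \<subseteq> sets ?M \<and> disjoint_family A"
    then have A: "\<And>n. A n \<in> sets ?M" and disjA: "disjoint_family A" by auto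
    define R where "R n = (\<Union>i\<in>{n..}. A i)" for n
    have R: "R n \<in> sets ?M" for n using A by (auto simp: R_def)
    have R_Suc: "R n = A n \<union> R (Suc n)" for n
    proof -
      have "{n..} = insert n {Suc n..}" by auto
      then show ?thesis by (simp add: R_def)
    qed
    have A_R: "A n \<inter> R (Suc n) = {}" for n
    proof -
      have "A n \<inter> A i = {}" if "i \<ge> Suc n" for i
        using disjA that unfolding disjoint_family_on_def by (metis Suc_n_not_le_n UNIV_I)
      then show ?thesis by (auto simp: R_def)
    qed
    have R0: "(\<Union>i. A i) = R 0" by (simp add: R_def atLeast_0)
    have "G (R 0) = (\<Sum>i<n. G (A i)) + G (R n)" for n
    proof (induction n)
      case 0
      show "G (R 0) = (\<Sum>i<0. G (A i)) + G (R 0)" by simp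
    next
      case (Suc n)
      have IH: "G (R 0) = (\<Sum>i<n. G (A i)) + G (R n)" by (rule Suc)
      have "G (R n) = G (A n) + G (R (Suc n))"
        using G_union[OF A R A_R, of n] R_Suc[of n] by simp
      then show "G (R 0) = (\<Sum>i<Suc n. G (A i)) + G (R (Suc n))"
        unfolding IH by (simp add: add.assoc)
    qed
    then have rest: "(\<Sum>i<n. G (A i)) - G (R 0) = - G (R n)" for n
      by (metis add_diff_cancel_left' minus_diff_eq)
    have mR: "measure ?M (R 0) = (\<Sum>i<n. measure ?M (A i)) + measure ?M (R n)" for n
    proof (induction n)
      case (Suc n)
      have "measure ?M (R n) = measure ?M (A n) + measure ?M (R (Suc n))"
        unfolding R_Suc[of n] using A R A_R by (intro M.finite_measure_Union) auto
      with Suc show ?case by simp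
    qed simp
    have mR': "measure ?M (R 0) - (\<Sum>i<n. measure ?M (A i)) = measure ?M (R n)" for n
      using mR[of n] by linarith
    have "(\<lambda>n. \<Sum>i<n. measure ?M (A i)) \<longlonglongrightarrow> measure ?M (R 0)"
      using M.finite_measure_UNION[of A] A disjA unfolding R0 sums_def by auto
    from tendsto_diff[OF tendsto_const[of "measure ?M (R 0)"] this]
    have "(\<lambda>n. measure ?M (R n)) \<longlonglongrightarrow> 0" by (simp only: mR' diff_self)
    moreover have "\<forall>n. norm (NE (G (R n))) \<le> measure ?M (R n)"
      using G_norm[OF R] N_nonneg[OF GE[OF R]] by simp
    ultimately have "(\<lambda>n. NE (G (R n))) \<longlonglongrightarrow> 0"
      by (rule Lim_null_comparison[OF always_eventually, rotated])
    then show "(\<lambda>n. NE ((\<Sum>i<n. G (A i)) - G (\<Union>i. A i))) \<longlonglongrightarrow> 0"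
      by (simp only: R0 rest N_minus[OF GE[OF R]])
  qed
  moreover have "bounded_variation_on NE ?M G"
    unfolding bounded_variation_on_def
  proof (intro exI[of _ "measure ?M (space ?M)"] allI impI)
    fix P assume P: "finite P \<and> P \<subseteq> sets ?M \<and> disjoint P"
    then have "(\<Sum>A\<in>P. NE (G A)) \<le> (\<Sum>A\<in>P. measure ?M A)" by (intro sum_mono G_norm) auto
    also have "\<dots> = measure ?M (\<Union>A\<in>P. A)"
      using P by (intro M.finite_measure_finite_Union[symmetric])
        (auto simp: disjoint_family_on_def disjoint_def)
    also have "\<dots> \<le> measure ?M (space ?M)" by (rule M.bounded_measure)
    finally show "(\<Sum>A\<in>P. NE (G A)) \<le> measure ?M (space ?M)" .
  qed
  moreover have "G A = 0" if A: "A \<in> null_sets ?M" for A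
  proof -
    have A': "A \<in> sets ?M" using A by (rule null_setsD2)
    have "measure ?M A = 0" using A by (simp add: measure_def null_setsD1)
    then have "NE (G A) \<le> 0" using G_norm[OF A'] by simp
    then have "NE (G A) = 0" using N_nonneg[OF GE[OF A']] by linarith
    then show ?thesis using N_eq_0[OF GE[OF A']] by blast
  qed
  ultimately have "\<exists>g. \<forall>A\<in>sets ?M.
      has_bochner_integral_on real_fun_scale E NE ?M (\<lambda>w. real_fun_scale (indicator A w) (g w)) (G A)"
    using M.finite_measure_axioms
    by (intro rnp[unfolded radon_nikodym_property_def, rule_format] conjI ballI)
  then obtain g where g: "\<And>A. A \<in> sets ?M \<Longrightarrow>
      has_bochner_integral_on real_fun_scale E NE ?M (\<lambda>w. real_fun_scale (indicator A w) (g w)) (G A)"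
    by blast
  have density: "AE w in ?M. g w l = x l * indicator (H l) w" for l
  proof -
    obtain \<phi> where \<phi>: "integrable ?M \<phi>" "AE w in ?M. real_fun_scale (indicator (space ?M) w) (g w) l = \<phi> w"
      by (rule bochner_coordinate[OF M.finite_measure_axioms g[OF sets.top]])
    have \<phi>_eq: "AE w in ?M. g w l = \<phi> w"
      by (rule AE_mp[OF \<phi>(2)]) (auto intro!: AE_I2)
    have "AE w in ?M. \<phi> w = x l * indicator (H l) w"
    proof (rule density_unique_real[OF \<phi>(1)])
      show "integrable ?M (\<lambda>w. x l * indicator (H l) w)"
        using H_sets[of l] by (auto simp: less_top[symmetric])
      fix A assume A: "A \<in> sets ?M"
      obtain \<psi> where \<psi>: "integrable ?M \<psi>" "AE w in ?M. real_fun_scale (indicator A w) (g w) l = \<psi> w"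
        "integral\<^sup>L ?M \<psi> = G A l"
        by (rule bochner_coordinate[OF M.finite_measure_axioms g[OF A]])
      have "AE w in ?M. indicator A w * \<phi> w = \<psi> w"
        using \<psi>(2) \<phi>_eq by eventually_elim auto
      moreover have "integrable ?M (\<lambda>w. indicator A w * \<phi> w)"
        using integrable_mult_indicator[OF A \<phi>(1)] by simp
      ultimately have "integral\<^sup>L ?M (\<lambda>w. indicator A w * \<phi> w) = integral\<^sup>L ?M \<psi>"
        using \<psi>(1) by (intro integral_cong_AE) auto
      also have "\<dots> = integral\<^sup>L ?M (\<lambda>w. x l * indicator (A \<inter> H l) w)"
      proof -
        have "A \<inter> H l \<inter> {0..<1} = A \<inter> H l" using H_sub[of l] by auto
        then show ?thesis
          using \<psi>(3) A H_sets[of l] by (simp add: G_def less_top[symmetric])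
      qed
      finally show "(LINT w:A|?M. \<phi> w) = (LINT w:A|?M. x l * indicator (H l) w)"
        unfolding set_lebesgue_integral_def
        by (simp add: indicator_inter_arith mult.left_commute)
    qed
    with \<phi>_eq show ?thesis by eventually_elim simp
  qed
  obtain u where u: "simple_function ?M u" "\<And>w. w \<in> space ?M \<Longrightarrow> u w \<in> E"
    and mean: "(\<integral>\<^sup>+ w. ennreal (NE (real_fun_scale (indicator (space ?M) w) (g w) - u w)) \<partial>?M) < ennreal (\<delta> / 4)"
  proof -
    obtain u where u: "\<And>n. simple_function ?M (u n)" "\<And>n w. w \<in> space ?M \<Longrightarrow> u n w \<in> E"
      and mean: "(\<lambda>n. \<integral>\<^sup>+ w. ennreal (NE (real_fun_scale (indicator (space ?M) w) (g w) - u n w)) \<partial>?M) \<longlonglongrightarrow> 0"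
      using g[OF sets.top] unfolding has_bochner_integral_on_def by blast
    have "0 < ennreal (\<delta> / 4)" using \<delta> by simp
    from order_tendstoD(2)[OF mean this] obtain n where
      "(\<integral>\<^sup>+ w. ennreal (NE (real_fun_scale (indicator (space ?M) w) (g w) - u n w)) \<partial>?M) < ennreal (\<delta> / 4)"
      by (auto simp: eventually_sequentially)
    with u show thesis using that[of "u n"] by blast
  qed
  have gE: "g w \<in> E" if "w \<in> space ?M" for w
  proof -
    have "real_fun_scale (indicator (space ?M) w) (g w) \<in> E"
      using g[OF sets.top] that unfolding has_bochner_integral_on_def by blast
    moreover have "real_fun_scale (indicator (space ?M) w) (g w) = g w" using that by (simp add: fun_eq_iff)
    ultimately show ?thesis by simp
  qed
  (* With this level, the exceptional intervals of all values of u together have measure at most 1/2. *)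
  define k where "k = 2 * card (u ` space ?M)"
  (* The subinterval outside which the value v is far from the density: that of a block in which
     v is large, if there is one, and otherwise any. *)
  define i0 where "i0 v = (SOME i. i \<le> k \<and> (\<delta> / 2 \<le> NE (cut (B k i) v) \<or> (\<forall>j\<le>k. NE (cut (B k j) v) < \<delta> / 2)))" for v
  have i0: "i0 v \<le> k" "\<delta> / 2 \<le> NE (cut (B k (i0 v)) v) \<or> (\<forall>j\<le>k. NE (cut (B k j) v) < \<delta> / 2)" for v
  proof -
    have "\<exists>i. i \<le> k \<and> (\<delta> / 2 \<le> NE (cut (B k i) v) \<or> (\<forall>j\<le>k. NE (cut (B k j) v) < \<delta> / 2))"
      by (metis le0 not_less)
    from someI_ex[OF this] show "i0 v \<le> k" "\<delta> / 2 \<le> NE (cut (B k (i0 v)) v) \<or> (\<forall>j\<le>k. NE (cut (B k j) v) < \<delta> / 2)"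
      unfolding i0_def by auto
  qed
  define Z where "Z = (\<Union>v\<in>u ` space ?M. subinterval k (i0 v))"
  have fin_u: "finite (u ` space ?M)" using simple_functionD(1)[OF u(1)] .
  have J_sets: "subinterval k i \<in> sets ?M" if "i \<le> k" for i
    using subinterval_subset[OF that] by (auto simp: sets_restrict_space_iff)
  have Z_sets: "Z \<in> sets ?M"
    unfolding Z_def using fin_u J_sets i0 by (intro sets.finite_UN) auto
  have "measure ?M Z \<le> (\<Sum>v\<in>u ` space ?M. measure ?M (subinterval k (i0 v)))"
    unfolding Z_def using fin_u J_sets i0 by (intro M.finite_measure_subadditive_finite) auto
  also have "\<dots> = card (u ` space ?M) / Suc k"
    using i0 measure_subinterval by simp
  also have "\<dots> \<le> 1 / 2" by (simp add: k_def field_simps)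
  finally have Z_small: "measure ?M Z \<le> 1 / 2" .
  have "AE w in ?M. \<forall>i\<le>k. \<forall>l\<in>B k i. g w l = x l * indicator (H l) w"
  proof -
    have "AE w in ?M. \<forall>l\<in>(\<Union>i\<le>k. B k i). g w l = x l * indicator (H l) w"
      by (rule AE_finite_allI) (use fin density in auto)
    then show ?thesis by eventually_elim auto
  qed
  then have "AE w in ?M. ennreal (\<delta> / 2) * indicator (space ?M - Z) w \<le>
      ennreal (NE (real_fun_scale (indicator (space ?M) w) (g w) - u w))"
  proof (rule AE_mp, intro AE_I2 impI)
    fix w assume w: "w \<in> space ?M" and coord: "\<forall>i\<le>k. \<forall>l\<in>B k i. g w l = x l * indicator (H l) w"
    have g_eq: "real_fun_scale (indicator (space ?M) w) (g w) = g w" using w by (simp add: fun_eq_iff)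
    have inE: "g w - u w \<in> E" "u w \<in> E" using gE[OF w] u(2)[OF w] by auto
    show "ennreal (\<delta> / 2) * indicator (space ?M - Z) w \<le>
        ennreal (NE (real_fun_scale (indicator (space ?M) w) (g w) - u w))"
    proof (cases "w \<in> Z")
      case False
      then have wJ: "w \<notin> subinterval k (i0 (u w))" using w by (auto simp: Z_def)
      have "\<delta> / 2 \<le> NE (g w - u w)"
      proof (cases "\<delta> / 2 \<le> NE (cut (B k (i0 (u w))) (u w))")
        case True
        (* The density vanishes on this block at w, whereas the value of u does not. *)
        have "cut (B k (i0 (u w))) (g w - u w) = - cut (B k (i0 (u w))) (u w)"
          using coord i0(1)[of "u w"] wJ H_eq by (auto simp: fun_eq_iff)
        then have "NE (cut (B k (i0 (u w))) (u w)) = NE (cut (B k (i0 (u w))) (g w - u w))"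
          using fin by simp
        with True cut_norm_le[OF inE(1), of "B k (i0 (u w))"] show ?thesis by simp
      next
        case False
        then have small: "NE (cut (B k j) (u w)) < \<delta> / 2" if "j \<le> k" for j using i0(2)[of "u w"] that by blast
        obtain i where i: "i \<le> k" "w \<in> subinterval k i"
          using subinterval_cover[of w k] w by auto
        have "cut (B k i) x = cut (B k i) (g w - u w) + cut (B k i) (u w)"
          using coord i H_eq by (auto simp: fun_eq_iff)
        then have "NE (cut (B k i) x) \<le> NE (cut (B k i) (g w - u w)) + NE (cut (B k i) (u w))"
          using fin N_triangle by simp
        with \<delta>(2)[of k i] small[OF i(1)] cut_norm_le[OF inE(1), of "B k i"] show ?thesis by linarith
      qed
      then show ?thesis unfolding g_eq by (auto simp: indicator_def intro: ennreal_leI)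
    qed simp
  qed
  from nn_integral_mono_AE[OF this]
  have "(\<integral>\<^sup>+ w. ennreal (\<delta> / 2) * indicator (space ?M - Z) w \<partial>?M) < ennreal (\<delta> / 4)"
    using mean by (rule le_less_trans)
  moreover have "(\<integral>\<^sup>+ w. ennreal (\<delta> / 2) * indicator (space ?M - Z) w \<partial>?M) = ennreal (\<delta> / 2 * measure ?M (space ?M - Z))"
    unfolding nn_integral_cmult_indicator[OF sets.compl_sets[OF Z_sets]] M.emeasure_eq_measure
    using \<delta> by (intro ennreal_mult[symmetric]) auto
  moreover have "measure ?M (space ?M - Z) \<ge> 1 / 2"
  proof -
    have "measure ?M (space ?M) = 1"
      by (subst measure_restrict_space) auto
    then show ?thesis using Z_small M.finite_measure_compl[OF Z_sets] by simp
  qed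
  then have "\<delta> / 2 * measure ?M (space ?M - Z) \<ge> \<delta> / 2 * (1 / 2)" using \<delta> by (intro mult_left_mono) auto
  ultimately show False using \<delta> by (simp add: ennreal_less_iff)
qed

lemma bounded_blocks_small:
  assumes fin: "\<And>n. finite (D n)" and disj: "disjoint_family D"
    and bound: "\<And>F. finite F \<Longrightarrow> F \<subseteq> (\<Union>n. D n) \<Longrightarrow> NE (cut F x) \<le> 1" and \<delta>: "\<delta> > 0"
  obtains n :: nat where "NE (cut (D n) x) < \<delta>"
proof (rule ccontr)
  assume "\<not> thesis"
  then have large: "\<delta> \<le> NE (cut (D n) x)" for n using that not_less by blast
  show False
  proof (rule no_bounded_block_array[where B = "\<lambda>k i. D (prod_encode (k, i))"])
    show "k = k' \<and> i = i'" if "l \<in> D (prod_encode (k, i))" "l \<in> D (prod_encode (k', i'))" for k i k' i' l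
    proof -
      have "prod_encode (k, i) = prod_encode (k', i')"
        using disj that unfolding disjoint_family_on_def by blast
      then show ?thesis by simp
    qed
    show "NE (cut F x) \<le> 1" if "finite F" "F \<subseteq> (\<Union>k i. D (prod_encode (k, i)))" for F
      using that by (intro bound) auto
  qed (use fin \<delta> large in auto)
qed

end

section \<open>Slices of small diameter\<close>

lemma disjoint_sequence_exists:
  assumes "\<And>F. finite F \<Longrightarrow> \<exists>D. finite D \<and> D \<inter> F = {} \<and> P D"
  obtains D :: "nat \<Rightarrow> 'l set" where "disjoint_family D" "\<And>n. finite (D n)" "\<And>n. P (D n)"
proof -
  obtain pick where pick: "\<And>F. finite F \<Longrightarrow> finite (pick F) \<and> pick F \<inter> F = {} \<and> P (pick F)"
    using assms by metis
  define G where "G = rec_nat {} (\<lambda>_ F. F \<union> pick F)"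
  have G: "G 0 = {}" "G (Suc n) = G n \<union> pick (G n)" for n by (simp_all add: G_def)
  have fin: "finite (G n)" for n by (induction n) (use G pick in auto)
  have mono: "G m \<subseteq> G n" if "m \<le> n" for m n
    using that by (rule lift_Suc_mono_le[rotated]) (simp add: G)
  have "pick (G m) \<inter> pick (G n) = {}" if "m < n" for m n
  proof -
    have "pick (G m) \<subseteq> G n" using mono[of "Suc m" n] that by (auto simp: G)
    then show ?thesis using pick[OF fin[of n]] by blast
  qed
  then have "disjoint_family (\<lambda>n. pick (G n))"
    unfolding disjoint_family_on_def by (metis inf_commute linorder_neqE_nat)
  with fin pick show thesis using that[of "\<lambda>n. pick (G n)"] by blast
qed

text \<open>
  The slice of \<open>K\<close> on which \<open>y\<close> is within \<open>b\<close> of its supremum, phrased without the supremum.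
\<close>

definition near_max :: "'w set \<Rightarrow> ('w \<Rightarrow> real) \<Rightarrow> real \<Rightarrow> 'w set" where
  "near_max K y b = {w \<in> K. \<forall>v\<in>K. y v \<le> y w + b}"

lemma near_maxI: "w \<in> K \<Longrightarrow> (\<And>v. v \<in> K \<Longrightarrow> y v \<le> y w + b) \<Longrightarrow> w \<in> near_max K y b"
  by (simp add: near_max_def)

lemma near_maxD: "w \<in> near_max K y b \<Longrightarrow> w \<in> K" "w \<in> near_max K y b \<Longrightarrow> v \<in> K \<Longrightarrow> y v \<le> y w + b"
  by (simp_all add: near_max_def)

lemma near_max_nonempty:
  assumes "K \<noteq> {}" "\<And>w. w \<in> K \<Longrightarrow> y w \<le> c" "b > 0"
  obtains w where "w \<in> near_max K y b"
proof -
  have bdd: "bdd_above (y ` K)" using assms(2) by (intro bdd_aboveI2[where M = c])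
  have "(SUP w\<in>K. y w) - b < (SUP w\<in>K. y w)" using assms by simp
  then obtain w where "w \<in> K" "(SUP w\<in>K. y w) - b < y w"
    using less_cSUP_iff[OF assms(1) bdd] by blast
  then have "w \<in> near_max K y b"
    using cSUP_upper[OF _ bdd] by (intro near_maxI) (force simp: diff_less_eq intro: order_trans less_imp_le)+
  then show thesis by (rule that)
qed

lemma near_max_mono: "b \<le> b' \<Longrightarrow> near_max K y b \<subseteq> near_max K y b'"
  by (force simp: near_max_def)

text \<open>
  Perturbing \<open>y\<close> by a small multiple of \<open>h\<close> shrinks the slice, and it makes \<open>h\<close> large on it: almost
  as large as at any given almost maximal point \<open>x\<close> of \<open>y\<close>, provided that the slacks \<open>b\<close> and \<open>c\<close>
  are small compared with \<open>t\<close>.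
\<close>

lemma near_max_perturb:
  assumes h: "\<And>w. w \<in> K \<Longrightarrow> \<bar>h w\<bar> \<le> 1" and w: "w \<in> near_max K (\<lambda>v. y v + t * h v) c" and t: "t > 0"
  shows "w \<in> near_max K y (c + 2 * t)"
    and "x \<in> near_max K y b \<Longrightarrow> h x - (b + c) / t \<le> h w"
proof -
  have wK: "w \<in> K" using w by (rule near_maxD)
  have th: "\<bar>t * h v\<bar> \<le> t" if "v \<in> K" for v
    using mult_left_mono[OF h[OF that], of t] t by (simp add: abs_mult)
  show "w \<in> near_max K y (c + 2 * t)"
  proof (rule near_maxI[OF wK])
    fix v assume v: "v \<in> K"
    show "y v \<le> y w + (c + 2 * t)"
      using near_maxD(2)[OF w v] th[OF v] th[OF wK] by linarith
  qed
  assume x: "x \<in> near_max K y b"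
  have "y w \<le> y x + b" using near_maxD(2)[OF x wK] .
  moreover have "y x + t * h x \<le> y w + t * h w + c" using near_maxD(2)[OF w near_maxD(1)[OF x]] .
  ultimately have "t * (h x - h w) \<le> b + c" by (simp add: algebra_simps)
  then show "h x - (b + c) / t \<le> h w" using t by (simp add: field_simps)
qed

text \<open>
  Let \<open>b\<close> almost maximise \<open>y + t * (\<Sum>l. (p l)\<^sup>2)\<close> and replace the quadratic term by its linearisation
  at \<open>b\<close>. The error of the linearisation is \<open>t * (\<Sum>l. (p l w - p l b)\<^sup>2)\<close>, so that almost maximal
  points \<open>w\<close> of the resulting function have coordinates close to those of \<open>b\<close>. As \<open>K\<close> is an arbitrary
  set, the argument serves both for the unit ball of \<open>E\<close> and for the dual ball.
\<close>

lemma small_near_max: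
  assumes K: "K \<noteq> {}" and y: "\<And>w. w \<in> K \<Longrightarrow> y w \<le> C" and G: "finite G"
    and p: "\<And>l w. l \<in> G \<Longrightarrow> w \<in> K \<Longrightarrow> \<bar>p l w\<bar> \<le> 1" and \<beta>: "\<beta> > 0" and \<eta>: "\<eta> > (0::real)"
  obtains c b \<beta>' where "\<beta>' > 0" "near_max K (\<lambda>w. y w + (\<Sum>l\<in>G. c l * p l w)) \<beta>' \<subseteq> near_max K y \<beta>"
    "\<And>w l. w \<in> near_max K (\<lambda>w. y w + (\<Sum>l\<in>G. c l * p l w)) \<beta>' \<Longrightarrow> l \<in> G \<Longrightarrow> \<bar>p l w - p l b\<bar> \<le> \<eta>"
proof -
  define t where "t = \<beta> / (8 * real (Suc (card G)))"
  have t: "t > 0" using \<beta> by (simp add: t_def)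
  have t_card: "4 * t * card G \<le> \<beta> / 2"
  proof -
    have "8 * t * real (Suc (card G)) = \<beta>" unfolding t_def by (simp del: of_nat_Suc)
    then show ?thesis using t by (simp add: algebra_simps)
  qed
  define \<beta>' where "\<beta>' = min (t * \<eta>\<^sup>2 / 2) (\<beta> / 2)"
  have \<beta>': "\<beta>' > 0" "2 * \<beta>' \<le> t * \<eta>\<^sup>2" "\<beta>' \<le> \<beta> / 2" using t \<eta> \<beta> by (auto simp: \<beta>'_def min_def)
  define \<Phi> where "\<Phi> w = y w + t * (\<Sum>l\<in>G. (p l w)\<^sup>2)" for w
  have "\<Phi> w \<le> C + t * card G" if "w \<in> K" for w
  proof -
    have "(\<Sum>l\<in>G. (p l w)\<^sup>2) \<le> (\<Sum>l\<in>G. 1)"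
      using p that by (intro sum_mono) (simp add: abs_square_le_1)
    then have "t * (\<Sum>l\<in>G. (p l w)\<^sup>2) \<le> t * card G" using t by (intro mult_left_mono) auto
    then show ?thesis using y[OF that] by (simp add: \<Phi>_def)
  qed
  then obtain b where b: "b \<in> near_max K \<Phi> \<beta>'" by (rule near_max_nonempty[OF K _ \<beta>'(1)])
  have bK: "b \<in> K" using b by (rule near_maxD)
  define c where "c l = 2 * t * p l b" for l
  define y' where "y' w = y w + (\<Sum>l\<in>G. c l * p l w)" for w
  have y'_eq: "y' w = \<Phi> w + t * (\<Sum>l\<in>G. (p l b)\<^sup>2) - t * (\<Sum>l\<in>G. (p l w - p l b)\<^sup>2)" for w
  proof -
    have "(\<Sum>l\<in>G. c l * p l w) = (\<Sum>l\<in>G. t * (p l w)\<^sup>2 + t * (p l b)\<^sup>2 - t * (p l w - p l b)\<^sup>2)"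
      by (intro sum.cong refl) (simp add: c_def power2_eq_square algebra_simps)
    then show ?thesis
      by (simp add: y'_def \<Phi>_def sum.distrib sum_subtractf sum_distrib_left)
  qed
  have exposed: "y' w \<le> y' b + \<beta>' - t * (\<Sum>l\<in>G. (p l w - p l b)\<^sup>2)" if "w \<in> K" for w
    using near_maxD(2)[OF b that] unfolding y'_eq by simp
  have close: "\<bar>p l w - p l b\<bar> \<le> \<eta>" if w: "w \<in> near_max K y' \<beta>'" and l: "l \<in> G" for w l
  proof -
    have "y' b \<le> y' w + \<beta>'" using near_maxD(2)[OF w bK] .
    then have "t * (\<Sum>l\<in>G. (p l w - p l b)\<^sup>2) \<le> 2 * \<beta>'"
      using exposed[OF near_maxD(1)[OF w]] by linarith
    also have "\<dots> \<le> t * \<eta>\<^sup>2" by (rule \<beta>')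
    finally have "(\<Sum>l\<in>G. (p l w - p l b)\<^sup>2) \<le> \<eta>\<^sup>2" using t by simp
    moreover have "(p l w - p l b)\<^sup>2 \<le> (\<Sum>l\<in>G. (p l w - p l b)\<^sup>2)"
      using G l by (intro member_le_sum) auto
    ultimately have "(p l w - p l b)\<^sup>2 \<le> \<eta>\<^sup>2" by linarith
    then show ?thesis using \<eta> by (simp add: abs_le_square_iff[symmetric])
  qed
  have diff: "\<bar>y' w - y w\<bar> \<le> 2 * t * card G" if "w \<in> K" for w
  proof -
    have "\<bar>\<Sum>l\<in>G. c l * p l w\<bar> \<le> (\<Sum>l\<in>G. \<bar>c l * p l w\<bar>)" by (rule sum_abs)
    also have "\<dots> \<le> (\<Sum>l\<in>G. 2 * t)"
    proof (rule sum_mono)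
      fix l assume "l \<in> G"
      then have "\<bar>p l b\<bar> * \<bar>p l w\<bar> \<le> 1 * 1" using p bK that by (intro mult_mono) auto
      then have "2 * t * (\<bar>p l b\<bar> * \<bar>p l w\<bar>) \<le> 2 * t * 1" using t by (intro mult_left_mono) auto
      then show "\<bar>c l * p l w\<bar> \<le> 2 * t" using t by (simp add: c_def abs_mult)
    qed
    finally show ?thesis by (simp add: y'_def mult.commute)
  qed
  have "near_max K y' \<beta>' \<subseteq> near_max K y \<beta>"
  proof
    fix w assume w: "w \<in> near_max K y' \<beta>'"
    have wK: "w \<in> K" using w by (rule near_maxD)
    show "w \<in> near_max K y \<beta>"
    proof (rule near_maxI[OF wK])
      fix v assume v: "v \<in> K"
      show "y v \<le> y w + \<beta>"
        using near_maxD(2)[OF w v] diff[OF wK] diff[OF v] t_card \<beta>'(3) by linarith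
    qed
  qed
  then show thesis
    using that[of \<beta>' c b] \<beta>'(1) close unfolding y'_def by blast
qed

text \<open>
  Start with the signs that make all terms nonnegative and flip them one by one. The sum ends up
  nonpositive without ever entering the gap between \<open>- c\<close> and \<open>c\<close>, so some flip changes it by at least
  \<open>2 c\<close>.
\<close>

lemma large_coefficient_from_signs:
  fixes p :: "'l \<Rightarrow> real"
  assumes G: "finite G" and c: "c > 0"
    and signs: "\<And>\<sigma>. (\<And>l. \<bar>\<sigma> l\<bar> = 1) \<Longrightarrow> c \<le> \<bar>\<Sum>l\<in>G. \<sigma> l * p l\<bar>"
  obtains l where "l \<in> G" "c \<le> \<bar>p l\<bar>"
proof -
  have "\<exists>l\<in>G. c \<le> \<bar>p l\<bar>"
  proof (rule ccontr)
    assume "\<not> ?thesis"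
    then have small: "\<bar>p l\<bar> < c" if "l \<in> G" for l using that by force
    define \<sigma> where "\<sigma> F l = (if p l \<ge> 0 then 1 else - 1) * (if l \<in> F then - 1 else 1 :: real)" for F l
    define S where "S F = (\<Sum>l\<in>G. \<sigma> F l * p l)" for F
    have S_large: "c \<le> \<bar>S F\<bar>" for F
      unfolding S_def by (rule signs) (simp add: \<sigma>_def)
    have S_eq: "S F = (\<Sum>l\<in>G. (if l \<in> F then - \<bar>p l\<bar> else \<bar>p l\<bar>))" for F
      unfolding S_def \<sigma>_def by (intro sum.cong) auto
    have "S F \<ge> c" if "finite F" "F \<subseteq> G" for F
      using that
    proof (induction F rule: finite_induct)
      case empty
      have "S {} \<ge> 0" unfolding S_eq by (auto intro: sum_nonneg)
      with S_large[of "{}"] show ?case by simp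
    next
      case (insert l F)
      have "S F = S (insert l F) + 2 * \<bar>p l\<bar>"
      proof -
        have "l \<in> G" using insert by simp
        have "S F = \<bar>p l\<bar> + (\<Sum>k\<in>G - {l}. (if k \<in> F then - \<bar>p k\<bar> else \<bar>p k\<bar>))"
          unfolding S_eq using G \<open>l \<in> G\<close> insert(2) by (subst sum.remove[of _ l]) auto
        moreover have "S (insert l F) = - \<bar>p l\<bar> + (\<Sum>k\<in>G - {l}. (if k \<in> F then - \<bar>p k\<bar> else \<bar>p k\<bar>))"
          unfolding S_eq using G \<open>l \<in> G\<close> by (subst sum.remove[of _ l]) (auto intro!: sum.cong)
        ultimately show ?thesis by simp
      qed
      with insert small[of l] S_large[of "insert l F"] show ?case by auto
    qed
    from this[OF G order_refl] have "c \<le> S G" .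
    moreover have "S G \<le> 0" unfolding S_eq by (simp add: sum_nonneg sum_negf)
    ultimately show False using c by simp
  qed
  then show thesis using that by blast
qed

context absolute_space
begin

abbreviation unit_ball :: "('l \<Rightarrow> real) set" where
  "unit_ball \<equiv> {w \<in> E. NE w \<le> 1}"

abbreviation functionals :: "(('l \<Rightarrow> real) \<Rightarrow> real) set" where
  "functionals \<equiv> dual_on real_fun_scale E NE"

lemma functional_add: "y \<in> functionals \<Longrightarrow> v \<in> E \<Longrightarrow> w \<in> E \<Longrightarrow> y (v + w) = y v + y w"
  and functional_scale: "y \<in> functionals \<Longrightarrow> w \<in> E \<Longrightarrow> y (real_fun_scale c w) = c * y w"
  by (auto simp: dual_on_def bounded_linear_on_def)

lemma functional_bound:
  assumes "y \<in> functionals"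
  obtains K where "K \<ge> 0" "\<And>w. w \<in> E \<Longrightarrow> \<bar>y w\<bar> \<le> K * NE w"
proof -
  obtain K where K: "\<And>w. w \<in> E \<Longrightarrow> norm (y w) \<le> K * NE w"
    using assms unfolding dual_on_def bounded_linear_on_def by blast
  have "\<bar>y w\<bar> \<le> max K 0 * NE w" if "w \<in> E" for w
    using K[OF that] mult_right_mono[of K "max K 0" "NE w"] that by simp
  then show thesis using that[of "max K 0"] by simp
qed

lemma functionalI:
  assumes "\<And>v w. v \<in> E \<Longrightarrow> w \<in> E \<Longrightarrow> y (v + w) = y v + y w"
    "\<And>c w. w \<in> E \<Longrightarrow> y (real_fun_scale c w) = c * y w" "\<And>w. w \<in> E \<Longrightarrow> \<bar>y w\<bar> \<le> K * NE w"
  shows "y \<in> functionals"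
proof -
  have "\<exists>K. \<forall>w\<in>E. norm (y w) \<le> K * NE w" using assms(3) by auto
  then show ?thesis using assms(1,2) by (simp add: dual_on_def bounded_linear_on_def)
qed

lemma functional_perturb:
  assumes y: "y \<in> functionals" and h: "h \<in> functionals"
  shows "(\<lambda>w. y w + t * h w) \<in> functionals"
proof -
  obtain K where K: "\<And>w. w \<in> E \<Longrightarrow> \<bar>y w\<bar> \<le> K * NE w" using functional_bound[OF y] by blast
  obtain L where L: "\<And>w. w \<in> E \<Longrightarrow> \<bar>h w\<bar> \<le> L * NE w" using functional_bound[OF h] by blast
  show ?thesis
  proof (rule functionalI[where K = "K + \<bar>t\<bar> * L"])
    fix w assume w: "w \<in> E"
    have "\<bar>t * h w\<bar> \<le> \<bar>t\<bar> * (L * NE w)" using L[OF w] by (simp add: abs_mult mult_left_mono)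
    then show "\<bar>y w + t * h w\<bar> \<le> (K + \<bar>t\<bar> * L) * NE w"
      using K[OF w] by (simp add: algebra_simps)
  qed (simp_all add: y h functional_add functional_scale algebra_simps)
qed

lemma functional_near_max_nonempty:
  assumes "y \<in> functionals" "b > 0"
  obtains w where "w \<in> near_max unit_ball y b"
proof -
  obtain K where K: "K \<ge> 0" "\<And>w. w \<in> E \<Longrightarrow> \<bar>y w\<bar> \<le> K * NE w"
    using functional_bound[OF assms(1)] by blast
  have "y w \<le> K" if "w \<in> unit_ball" for w
    using K(2)[of w] mult_left_mono[of "NE w" 1 K] K(1) that by simp
  then show thesis
    using near_max_nonempty[of unit_ball y K b] assms(2) that zero_mem N_0
    by (metis (mono_tags, lifting) empty_iff mem_Collect_eq zero_le_one)
qed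

lemma coordinate_functional: "(\<lambda>w. w l) \<in> functionals"
  by (rule functionalI[where K = 1]) (auto simp: coordinate_le)

lemma functional_coordinate_sum:
  assumes y: "y \<in> functionals" and "finite G"
  shows "(\<lambda>w. y w + (\<Sum>l\<in>G. c l * w l)) \<in> functionals"
  using assms(2)
proof (induction G rule: finite_induct)
  case empty
  show "(\<lambda>w. y w + (\<Sum>l\<in>{}. c l * w l)) \<in> functionals" using y by simp
next
  case (insert l G)
  have "(\<lambda>w. (y w + (\<Sum>l\<in>G. c l * w l)) + c l * w l) \<in> functionals"
    by (rule functional_perturb[OF insert(3) coordinate_functional])
  moreover have "(\<lambda>w. y w + (\<Sum>l\<in>insert l G. c l * w l)) = (\<lambda>w. (y w + (\<Sum>l\<in>G. c l * w l)) + c l * w l)"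
    using insert(1,2) by (simp add: fun_eq_iff)
  ultimately show "(\<lambda>w. y w + (\<Sum>l\<in>insert l G. c l * w l)) \<in> functionals" by (simp only:)
qed

lemma cut_diff_norm_le:
  fixes \<eta> :: real
  assumes v: "v \<in> E" and w: "w \<in> E" and G: "finite G"
    and coord: "\<And>l. l \<in> G \<Longrightarrow> \<bar>w l - v l\<bar> \<le> \<eta>"
  shows "NE (w - v) \<le> card G * \<eta> + NE (cut (- G) w) + NE (cut (- G) v)"
proof -
  have "w - v = cut G (w - v) + (cut (- G) w - cut (- G) v)" by (auto simp: fun_eq_iff)
  then have "NE (w - v) \<le> NE (cut G (w - v)) + NE (cut (- G) w - cut (- G) v)"
    using N_triangle[of "cut G (w - v)" "cut (- G) w - cut (- G) v"] v w by simp
  also have "NE (cut G (w - v)) \<le> (\<Sum>l\<in>G. \<bar>(w - v) l\<bar>)" by (rule cut_norm_le_sum[OF G])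
  also have "\<dots> \<le> (\<Sum>l\<in>G. \<eta>)" using coord by (intro sum_mono) simp
  also have "NE (cut (- G) w - cut (- G) v) \<le> NE (cut (- G) w) + NE (cut (- G) v)"
    using v w by (intro N_triangle_diff) auto
  finally show ?thesis by (simp add: add.assoc)
qed

end

context absolute_rnp_space
begin

text \<open>
  Density of the finitely supported elements. If finite pieces of \<open>x\<close> disjoint from large finite
  sets did not become small, they would form a sequence of blocks excluded by
  \<open>bounded_blocks_small\<close>; so the finite restrictions of \<open>x\<close> are a Cauchy net, with pointwise
  limit \<open>x\<close>.
\<close>

lemma finite_tail_small:
  assumes x: "x \<in> E" and \<epsilon>: "\<epsilon> > 0"
  obtains F where "finite F" "NE (cut (- F) x) < \<epsilon>"
proof -
  have ex: "\<exists>F. finite F \<and> (\<forall>D. finite D \<and> D \<inter> F = {} \<longrightarrow> NE (cut D x) < e)" if e: "e > 0" for e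
  proof (rule ccontr)
    assume "\<not> ?thesis"
    then have "\<exists>D. finite D \<and> D \<inter> F = {} \<and> e \<le> NE (cut D x)" if "finite F" for F
      using that by (meson not_less)
    then obtain D :: "nat \<Rightarrow> 'l set" where D: "disjoint_family D" "\<And>n. finite (D n)" "\<And>n. e \<le> NE (cut (D n) x)"
      using disjoint_sequence_exists[of "\<lambda>D. e \<le> NE (cut D x)"] by metis
    have "NE x > 0" using D(3)[of 0] cut_norm_le[OF x, of "D 0"] e by linarith
    let ?x = "real_fun_scale (1 / NE x) x"
    have cut_x: "cut F ?x = real_fun_scale (1 / NE x) (cut F x)" for F by (auto simp: fun_eq_iff)
    have x1: "NE ?x = 1" "?x \<in> E" using \<open>NE x > 0\<close> x by (simp_all add: N_scale)
    obtain n where "NE (cut (D n) ?x) < e / NE x"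
    proof (rule bounded_blocks_small[OF D(2,1)])
      show "NE (cut F ?x) \<le> 1" for F using cut_norm_le[OF x1(2), of F] x1(1) by simp
      show "0 < e / NE x" using e \<open>NE x > 0\<close> by simp
    qed
    then have "NE (cut (D n) x) < e"
      unfolding cut_x using x \<open>NE x > 0\<close> by (simp add: N_scale divide_less_cancel)
    with D(3)[of n] show False by simp
  qed
  then have "\<exists>F. finite F \<and> (\<forall>D. finite D \<and> D \<inter> F = {} \<longrightarrow> NE (cut D x) < 1 / real (Suc n))" for n
    by simp
  then obtain F where F: "\<And>n. finite (F n)"
    "\<And>n D. finite D \<Longrightarrow> D \<inter> F n = {} \<Longrightarrow> NE (cut D x) < 1 / real (Suc n)"
    by metis
  define G where "G n = (\<Union>i\<le>n. F i)" for n
  have G_fin: "finite (G n)" for n using F by (simp add: G_def)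
  have rate: "(\<lambda>n. 1 / real (Suc n)) \<longlonglongrightarrow> 0"
    using LIMSEQ_inverse_real_of_nat by (simp add: inverse_eq_divide)
  have "x \<in> E \<and> (\<lambda>n. NE (cut (G n) x - x)) \<longlonglongrightarrow> 0"
  proof (rule limit_in_E[OF _ _ rate])
    show "cut (G n) x \<in> E" for n using x by simp
    show "NE (cut (G m) x - cut (G n) x) \<le> 1 / real (Suc n)" if "n \<le> m" for n m
    proof -
      have "G n \<subseteq> G m" using that by (force simp: G_def)
      then have "cut (G m) x - cut (G n) x = cut (G m - G n) x" by (auto simp: fun_eq_iff)
      moreover have "(G m - G n) \<inter> F n = {}" by (auto simp: G_def)
      then have "NE (cut (G m - G n) x) < 1 / real (Suc n)" using G_fin by (intro F) auto
      ultimately show ?thesis by simp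
    qed
    show "(\<lambda>n. cut (G n) x l) \<longlonglongrightarrow> x l" for l
    proof (cases "\<exists>n. l \<in> F n")
      case True
      then obtain n0 where "l \<in> F n0" by blast
      then have "\<forall>\<^sub>F n in sequentially. x l = cut (G n) x l"
        by (auto simp: eventually_sequentially G_def intro!: exI[of _ n0])
      then show ?thesis by (rule Lim_transform_eventually[OF tendsto_const])
    next
      case False
      have "\<bar>x l\<bar> \<le> 1 / real (Suc n)" for n
      proof -
        have "\<bar>x l\<bar> \<le> NE (cut {l} x)" using coordinate_le[of "cut {l} x" l] by simp
        also have "\<dots> < 1 / real (Suc n)" using False by (intro F) auto
        finally show ?thesis by simp
      qed
      then have "\<bar>x l\<bar> \<le> 0" by (intro LIMSEQ_le_const[OF rate]) auto
      then have "cut (G n) x l = 0" for n by simp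
      then show ?thesis using \<open>\<bar>x l\<bar> \<le> 0\<close> by simp
    qed
  qed
  then have "\<forall>\<^sub>F n in sequentially. NE (cut (G n) x - x) < \<epsilon>"
    using \<epsilon> by (auto dest: order_tendstoD(2))
  then obtain n where "NE (cut (G n) x - x) < \<epsilon>" by (auto simp: eventually_sequentially)
  moreover have "cut (G n) x - x = - cut (- G n) x" by (auto simp: fun_eq_iff)
  ultimately have "NE (cut (- G n) x) < \<epsilon>" using x by simp
  then show thesis using that G_fin by blast
qed

text \<open>
  The limit \<open>x\<close> is found by compactness of the product of the intervals from \<open>-1\<close> to \<open>1\<close>, since the
  norm of a restriction to finitely many coordinates is continuous for pointwise convergence.
\<close>

lemma bounded_pointwise_limit:
  assumes D: "\<And>n. finite (D n)"
    and w: "\<And>n. \<exists>w\<in>unit_ball. \<forall>m<n. \<delta> \<le> NE (cut (D m) w)"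
  obtains x where "\<And>F. finite F \<Longrightarrow> NE (cut F x) \<le> 1" "\<And>n :: nat. \<delta> \<le> NE (cut (D n) x)"
proof -
  define K :: "('l \<Rightarrow> real) set" where "K = Pi\<^sub>E UNIV (\<lambda>_. {-1..1})"
  have "compactin (product_topology (\<lambda>_. euclidean) UNIV) K"
    unfolding K_def by (subst compactin_PiE) simp
  then have "compact K" by (simp add: euclidean_product_topology)
  define C where "C n = {x. (\<forall>F. finite F \<longrightarrow> NE (cut F x) \<le> 1) \<and> \<delta> \<le> NE (cut (D n) x)}" for n
  have "K \<inter> (\<Inter>n\<in>UNIV. C n) \<noteq> {}"
  proof (rule compact_imp_fip_image[OF \<open>compact K\<close>])
    fix n :: nat
    have "closed {x. NE (cut F x) \<le> 1}" if "finite F" for F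
      using continuous_on_cut_norm[OF that] by (intro closed_Collect_le) auto
    moreover have "closed {x. \<delta> \<le> NE (cut (D n) x)}"
      using continuous_on_cut_norm[OF D] by (intro closed_Collect_le) auto
    moreover have "C n = (\<Inter>F\<in>{F. finite F}. {x. NE (cut F x) \<le> 1}) \<inter> {x. \<delta> \<le> NE (cut (D n) x)}"
      by (auto simp: C_def)
    ultimately show "closed (C n)" by auto
  next
    fix I :: "nat set" assume "finite I"
    then obtain n where n: "\<And>i. i \<in> I \<Longrightarrow> i < n" by (auto simp: finite_nat_set_iff_bounded)
    obtain w where w: "w \<in> E" "NE w \<le> 1" "\<And>m. m < n \<Longrightarrow> \<delta> \<le> NE (cut (D m) w)" using w[of n] by blast
    have "\<bar>w l\<bar> \<le> 1" for l using coordinate_le[OF w(1), of l] w(2) by simp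
    then have "w \<in> K" by (auto simp: K_def abs_le_iff minus_le_iff)
    moreover have "NE (cut F w) \<le> 1" for F using cut_norm_le[OF w(1), of F] w(2) by simp
    then have "w \<in> C i" if "i \<in> I" for i using w(3) n[OF that] by (simp add: C_def)
    ultimately show "K \<inter> (\<Inter>n\<in>I. C n) \<noteq> {}" by blast
  qed
  then obtain x where "\<And>n. x \<in> C n" by blast
  then show thesis using that unfolding C_def by blast
qed

text \<open>
  Take an almost maximal \<open>w\<close> of \<open>y\<close> with a large tail off \<open>F\<close>, a finite piece \<open>D\<close> of that tail which
  still has norm above \<open>\<epsilon>\<close>, and perturb \<open>y\<close> by a functional that norms this piece.
\<close>

lemma tail_perturbation:
  assumes y: "y \<in> functionals" and b: "b > 0" and \<epsilon>: "\<epsilon> > 0" and F: "finite F"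
    and big: "\<And>c. 0 < c \<Longrightarrow> c \<le> b \<Longrightarrow> \<exists>w\<in>near_max unit_ball y c. \<epsilon> < NE (cut (- F) w)"
  obtains y' b' D where "y' \<in> functionals" "b' > 0" "finite D" "D \<inter> F = {}"
    "near_max unit_ball y' b' \<subseteq> near_max unit_ball y b"
    "\<And>w. w \<in> near_max unit_ball y' b' \<Longrightarrow> \<epsilon> / 2 \<le> NE (cut D w)"
proof -
  (* The slack c has to be small compared with the size t of the perturbation, and both compared with b. *)
  define t where "t = b / 4"
  define c where "c = min (b / 4) (t * \<epsilon> / 4)"
  have t: "t > 0" using b by (simp add: t_def)
  have c: "0 < c" "c \<le> b" "c + 2 * t \<le> b" "(c + c) / t \<le> \<epsilon> / 2"
    using b \<epsilon> t by (auto simp: c_def t_def min_def field_simps)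
  obtain w where w: "w \<in> near_max unit_ball y c" "\<epsilon> < NE (cut (- F) w)"
    using big[OF c(1,2)] by blast
  have wE: "w \<in> E" using near_maxD(1)[OF w(1)] by simp
  obtain F1 where F1: "finite F1" "NE (cut (- F1) (cut (- F) w)) < NE (cut (- F) w) - \<epsilon>"
    using finite_tail_small[of "cut (- F) w" "NE (cut (- F) w) - \<epsilon>"] wE w(2) by auto
  define D where "D = F1 - F"
  have split: "cut D w + cut (- F1) (cut (- F) w) = cut (- F) w" by (auto simp: fun_eq_iff D_def)
  have "NE (cut (- F) w) \<le> NE (cut D w) + NE (cut (- F1) (cut (- F) w))"
    using N_triangle[of "cut D w" "cut (- F1) (cut (- F) w)", unfolded split] wE by simp
  with F1(2) have D_large: "\<epsilon> < NE (cut D w)" by simp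
  obtain h0 where h0: "h0 \<in> dual_ball" "h0 (cut D w) = of_real (NE (cut D w))"
    using norming_functional[of "cut D w"] wE by auto
  define h where "h v = h0 (cut D v)" for v
  have h_le: "\<bar>h v\<bar> \<le> NE (cut D v)" if "v \<in> E" for v
    using dual_ball_le[OF h0(1), of "cut D v"] that by (simp add: h_def)
  have cut_lin: "cut D (v + w) = cut D v + cut D w" "cut D (real_fun_scale a v) = real_fun_scale a (cut D v)" for v w a
    by (auto simp: fun_eq_iff)
  have h: "h \<in> functionals"
  proof (rule functionalI[where K = 1])
    show "\<bar>h v\<bar> \<le> 1 * NE v" if "v \<in> E" for v
      using h_le[OF that] cut_norm_le[OF that, of D] by simp
  qed (use h0(1) in \<open>auto simp: h_def cut_lin dual_ball_add dual_ball_scale\<close>)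
  have h1: "\<bar>h v\<bar> \<le> 1" if "v \<in> unit_ball" for v
    using h_le[of v] cut_norm_le[of v D] that by simp
  define y' where "y' v = y v + t * h v" for v
  show thesis
  proof (rule that[of y' c D])
    show "y' \<in> functionals" unfolding y'_def by (rule functional_perturb[OF y h])
    show "near_max unit_ball y' c \<subseteq> near_max unit_ball y b"
    proof
      fix v assume "v \<in> near_max unit_ball y' c"
      then have "v \<in> near_max unit_ball y (c + 2 * t)"
        using near_max_perturb(1)[of unit_ball h v y t c] h1 t unfolding y'_def by blast
      then show "v \<in> near_max unit_ball y b" using near_max_mono[OF c(3), of unit_ball y] by blast
    qed
    show "\<epsilon> / 2 \<le> NE (cut D v)" if v: "v \<in> near_max unit_ball y' c" for v
    proof -
      have "h w - (c + c) / t \<le> h v"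
        using near_max_perturb(2)[of unit_ball h v y t c w c] h1 v t w(1) unfolding y'_def by blast
      moreover have "h w = NE (cut D w)" using h0(2) by (simp add: h_def)
      moreover have "h v \<le> NE (cut D v)" using h_le[of v] near_maxD(1)[OF v] by simp
      ultimately show ?thesis using D_large c(4) by linarith
    qed
  qed (use c F1 in \<open>auto simp: D_def\<close>)
qed

text \<open>
  If every smaller slice had elements with large tails, \<open>tail_perturbation\<close> could be iterated. Elements
  of the nested slices would then be large on more and more disjoint finite sets, and a pointwise limit of
  them would contradict \<open>bounded_blocks_small\<close>.
\<close>

lemma near_max_small_tails:
  assumes y: "y \<in> functionals" and \<beta>: "\<beta> > 0" and \<epsilon>: "\<epsilon> > 0"
  obtains y' \<beta>' F where "y' \<in> functionals" "\<beta>' > 0" "finite F"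
    "near_max unit_ball y' \<beta>' \<subseteq> near_max unit_ball y \<beta>"
    "\<And>w. w \<in> near_max unit_ball y' \<beta>' \<Longrightarrow> NE (cut (- F) w) \<le> \<epsilon>"
proof -
  let ?ok = "\<lambda>(y', \<beta>', F :: 'l set). y' \<in> functionals \<and> \<beta>' > 0 \<and> finite F \<and>
    near_max unit_ball y' \<beta>' \<subseteq> near_max unit_ball y \<beta>"
  let ?step = "\<lambda>(y1, b1, F1) (y2, b2, F2). F1 \<subseteq> F2 \<and>
    near_max unit_ball y2 b2 \<subseteq> near_max unit_ball y1 b1 \<and>
    (\<forall>w\<in>near_max unit_ball y2 b2. \<epsilon> / 2 \<le> NE (cut (F2 - F1) w))"
  have "\<exists>y' \<beta>' F. ?ok (y', \<beta>', F) \<and> (\<forall>w\<in>near_max unit_ball y' \<beta>'. NE (cut (- F) w) \<le> \<epsilon>)"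
  proof (rule ccontr)
    assume neg: "\<not> ?thesis"
    have "\<exists>f :: nat \<Rightarrow> _. \<forall>n. ?ok (f n) \<and> ?step (f n) (f (Suc n))"
    proof (rule dependent_nat_choice)
      show "\<exists>s. ?ok s" using y \<beta> by (intro exI[of _ "(y, \<beta>, {})"]) auto
      fix s and n :: nat assume "?ok s"
      then obtain y1 b1 F1 where s: "s = (y1, b1, F1)" and
        ok: "y1 \<in> functionals" "b1 > 0" "finite F1" "near_max unit_ball y1 b1 \<subseteq> near_max unit_ball y \<beta>"
        by (cases s) auto
      have big: "\<exists>w\<in>near_max unit_ball y1 c. \<epsilon> < NE (cut (- F1) w)" if "0 < c" "c \<le> b1" for c
      proof -
        have "?ok (y1, c, F1)" using ok that near_max_mono[OF that(2), of unit_ball y1] by auto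
        with neg show ?thesis by (meson not_less)
      qed
      obtain y2 b2 D where "y2 \<in> functionals" "b2 > 0" "finite D" "D \<inter> F1 = {}"
        "near_max unit_ball y2 b2 \<subseteq> near_max unit_ball y1 b1"
        "\<And>w. w \<in> near_max unit_ball y2 b2 \<Longrightarrow> \<epsilon> / 2 \<le> NE (cut D w)"
        using tail_perturbation[OF ok(1,2) \<epsilon> ok(3) big] by blast
      moreover have "(F1 \<union> D) - F1 = D" using \<open>D \<inter> F1 = {}\<close> by blast
      ultimately have "?ok (y2, b2, F1 \<union> D) \<and> ?step s (y2, b2, F1 \<union> D)"
        using ok by (auto simp: s)
      then show "\<exists>s'. ?ok s' \<and> ?step s s'" by blast
    qed
    then obtain f :: "nat \<Rightarrow> _" where "\<forall>n. ?ok (f n) \<and> ?step (f n) (f (Suc n))" by (rule exE)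
    note f = this[THEN spec, THEN conjunct1] this[THEN spec, THEN conjunct2]
    define M where "M n = near_max unit_ball (fst (f n)) (fst (snd (f n)))" for n
    define F where "F n = snd (snd (f n))" for n
    have F_fin: "finite (F n)" for n using f(1)[of n] by (cases "f n") (simp only: F_def prod.case fst_conv snd_conv)
    have F_mono: "F n \<subseteq> F (Suc n)" and M_dec: "M (Suc n) \<subseteq> M n"
      and M_large: "\<And>w. w \<in> M (Suc n) \<Longrightarrow> \<epsilon> / 2 \<le> NE (cut (F (Suc n) - F n) w)" for n
    proof -
      obtain y1 b1 F1 where 1: "f n = (y1, b1, F1)" by (cases "f n")
      obtain y2 b2 F2 where 2: "f (Suc n) = (y2, b2, F2)" by (cases "f (Suc n)")
      have "F1 \<subseteq> F2 \<and> near_max unit_ball y2 b2 \<subseteq> near_max unit_ball y1 b1 \<and>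
          (\<forall>w\<in>near_max unit_ball y2 b2. \<epsilon> / 2 \<le> NE (cut (F2 - F1) w))"
        using f(2)[of n] unfolding 1 2 prod.case .
      note * = this[THEN conjunct1] this[THEN conjunct2, THEN conjunct1]
        this[THEN conjunct2, THEN conjunct2, rule_format]
      from * show "F n \<subseteq> F (Suc n)" "M (Suc n) \<subseteq> M n" by (simp_all only: F_def M_def 1 2 fst_conv snd_conv)
      show "\<epsilon> / 2 \<le> NE (cut (F (Suc n) - F n) w)" if "w \<in> M (Suc n)" for w
        using *(3)[of w] that by (simp only: F_def M_def 1 2 fst_conv snd_conv)
    qed
    define D where "D n = F (Suc n) - F n" for n
    have D_disj: "disjoint_family D"
    proof -
      have "D m \<inter> D n = {}" if "m < n" for m n
      proof -
        have "F (Suc m) \<subseteq> F n" using that by (intro lift_Suc_mono_le[of F, OF F_mono]) simp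
        then show ?thesis by (auto simp: D_def)
      qed
      then show ?thesis unfolding disjoint_family_on_def by (metis inf_commute linorder_neqE_nat)
    qed
    have D_fin: "finite (D n)" for n using F_fin by (simp add: D_def)
    have "\<exists>w\<in>unit_ball. \<forall>m<n. \<epsilon> / 2 \<le> NE (cut (D m) w)" for n
    proof -
      obtain y1 b1 F1 where 1: "f n = (y1, b1, F1)" by (cases "f n")
      have "y1 \<in> functionals" "b1 > 0" using f(1)[of n] by (simp_all only: 1 prod.case)
      then obtain w where w: "w \<in> M n"
        unfolding M_def 1 fst_conv snd_conv by (rule functional_near_max_nonempty)
      have "\<epsilon> / 2 \<le> NE (cut (D m) w)" if "m < n" for m
      proof -
        have "M n \<subseteq> M (Suc m)" using that by (intro lift_Suc_antimono_le[of M, OF M_dec]) simp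
        then show ?thesis using w M_large[of w m] by (auto simp: D_def)
      qed
      moreover have "w \<in> unit_ball" using w unfolding M_def by (rule near_maxD(1))
      ultimately show ?thesis by (intro bexI[of _ w]) auto
    qed
    then obtain x where x: "\<And>F. finite F \<Longrightarrow> NE (cut F x) \<le> 1" "\<And>n. \<epsilon> / 2 \<le> NE (cut (D n) x)"
      using bounded_pointwise_limit[of D "\<epsilon> / 2"] D_fin by blast
    obtain n where "NE (cut (D n) x) < \<epsilon> / 2"
      using bounded_blocks_small[OF D_fin D_disj, of x "\<epsilon> / 2"] x(1) \<epsilon> by auto
    with x(2)[of n] show False by simp
  qed
  then show thesis using that by auto
qed

text \<open>
  Dentability of the unit ball, localised to a given slice: \<open>near_max_small_tails\<close> controls all but
  finitely many coordinates, and \<open>small_near_max\<close> controls the remaining ones.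
\<close>

lemma near_max_small_diameter:
  assumes y: "y \<in> functionals" and \<beta>: "\<beta> > 0" and \<epsilon>: "\<epsilon> > 0"
  obtains y' \<beta>' a where "y' \<in> functionals" "\<beta>' > 0" "a \<in> near_max unit_ball y' \<beta>'"
    "near_max unit_ball y' \<beta>' \<subseteq> near_max unit_ball y \<beta>"
    "\<And>w. w \<in> near_max unit_ball y' \<beta>' \<Longrightarrow> NE (w - a) \<le> \<epsilon>"
proof -
  obtain y1 b1 G where y1: "y1 \<in> functionals" "b1 > 0" "finite G"
    "near_max unit_ball y1 b1 \<subseteq> near_max unit_ball y \<beta>"
    "\<And>w. w \<in> near_max unit_ball y1 b1 \<Longrightarrow> NE (cut (- G) w) \<le> \<epsilon> / 4"
    using near_max_small_tails[OF y \<beta>, of "\<epsilon> / 4"] \<epsilon> by auto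
  obtain K where K: "K \<ge> 0" "\<And>w. w \<in> E \<Longrightarrow> \<bar>y1 w\<bar> \<le> K * NE w"
    using functional_bound[OF y1(1)] by blast
  have bound: "y1 w \<le> K" if "w \<in> unit_ball" for w
    using K(2)[of w] mult_left_mono[of "NE w" 1 K] K(1) that by simp
  have ne: "unit_ball \<noteq> {}" using zero_mem N_0 by fastforce
  define \<eta> where "\<eta> = \<epsilon> / (4 * real (Suc (card G)))"
  have \<eta>: "\<eta> > 0" using \<epsilon> by (simp add: \<eta>_def)
  have coord: "\<bar>w l\<bar> \<le> 1" if "l \<in> G" "w \<in> unit_ball" for w l
    using coordinate_le[of w l] that by simp
  obtain c b \<beta>' where \<beta>': "\<beta>' > 0"
    and sub: "near_max unit_ball (\<lambda>w. y1 w + (\<Sum>l\<in>G. c l * w l)) \<beta>' \<subseteq> near_max unit_ball y1 b1"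
    and close: "\<And>w l. w \<in> near_max unit_ball (\<lambda>w. y1 w + (\<Sum>l\<in>G. c l * w l)) \<beta>' \<Longrightarrow> l \<in> G \<Longrightarrow> \<bar>w l - b l\<bar> \<le> \<eta>"
    by (rule small_near_max[where K = unit_ball and y = y1 and C = K and G = G and p = "\<lambda>l w. w l"
        and \<beta> = b1 and \<eta> = \<eta>]) (assumption | rule ne bound y1(3) coord y1(2) \<eta> that)+
  define y' where "y' w = y1 w + (\<Sum>l\<in>G. c l * w l)" for w
  have y': "y' \<in> functionals" unfolding y'_def by (rule functional_coordinate_sum[OF y1(1,3)])
  obtain a where a: "a \<in> near_max unit_ball y' \<beta>'"
    using functional_near_max_nonempty[OF y' \<beta>'] .
  show thesis
  proof (rule that[OF y' \<beta>' a])
    show "near_max unit_ball y' \<beta>' \<subseteq> near_max unit_ball y \<beta>" using sub y1(4) unfolding y'_def by blast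
    fix w assume w: "w \<in> near_max unit_ball y' \<beta>'"
    have aw: "a \<in> near_max unit_ball y1 b1" "w \<in> near_max unit_ball y1 b1"
      using a w sub unfolding y'_def by auto
    have inE: "a \<in> E" "w \<in> E" using near_maxD(1)[OF aw(1)] near_maxD(1)[OF aw(2)] by auto
    have "\<bar>w l - a l\<bar> \<le> 2 * \<eta>" if "l \<in> G" for l
      using close[OF w[unfolded y'_def] that] close[OF a[unfolded y'_def] that] by linarith
    then have "NE (w - a) \<le> card G * (2 * \<eta>) + NE (cut (- G) w) + NE (cut (- G) a)"
      using inE y1(3) by (intro cut_diff_norm_le) auto
    also have "card G * (2 * \<eta>) \<le> real (Suc (card G)) * (2 * \<eta>)" using \<eta> by (intro mult_right_mono) auto
    also have "\<dots> = \<epsilon> / 2" by (simp add: \<eta>_def del: of_nat_Suc)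
    finally show "NE (w - a) \<le> \<epsilon>" using y1(5)[OF aw(1)] y1(5)[OF aw(2)] by linarith
  qed
qed

end

section \<open>Sequence spaces of numerical index one\<close>

context absolute_space
begin

text \<open>
  The operator \<open>w \<mapsto> y w * z\<close> has norm \<open>m * NE z\<close>, where \<open>m\<close> is the norm of \<open>y\<close>. At a state \<open>(e, g)\<close>
  it takes the value \<open>y e * g z\<close>; if this product is almost \<open>m * NE z\<close>, then both factors are almost
  maximal.
\<close>

lemma rank_one_states:
  assumes index: "numerical_index real_fun_scale E NE = 1"
    and y: "y \<in> functionals" and v0: "v0 \<in> unit_ball" "y v0 \<noteq> 0"
    and z: "z \<in> E" "z \<noteq> 0" and b: "b > 0"
  obtains e g where "e \<in> E" "NE e = 1" "g \<in> dual_ball" "g e = 1"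
    "\<And>v. v \<in> unit_ball \<Longrightarrow> \<bar>y v\<bar> \<le> \<bar>y e\<bar> + b" "NE z \<le> \<bar>g z\<bar> + b"
proof -
  obtain K where K: "K \<ge> 0" "\<And>w. w \<in> E \<Longrightarrow> \<bar>y w\<bar> \<le> K * NE w"
    using functional_bound[OF y] by blast
  have bdd: "bdd_above ((\<lambda>v. \<bar>y v\<bar>) ` unit_ball)"
  proof (rule bdd_aboveI2[where M = K])
    fix w assume "w \<in> unit_ball"
    then show "\<bar>y w\<bar> \<le> K" using K(2)[of w] mult_left_mono[of "NE w" 1 K] K(1) by simp
  qed
  define m where "m = (SUP v\<in>unit_ball. \<bar>y v\<bar>)"
  have y_le: "\<bar>y v\<bar> \<le> m" if "v \<in> unit_ball" for v
    unfolding m_def using that bdd by (rule cSUP_upper)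
  have m: "m > 0" using y_le[OF v0(1)] v0(2) by linarith
  define q where "q = NE z"
  have q: "q > 0" using z by (simp add: q_def N_pos)
  define \<eta> where "\<eta> = min (b * q / 2) (b * m / 2)"
  have \<eta>: "\<eta> > 0" "2 * \<eta> \<le> b * q" "2 * \<eta> \<le> b * m" using b q m by (auto simp: \<eta>_def)
  have "m - \<eta> / q < m" using \<eta> q by simp
  then obtain v where v: "v \<in> unit_ball" "m - \<eta> / q < \<bar>y v\<bar>"
    unfolding m_def using less_cSUP_iff[OF _ bdd] v0(1) by blast
  define T where "T w = real_fun_scale (y w) z" for w
  have T: "T \<in> operators_on real_fun_scale E NE"
  proof (rule operatorI[where K = "K * q"])
    show "T (v + w) = T v + T w" if "v \<in> E" "w \<in> E" for v w
      using y that by (simp add: T_def functional_add fun_eq_iff algebra_simps)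
    show "T (real_fun_scale c w) = real_fun_scale c (T w)" if "w \<in> E" for c w
      using y that by (simp add: T_def functional_scale fun_eq_iff)
    show "NE (T w) \<le> K * q * NE w" if "w \<in> E" for w
    proof -
      have "\<bar>y w\<bar> * q \<le> K * NE w * q" using K(2)[OF that] q by (intro mult_right_mono) auto
      then show ?thesis using z by (simp add: T_def N_scale q_def mult_ac)
    qed
  qed (use z in \<open>simp add: T_def\<close>)
  obtain e g where eg: "(e, g) \<in> state_pairs real_fun_scale E NE"
    "numerical_index real_fun_scale E NE * NE (T v) - \<eta> < norm (g (T e))"
    using state_attaining_index[OF E_nontrivial T, of v \<eta>] v(1) \<eta>(1) by blast
  then have e: "e \<in> E" "NE e = 1" and g: "g \<in> dual_ball" "g e = 1"
    by (auto simp: state_pairs_iff)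
  have "NE (T v) = \<bar>y v\<bar> * q" "norm (g (T e)) = \<bar>y e\<bar> * \<bar>g z\<bar>"
    using z g by (simp_all add: T_def N_scale q_def dual_ball_scale abs_mult)
  with eg(2) index have A: "\<bar>y v\<bar> * q - \<eta> < \<bar>y e\<bar> * \<bar>g z\<bar>" by simp
  have "m * q - \<eta> < \<bar>y v\<bar> * q" using v(2) q by (simp add: field_simps)
  with A have A: "m * q - 2 * \<eta> < \<bar>y e\<bar> * \<bar>g z\<bar>" by linarith
  have le: "\<bar>y e\<bar> \<le> m" "\<bar>g z\<bar> \<le> q"
    using y_le[of e] e dual_ball_le[OF g(1) z(1)] by (auto simp: q_def)
  have "\<bar>y e\<bar> * \<bar>g z\<bar> \<le> \<bar>y e\<bar> * q" using le by (intro mult_left_mono) auto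
  then have "m * q \<le> (\<bar>y e\<bar> + b) * q" using A \<eta>(2) by (simp add: algebra_simps)
  then have me: "m \<le> \<bar>y e\<bar> + b" using q by simp
  have "\<bar>y e\<bar> * \<bar>g z\<bar> \<le> m * \<bar>g z\<bar>" using le by (intro mult_right_mono) auto
  then have "m * q \<le> m * (\<bar>g z\<bar> + b)" using A \<eta>(3) by (simp add: algebra_simps)
  then have "q \<le> \<bar>g z\<bar> + b" using m by simp
  then show thesis
    using that[OF e g] y_le me unfolding q_def by (meson order_trans)
qed

end

context absolute_rnp_space
begin

text \<open>
  Choose \<open>b\<close> in a slice of the dual ball, defined by a perturbation \<open>z\<close> of \<open>t\<close>, on which the
  coordinates that carry \<open>a\<close> hardly vary. For each choice of signs \<open>\<sigma>\<close>, \<open>rank_one_states\<close> with the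
  functional \<open>w \<mapsto> y (\<sigma> w)\<close> gives a state \<open>(e, g)\<close>; up to a sign, \<open>e\<close> is close to \<open>\<sigma> a\<close> and \<open>g\<close> is
  close to \<open>b\<close> where it matters, so that \<open>g e = 1\<close> forces \<open>\<bar>b (\<sigma> a)\<bar>\<close> to be almost \<open>1\<close>. Then
  \<open>large_coefficient_from_signs\<close> applies.
\<close>

lemma common_unit_coordinate:
  assumes index: "numerical_index real_fun_scale E NE = 1"
    and y: "y \<in> functionals" and \<beta>: "\<beta> > 0" and v0: "v0 \<in> unit_ball" "y v0 \<noteq> 0"
    and a: "a \<in> unit_ball" "\<And>w. w \<in> near_max unit_ball y \<beta> \<Longrightarrow> NE (w - a) \<le> \<delta>"
    and t: "t \<in> E" "\<delta> < NE t" and \<delta>: "0 < \<delta>" "\<delta> < 1 / 4"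
  obtains b l where "b \<in> dual_ball" "NE t - \<delta> \<le> b t" "1 - 4 * \<delta> \<le> \<bar>a l * b (unit_vec l)\<bar>"
proof -
  have aE: "a \<in> E" using a by simp
  obtain G where G: "finite G" "NE (cut (- G) a) < \<delta>"
    using finite_tail_small[OF aE \<delta>(1)] .
  define \<eta> where "\<eta> = \<delta> / (2 * real (Suc (card G)))"
  have \<eta>: "\<eta> > 0" using \<delta> by (simp add: \<eta>_def)
  have zero_ball: "(\<lambda>_. 0) \<in> dual_ball" by (simp add: dual_ball_def)
  then have ne: "dual_ball \<noteq> {}" by blast
  have bound: "g t \<le> NE t" if "g \<in> dual_ball" for g
    using dual_ball_le[OF that t(1)] by simp
  have coord: "\<bar>g (unit_vec l)\<bar> \<le> 1" if "l \<in> G" "g \<in> dual_ball" for l g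
    using dual_ball_coordinate_le[OF that(2)] .
  obtain c b0 \<beta>' where \<beta>': "\<beta>' > 0"
    and sub: "near_max dual_ball (\<lambda>g. g t + (\<Sum>l\<in>G. c l * g (unit_vec l))) \<beta>' \<subseteq> near_max dual_ball (\<lambda>g. g t) \<delta>"
    and close: "\<And>g l. g \<in> near_max dual_ball (\<lambda>g. g t + (\<Sum>l\<in>G. c l * g (unit_vec l))) \<beta>' \<Longrightarrow> l \<in> G \<Longrightarrow>
      \<bar>g (unit_vec l) - b0 (unit_vec l)\<bar> \<le> \<eta>"
    by (rule small_near_max[where K = dual_ball and y = "\<lambda>g. g t" and C = "NE t" and G = G
        and p = "\<lambda>l g. g (unit_vec l)" and \<beta> = \<delta> and \<eta> = \<eta>])
      (assumption | rule ne bound G(1) coord \<delta>(1) \<eta> that)+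
  define z where "z = t + cut G c"
  have zE: "z \<in> E" using t G by (simp add: z_def)
  have z_eval: "g z = g t + (\<Sum>l\<in>G. c l * g (unit_vec l))" if "g \<in> dual_ball" for g
    using that t G by (simp add: z_def dual_ball_add dual_ball_cut)
  define M where "M = near_max dual_ball (\<lambda>g. g z) \<beta>'"
  have M_eq: "M = near_max dual_ball (\<lambda>g. g t + (\<Sum>l\<in>G. c l * g (unit_vec l))) \<beta>'"
    using z_eval by (auto simp: M_def near_max_def)
  have M_sub: "M \<subseteq> near_max dual_ball (\<lambda>g. g t) \<delta>" using sub by (simp only: M_eq)
  have M_close: "\<bar>g (unit_vec l) - b0 (unit_vec l)\<bar> \<le> \<eta>" if "g \<in> M" "l \<in> G" for g l
    using close that by (simp only: M_eq)
  obtain ft where ft: "ft \<in> dual_ball" "ft t = NE t"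
    using norming_functional[OF t(1)] by auto
  have M_t: "NE t - \<delta> \<le> g t" if "g \<in> M" for g
    using near_maxD(2)[of g dual_ball "\<lambda>g. g t" \<delta> ft] that M_sub ft by auto
  have "z \<noteq> 0"
  proof
    assume "z = 0"
    then have "(\<lambda>_. 0) \<in> M"
      unfolding M_def using zero_ball \<beta>' by (intro near_maxI) (auto simp: dual_ball_0)
    from M_t[OF this] t(2) show False by simp
  qed
  have z_le: "\<bar>g z\<bar> \<le> NE z" if "g \<in> dual_ball" for g using dual_ball_le[OF that zE] by simp
  obtain b where b: "b \<in> M"
    unfolding M_def by (rule near_max_nonempty[OF ne _ \<beta>', of "\<lambda>g. g z" "NE z"]) (use z_le in force)+
  have b_ball: "b \<in> dual_ball" using b unfolding M_def by (rule near_maxD)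
  have signs: "1 - 4 * \<delta> \<le> \<bar>\<Sum>l\<in>G. \<sigma> l * (a l * b (unit_vec l))\<bar>" if \<sigma>: "\<And>l. \<bar>\<sigma> l\<bar> = 1" for \<sigma>
  proof -
    define F where "F w = (\<lambda>l. \<sigma> l * w l)" for w
    have F_E: "F w \<in> E" "NE (F w) = NE w" if "w \<in> E" for w
      using that abs_mem[of "F w" w] abs_norm[of "F w" w] \<sigma> by (auto simp: F_def abs_mult)
    have F_F: "F (F w) = w" for w
      using \<sigma> by (auto simp: F_def fun_eq_iff abs_if split: if_splits) (metis mult_minus1 minus_minus mult_1)
    have F_lin: "F (v + w) = F v + F w" "F (real_fun_scale r w) = real_fun_scale r (F w)"
      "F (v - w) = F v - F w" for v w r
      by (simp_all add: F_def fun_eq_iff algebra_simps)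
    define y\<sigma> where "y\<sigma> w = y (F w)" for w
    obtain K where K: "\<And>w. w \<in> E \<Longrightarrow> \<bar>y w\<bar> \<le> K * NE w" using functional_bound[OF y] by blast
    have y\<sigma>: "y\<sigma> \<in> functionals"
    proof (rule functionalI[where K = K])
      show "\<bar>y\<sigma> w\<bar> \<le> K * NE w" if "w \<in> E" for w
        using K[OF F_E(1)[OF that]] F_E(2)[OF that] by (simp add: y\<sigma>_def)
    qed (simp_all add: y\<sigma>_def F_lin F_E functional_add[OF y] functional_scale[OF y])
    have F_v0: "F v0 \<in> unit_ball" "y\<sigma> (F v0) \<noteq> 0" using v0 F_E F_F by (auto simp: y\<sigma>_def)
    obtain e g where e: "e \<in> E" "NE e = 1" and g: "g \<in> dual_ball" "g e = 1"
      and y_e: "\<And>v. v \<in> unit_ball \<Longrightarrow> \<bar>y\<sigma> v\<bar> \<le> \<bar>y\<sigma> e\<bar> + min \<beta> \<beta>'" and g_z: "NE z \<le> \<bar>g z\<bar> + min \<beta> \<beta>'"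
      using rank_one_states[OF index y\<sigma> F_v0 zE \<open>z \<noteq> 0\<close>, of "min \<beta> \<beta>'"] \<beta> \<beta>' by auto
    (* Up to signs, e lies in the small piece of the unit ball of E and g in the one of the dual ball. *)
    define r where "r = (if y\<sigma> e \<ge> 0 then 1 else - 1 :: real)"
    have r: "\<bar>r\<bar> = 1" "r * r = 1" by (auto simp: r_def)
    have "real_fun_scale r (F e) \<in> near_max unit_ball y \<beta>"
    proof (rule near_maxI)
      show "real_fun_scale r (F e) \<in> unit_ball" using F_E[OF e(1)] e r by (simp add: N_scale)
      fix v assume v: "v \<in> unit_ball"
      have "y v = y\<sigma> (F v)" by (simp add: y\<sigma>_def F_F)
      also have "\<dots> \<le> \<bar>y\<sigma> e\<bar> + \<beta>" using y_e[of "F v"] F_E v by auto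
      also have "\<bar>y\<sigma> e\<bar> = y (real_fun_scale r (F e))"
        using functional_scale[OF y F_E(1)[OF e(1)]] by (simp add: r_def y\<sigma>_def)
      finally show "y v \<le> y (real_fun_scale r (F e)) + \<beta>" .
    qed
    then have "NE (real_fun_scale r (F e) - a) \<le> \<delta>" by (rule a(2))
    moreover have "F (real_fun_scale r (real_fun_scale r (F e) - a)) = e - real_fun_scale r (F a)"
    proof -
      have "real_fun_scale r (real_fun_scale r (F e) - a) = F e - real_fun_scale r a"
        using r by (simp add: fun_eq_iff right_diff_distrib flip: mult.assoc)
      then show ?thesis by (simp only: F_lin F_F)
    qed
    then have "NE (e - real_fun_scale r (F a)) = NE (real_fun_scale r (real_fun_scale r (F e) - a))"
      using F_E[of "real_fun_scale r (real_fun_scale r (F e) - a)"] F_E[OF e(1)] aE by simp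
    ultimately have "NE (e - real_fun_scale r (F a)) \<le> \<delta>"
      using r F_E[OF e(1)] aE by (simp add: N_scale)
    moreover have "g (e - real_fun_scale r (F a)) = 1 - r * g (F a)"
      using g e F_E[OF aE] by (simp add: dual_ball_diff dual_ball_scale)
    moreover have "\<bar>g (e - real_fun_scale r (F a))\<bar> \<le> NE (e - real_fun_scale r (F a))"
      using dual_ball_le[OF g(1), of "e - real_fun_scale r (F a)"] e F_E[OF aE] by simp
    ultimately have "\<bar>1 - r * g (F a)\<bar> \<le> \<delta>" by simp
    moreover have "\<bar>r * g (F a)\<bar> = \<bar>g (F a)\<bar>" using r by (simp add: abs_mult)
    ultimately have gFa: "1 - \<delta> \<le> \<bar>g (F a)\<bar>" by linarith
    have "F a = cut G (F a) + cut (- G) (F a)" by (rule cut_decompose)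
    then have "g (F a) = g (cut G (F a)) + g (cut (- G) (F a))"
      using dual_ball_add[OF g(1), of "cut G (F a)" "cut (- G) (F a)"] F_E[OF aE] by simp
    moreover have "\<bar>g (cut (- G) (F a))\<bar> \<le> \<delta>"
    proof -
      have "NE (cut (- G) (F a)) = NE (cut (- G) a)"
        using aE \<sigma> by (intro abs_norm) (auto simp: F_def abs_mult)
      then show ?thesis using dual_ball_le[OF g(1), of "cut (- G) (F a)"] F_E[OF aE] G(2) by simp
    qed
    ultimately have "1 - 2 * \<delta> \<le> \<bar>g (cut G (F a))\<bar>" using gFa by linarith
    then have gG: "1 - 2 * \<delta> \<le> \<bar>\<Sum>l\<in>G. F a l * g (unit_vec l)\<bar>"
      by (simp only: dual_ball_cut[OF g(1) G(1)])
    define r' where "r' = (if g z \<ge> 0 then 1 else - 1 :: real)"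
    have r': "\<bar>r'\<bar> = 1" by (simp add: r'_def)
    have "(\<lambda>w. r' * g w) \<in> M"
      unfolding M_def
    proof (rule near_maxI)
      show "(\<lambda>w. r' * g w) \<in> dual_ball" using g(1) r' by (intro dual_ball_cmult) auto
      fix h assume "h \<in> dual_ball"
      then have "h z \<le> NE z" using z_le[of h] by simp
      also have "\<dots> \<le> \<bar>g z\<bar> + \<beta>'" using g_z by simp
      also have "\<bar>g z\<bar> = r' * g z" by (simp add: r'_def)
      finally show "h z \<le> r' * g z + \<beta>'" .
    qed
    then have close': "\<bar>r' * g (unit_vec l) - b (unit_vec l)\<bar> \<le> 2 * \<eta>" if "l \<in> G" for l
      using M_close[OF _ that, of "\<lambda>w. r' * g w"] M_close[OF b that] by simp
    have "\<bar>(\<Sum>l\<in>G. F a l * (r' * g (unit_vec l))) - (\<Sum>l\<in>G. F a l * b (unit_vec l))\<bar>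
        \<le> (\<Sum>l\<in>G. \<bar>F a l * (r' * g (unit_vec l) - b (unit_vec l))\<bar>)"
      unfolding sum_subtractf[symmetric] right_diff_distrib[symmetric] by (rule sum_abs)
    also have "\<dots> \<le> (\<Sum>l\<in>G. 2 * \<eta>)"
    proof (rule sum_mono)
      fix l assume l: "l \<in> G"
      have "\<bar>F a l\<bar> \<le> 1" using coordinate_le[of "F a" l] F_E[OF aE] a(1) by simp
      then have "\<bar>F a l\<bar> * \<bar>r' * g (unit_vec l) - b (unit_vec l)\<bar> \<le> 1 * (2 * \<eta>)"
        using close'[OF l] by (intro mult_mono) auto
      then show "\<bar>F a l * (r' * g (unit_vec l) - b (unit_vec l))\<bar> \<le> 2 * \<eta>" by (simp add: abs_mult)
    qed
    also have "\<dots> \<le> real (Suc (card G)) * (2 * \<eta>)" using \<eta> by simp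
    also have "\<dots> = \<delta>" by (simp add: \<eta>_def del: of_nat_Suc)
    finally have "\<bar>(\<Sum>l\<in>G. F a l * (r' * g (unit_vec l))) - (\<Sum>l\<in>G. F a l * b (unit_vec l))\<bar> \<le> \<delta>" .
    moreover have "\<bar>\<Sum>l\<in>G. F a l * (r' * g (unit_vec l))\<bar> = \<bar>\<Sum>l\<in>G. F a l * g (unit_vec l)\<bar>"
    proof -
      have "(\<Sum>l\<in>G. F a l * (r' * g (unit_vec l))) = r' * (\<Sum>l\<in>G. F a l * g (unit_vec l))"
        by (simp add: sum_distrib_left mult.left_commute)
      then show ?thesis using r' by (simp add: abs_mult)
    qed
    ultimately have "1 - 4 * \<delta> \<le> \<bar>\<Sum>l\<in>G. F a l * b (unit_vec l)\<bar>" using gG \<delta>(1) by linarith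
    then show ?thesis by (simp add: F_def mult.assoc)
  qed
  obtain l where "1 - 4 * \<delta> \<le> \<bar>a l * b (unit_vec l)\<bar>"
    using large_coefficient_from_signs[where G = G and c = "1 - 4 * \<delta>"
        and p = "\<lambda>l. a l * b (unit_vec l)", OF G(1) _ signs] \<delta>(2) by auto
  then show thesis using that[OF b_ball M_t[OF b]] by blast
qed

end

section \<open>Sums of families\<close>

locale family_sum = absolute_space E NE
  for E :: "('l \<Rightarrow> real) set" and NE +
  fixes s :: "'k::scalar_field \<Rightarrow> 'a::ab_group_add \<Rightarrow> 'a" and V :: "'l \<Rightarrow> 'a set" and N :: "'l \<Rightarrow> 'a \<Rightarrow> real"
  assumes normed_summand: "normed_space_on s (V l) (N l)" and nontrivial_summand: "V l \<noteq> {0}"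
begin

sublocale X: normed_carrier s "V l" "N l" for l
  using normed_summand by unfold_locales

abbreviation X_sum :: "('l \<Rightarrow> 'a) set" where "X_sum \<equiv> esum E V N"
abbreviation X_norm :: "('l \<Rightarrow> 'a) \<Rightarrow> real" where "X_norm \<equiv> esum_norm NE N"

definition modulus :: "('l \<Rightarrow> 'a) \<Rightarrow> 'l \<Rightarrow> real" where
  "modulus x = (\<lambda>l. N l (x l))"

lemma X_sumI: "(\<And>l. x l \<in> V l) \<Longrightarrow> modulus x \<in> E \<Longrightarrow> x \<in> X_sum"
  by (simp add: esum_def modulus_def)

lemma X_norm_eq: "X_norm x = NE (modulus x)"
  by (simp add: esum_norm_def modulus_def)

lemma component_mem [simp]: "x \<in> X_sum \<Longrightarrow> x l \<in> V l"
  and modulus_mem [simp]: "x \<in> X_sum \<Longrightarrow> modulus x \<in> E"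
  by (simp_all add: esum_def modulus_def)

lemma dominated:
  assumes "\<And>l. x l \<in> V l" "\<And>l. N l (x l) \<le> \<bar>a l\<bar>" "a \<in> E"
  shows "x \<in> X_sum" "X_norm x \<le> NE a"
proof -
  have "\<bar>modulus x l\<bar> \<le> \<bar>a l\<bar>" for l using assms(1,2) by (simp add: modulus_def)
  from solid[OF assms(3) this] show "x \<in> X_sum" "X_norm x \<le> NE a"
    using assms(1) by (auto simp: X_norm_eq intro: X_sumI)
qed

lemma normed_sum: "normed_space_on (fun_scale s) X_sum X_norm"
proof -
  have vs: "vector_space (fun_scale s)"
    by unfold_locales (auto simp: fun_eq_iff X.scale_right_distrib X.scale_left_distrib)
  interpret F: vector_space "fun_scale s" by (rule vs)
  have zero: "0 \<in> X_sum"
    by (rule dominated(1)[of _ 0]) auto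
  have add: "x + y \<in> X_sum" "X_norm (x + y) \<le> X_norm x + X_norm y" if "x \<in> X_sum" "y \<in> X_sum" for x y
  proof -
    have *: "N l ((x + y) l) \<le> \<bar>(modulus x + modulus y) l\<bar>" for l
      using X.N_triangle[of "x l" l "y l"] that by (simp add: modulus_def)
    have E: "modulus x + modulus y \<in> E" using that by (intro add_mem modulus_mem)
    show "x + y \<in> X_sum" by (rule dominated(1)[OF _ * E]) (use that in simp)
    have "X_norm (x + y) \<le> NE (modulus x + modulus y)" by (rule dominated(2)[OF _ * E]) (use that in simp)
    also have "\<dots> \<le> X_norm x + X_norm y" unfolding X_norm_eq using that by (intro N_triangle) auto
    finally show "X_norm (x + y) \<le> X_norm x + X_norm y" .
  qed
  have scale: "fun_scale s c x \<in> X_sum" "X_norm (fun_scale s c x) = norm c * X_norm x" if "x \<in> X_sum" for c x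
  proof -
    have "modulus (fun_scale s c x) = real_fun_scale (norm c) (modulus x)"
      using that by (simp add: fun_eq_iff modulus_def X.N_scale)
    then show "fun_scale s c x \<in> X_sum" "X_norm (fun_scale s c x) = norm c * X_norm x"
      using that by (auto simp: X_norm_eq N_scale intro!: X_sumI)
  qed
  have "x = 0" if "x \<in> X_sum" "X_norm x = 0" for x
  proof -
    have "modulus x = 0" using that N_eq_0[of "modulus x"] by (simp add: X_norm_eq)
    then have "N l (x l) = 0" for l by (metis modulus_def zero_fun_apply)
    then show ?thesis using that by (simp add: fun_eq_iff X.N_eq_0)
  qed
  moreover have "X_norm 0 = 0"
  proof -
    have "modulus 0 = 0" by (simp add: fun_eq_iff modulus_def)
    then show ?thesis by (simp add: X_norm_eq)
  qed
  moreover have "F.subspace X_sum"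
    using zero add scale by (auto intro: F.subspaceI)
  moreover have "0 \<le> X_norm x" if "x \<in> X_sum" for x using that by (simp add: X_norm_eq)
  ultimately show ?thesis
    unfolding normed_space_on_def by (intro conjI ballI allI vs add scale) auto
qed

sublocale S: normed_carrier "fun_scale s" X_sum X_norm
  using normed_sum by unfold_locales

lemma component_norm_le: "x \<in> X_sum \<Longrightarrow> N l (x l) \<le> X_norm x"
  using coordinate_le[OF modulus_mem, of x l] abs_ge_self[of "modulus x l"]
  unfolding X_norm_eq modulus_def by (rule order_trans[rotated])

definition single :: "'l \<Rightarrow> 'a \<Rightarrow> 'l \<Rightarrow> 'a" where
  "single l v = (\<lambda>k. if k = l then v else 0)"

lemma single_mem [simp]: "v \<in> V l \<Longrightarrow> single l v \<in> X_sum"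
  and single_norm [simp]: "v \<in> V l \<Longrightarrow> X_norm (single l v) = N l v"
proof -
  assume v: "v \<in> V l"
  have "modulus (single l v) = real_fun_scale (N l v) (unit_vec l)"
    by (simp add: fun_eq_iff modulus_def single_def indicator_def)
  then show "single l v \<in> X_sum" "X_norm (single l v) = N l v"
    using v by (auto simp: X_norm_eq N_scale single_def intro!: X_sumI)
qed

lemma single_add: "single l (v + w) = single l v + single l w"
  and single_scale: "single l (s c v) = fun_scale s c (single l v)"
  by (auto simp: fun_eq_iff single_def)

lemma X_sum_nontrivial: "X_sum \<noteq> {0}"
proof -
  obtain q where q: "q \<in> V undefined" "N undefined q = 1"
    using X.unit_direction[OF nontrivial_summand X.zero_mem] by blast
  then have "single undefined q \<in> X_sum" "X_norm (single undefined q) \<noteq> 0" by auto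
  then show ?thesis using S.N_0 by fastforce
qed

text \<open>
  Replacing \<open>x l\<close> by a vector \<open>w\<close> of the same norm keeps \<open>x\<close> in the unit sphere, where the real part
  of \<open>f\<close> is maximal at \<open>x\<close>. So \<open>real_part (f (single l w))\<close> is at most its value for \<open>w = x l\<close>; the
  phase of \<open>w\<close> is free.
\<close>

lemma summand_functional_aligned:
  assumes x: "x \<in> X_sum" "X_norm x = 1" and f: "f \<in> S.dual_ball" "f x = 1" and v: "v \<in> V l"
  shows "norm (f (single l v)) * N l (x l) \<le> N l v * norm (f (single l (x l)))"
proof (cases "v = 0")
  case True
  then have "single l v = 0" by (simp add: fun_eq_iff single_def)
  then show ?thesis using f True by (simp add: S.dual_ball_0)
next
  case False
  let ?n = "N l (x l)"
  have pos: "N l v > 0" using X.N_pos[OF v False] .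
  obtain u where u: "norm u = 1" "u * f (single l v) = of_real (norm (f (single l v)))" by (rule unit_phase)
  define w where "w = s (of_real (?n / N l v) * u) v"
  have w: "w \<in> V l" "N l w = ?n"
    using v u pos x by (auto simp: w_def X.N_scale norm_mult norm_divide)
  define x' where "x' = x(l := w)"
  have "modulus x' = modulus x" using w by (auto simp: x'_def modulus_def)
  then have x': "x' \<in> X_sum" "X_norm x' = 1"
    using x w by (auto simp: X_norm_eq x'_def intro!: X_sumI)
  have "x' + single l (x l) = x + single l w"
    by (auto simp: fun_eq_iff x'_def single_def)
  moreover have "f (x' + single l (x l)) = f x' + f (single l (x l))" "f (x + single l w) = 1 + f (single l w)"
    using x' x w f by (simp_all add: S.dual_ball_add)
  ultimately have "f x' + f (single l (x l)) = 1 + f (single l w)" by simp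
  then have "real_part (f x') + real_part (f (single l (x l))) = 1 + real_part (f (single l w))"
    by (metis real_part_add real_part_one)
  moreover have "real_part (f x') \<le> 1"
    using real_part_le_norm[of "f x'"] S.dual_ball_le[OF f(1) x'(1)] x'(2) by simp
  ultimately have "real_part (f (single l w)) \<le> real_part (f (single l (x l)))" by simp
  also have "\<dots> \<le> norm (f (single l (x l)))" by (rule real_part_le_norm)
  finally have "real_part (f (single l w)) \<le> norm (f (single l (x l)))" .
  moreover have "f (single l w) = of_real (?n / N l v * norm (f (single l v)))"
    using f v u by (simp add: w_def single_scale S.dual_ball_scale mult.assoc)
  ultimately have "?n / N l v * norm (f (single l v)) \<le> norm (f (single l (x l)))"
    by (simp only: real_part_of_real)
  then show ?thesis using pos by (simp add: field_simps)
qed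

lemma index_sum_le_summand:
  "numerical_index (fun_scale s) X_sum X_norm \<le> numerical_index s (V l) (N l)"
proof (rule X.numerical_index_ge[OF nontrivial_summand])
  fix T assume T: "T \<in> operators_on s (V l) (N l)" "op_norm_on (V l) (N l) (N l) T = 1"
  define R where "R x = single l (T (x l))" for x
  have T_le: "N l (T v) \<le> N l v" if "v \<in> V l" for v
    using X.operator_le_op_norm[OF T(1) that] T(2) by simp
  have R: "R \<in> operators_on (fun_scale s) X_sum X_norm"
  proof (rule S.operatorI[where K = 1])
    fix x assume x: "x \<in> X_sum"
    show "X_norm (R x) \<le> 1 * X_norm x"
      using x T_le[of "x l"] component_norm_le[OF x, of l] X.operator_mem[OF T(1)]
      by (simp add: R_def)
  qed (use T(1) in \<open>auto simp: R_def X.operator_mem X.operator_add X.operator_scale single_add single_scale\<close>)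
  have "op_norm_on X_sum X_norm X_norm R = 1"
  proof (rule antisym)
    show "op_norm_on X_sum X_norm X_norm R \<le> 1"
      unfolding op_norm_on_def
    proof (rule cSUP_least)
      fix x assume "x \<in> {x \<in> X_sum. X_norm x \<le> 1}"
      then show "X_norm (R x) \<le> 1"
        using T_le[of "x l"] component_norm_le[of x l] X.operator_mem[OF T(1), of "x l"]
        by (simp add: R_def)
    qed (use S.zero_mem S.N_0 in fastforce)
    show "1 \<le> op_norm_on X_sum X_norm X_norm R"
    proof (rule ccontr)
      assume "\<not> ?thesis"
      then have "op_norm_on X_sum X_norm X_norm R < op_norm_on (V l) (N l) (N l) T" using T(2) by simp
      then obtain v where v: "v \<in> V l" "N l v \<le> 1" "op_norm_on X_sum X_norm X_norm R < N l (T v)"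
        by (rule X.op_norm_approx)
      have "X_norm (R (single l v)) \<le> op_norm_on X_sum X_norm X_norm R"
        using v by (subst op_norm_on_def) (intro cSUP_upper S.operator_bounded R, auto)
      moreover have "R (single l v) = single l (T v)" by (simp add: R_def single_def)
      ultimately show False using v X.operator_mem[OF T(1) v(1)] by simp
    qed
  qed
  then have "numerical_index (fun_scale s) X_sum X_norm \<le> numerical_radius (fun_scale s) X_sum X_norm R"
    by (rule S.numerical_index_le_radius[OF X_sum_nontrivial R])
  also have "\<dots> \<le> numerical_radius s (V l) (N l) T"
  proof (rule S.numerical_radius_le[OF X_sum_nontrivial])
    fix x f assume "(x, f) \<in> state_pairs (fun_scale s) X_sum X_norm"
    then have x: "x \<in> X_sum" "X_norm x = 1" and f: "f \<in> S.dual_ball" "f x = 1"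
      by (auto simp: S.state_pairs_iff)
    let ?n = "N l (x l)"
    have rad0: "0 \<le> numerical_radius s (V l) (N l) T"
      by (rule X.numerical_radius_nonneg[OF nontrivial_summand T(1)])
    obtain q where q: "q \<in> V l" "N l q = 1" "x l = s (of_real ?n) q"
      using X.unit_direction[OF nontrivial_summand component_mem[OF x(1)]] by blast
    have n: "0 \<le> ?n" using x by simp
    have single_eq: "f (single l (s c v)) = c * f (single l v)" if "v \<in> V l" for c v
      using that f by (simp add: single_scale S.dual_ball_scale)
    have fx: "f (single l (x l)) = of_real ?n * f (single l q)"
      using single_eq[OF q(1), of "of_real ?n"] q(3) by simp
    have "R x = single l (s (of_real ?n) (T q))"
      using X.operator_scale[OF T(1) q(1), of "of_real ?n"] q(3) by (simp add: R_def)
    then have fRx: "f (R x) = of_real ?n * f (single l (T q))"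
      using single_eq[OF X.operator_mem[OF T(1) q(1)], of "of_real ?n"] by simp
    show "norm (f (R x)) \<le> numerical_radius s (V l) (N l) T"
    proof (cases "?n = 0 \<or> f (single l q) = 0")
      case True
      have "norm (f (single l (T q))) * ?n \<le> N l (T q) * norm (f (single l (x l)))"
        using summand_functional_aligned[OF x f X.operator_mem[OF T(1) q(1)]] .
      also have "\<dots> = 0" using True unfolding fx by auto
      finally have "norm (f (R x)) \<le> 0" unfolding fRx using n by (simp add: norm_mult mult.commute)
      then show ?thesis using rad0 by simp
    next
      case False
      with n have npos: "?n > 0" and fq: "norm (f (single l q)) > 0" by auto
      obtain u where u: "norm u = 1" "u * f (single l q) = of_real (norm (f (single l q)))" by (rule unit_phase)
      define g where "g v = u / of_real (norm (f (single l q))) * f (single l v)" for v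
      have "norm (f (single l v)) \<le> N l v * norm (f (single l q))" if v: "v \<in> V l" for v
      proof -
        have "norm (f (single l v)) * ?n \<le> N l v * (?n * norm (f (single l q)))"
          using summand_functional_aligned[OF x f v] n unfolding fx by (simp add: norm_mult)
        then show ?thesis using npos by (simp add: mult.assoc[symmetric] mult.commute[of _ ?n])
      qed
      then have "norm (g v) \<le> N l v" if "v \<in> V l" for v
        using that fq u by (simp add: g_def norm_mult norm_divide field_simps)
      then have "g \<in> X.dual_ball l"
        using f by (auto simp: X.dual_ball_def g_def single_add S.dual_ball_add single_eq algebra_simps)
      moreover have "g q = 1" using u fq by (simp add: g_def)
      ultimately have "norm (g (T q)) \<le> numerical_radius s (V l) (N l) T"
        using q by (intro X.state_value_le_radius[OF T(1)]) (simp add: X.state_pairs_iff)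
      moreover have "norm (f (R x)) = norm (f (single l (x l))) * norm (g (T q))"
        unfolding fRx fx using fq u n by (simp add: g_def norm_mult norm_divide)
      moreover have "norm (f (single l (x l))) \<le> 1"
        using S.dual_ball_le[OF f(1), of "single l (x l)"] x component_norm_le[OF x(1), of l] by simp
      ultimately show ?thesis
        using mult_right_mono[of "norm (f (single l (x l)))" 1 "norm (g (T q))"] by simp
    qed
  qed
  finally show "numerical_index (fun_scale s) X_sum X_norm \<le> numerical_radius s (V l) (N l) T" .
qed

text \<open>
  The operator \<open>R\<close> on \<open>V l0\<close> first lifts \<open>u\<close> to the vector with entry \<open>a l0 * u\<close> at \<open>l0\<close> and
  \<open>\<psi> u * a l * e l\<close> elsewhere, which is \<open>x\<close> for \<open>u = e l0\<close>; it then applies \<open>T\<close>, and collects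
  the coordinates in \<open>H\<close>: the one at \<open>l0\<close> times \<open>b l0\<close>, and those of the others as
  scalars times \<open>q\<close>. Since \<open>q\<close> has the direction of \<open>T x l0\<close>, nothing is lost at \<open>e l0\<close>. For a state
  \<open>(u, h)\<close> of \<open>V l0\<close>, the number \<open>h (R u)\<close> equals \<open>f (T z)\<close> with \<open>z\<close> the lift of \<open>u\<close>, and \<open>f z\<close> differs
  from \<open>a l0 * b l0\<close> by at most the sum of the other products.
\<close>

lemma compression_to_summand:
  assumes T: "T \<in> operators_on (fun_scale s) X_sum X_norm" "\<And>x. x \<in> X_sum \<Longrightarrow> X_norm (T x) \<le> X_norm x"
    and a: "a \<in> E" "NE a \<le> 1" and e: "\<And>l. e l \<in> V l" "\<And>l. N l (e l) = 1"
    and b: "b \<in> dual_ball" and H: "finite H" "l0 \<in> H" and \<epsilon>: "\<epsilon> > 0"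
  defines "x \<equiv> \<lambda>l. s (of_real (a l)) (e l)"
  obtains z f where "z \<in> X_sum" "X_norm z \<le> 1" "f \<in> S.dual_ball"
    "2 * \<bar>a l0 * b (unit_vec l0)\<bar> - 1 \<le> norm (f z)"
    "numerical_index s (V l0) (N l0) * \<bar>\<Sum>l\<in>H. b (unit_vec l) * modulus (T x) l\<bar> - \<epsilon> < norm (f (T z))"
proof -
  define B where "B l = b (unit_vec l)" for l
  let ?H = "H - {l0}"
  have split: "(\<Sum>l\<in>H. h l) = h l0 + (\<Sum>l\<in>?H. h l)" for h :: "'l \<Rightarrow> real"
    by (rule sum.remove[OF H])
  have B_sum: "(\<Sum>l\<in>H. \<bar>B l\<bar> * modulus w l) \<le> X_norm w" if "w \<in> X_sum" for w
  proof -
    have "(\<Sum>l\<in>H. \<bar>B l\<bar> * modulus w l) = (\<Sum>l\<in>H. \<bar>b (unit_vec l) * modulus w l\<bar>)"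
      using that by (intro sum.cong) (auto simp: B_def abs_mult modulus_def)
    also have "\<dots> \<le> X_norm w"
      unfolding X_norm_eq using that H by (intro dual_ball_abs_sum_le[OF b]) auto
    finally show ?thesis .
  qed
  have x: "x \<in> X_sum"
    using e a by (intro dominated(1)[OF _ _ a(1)]) (auto simp: x_def X.N_scale)
  have Tx: "T x l \<in> V l" for l using S.operator_mem[OF T(1) x] by simp
  have "\<exists>f. f \<in> X.dual_ball l \<and> f (T x l) = of_real (modulus (T x) l)" for l
    using X.norming_functional[OF Tx[of l]] unfolding modulus_def by metis
  then obtain \<phi> where \<phi>: "\<And>l. \<phi> l \<in> X.dual_ball l" "\<And>l. \<phi> l (T x l) = of_real (modulus (T x) l)" by metis
  obtain q where q: "q \<in> V l0" "N l0 q = 1" "T x l0 = s (of_real (N l0 (T x l0))) q"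
    using X.unit_direction[OF nontrivial_summand Tx] by blast
  obtain \<psi> where \<psi>: "\<psi> \<in> X.dual_ball l0" "\<psi> (e l0) = 1"
    using X.norming_functional[OF e(1)[of l0]] e(2)[of l0] by auto
  define lift where "lift u = (\<lambda>l. if l = l0 then s (of_real (a l0)) u else s (of_real (a l) * \<psi> u) (e l))" for u
  have lift_comp: "lift u l \<in> V l" "N l (lift u l) \<le> \<bar>real_fun_scale (N l0 u) a l\<bar>" if "u \<in> V l0" for u l
    using that e X.dual_ball_le[OF \<psi>(1) that]
    by (auto simp: lift_def X.N_scale norm_mult abs_mult mult.commute[of "N l0 u"] intro: mult_left_mono)
  have lift_mem: "lift u \<in> X_sum" if "u \<in> V l0" for u
    by (rule dominated(1)[OF lift_comp[OF that] scale_mem[OF a(1)]])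
  have lift_norm: "X_norm (lift u) \<le> N l0 u" if u: "u \<in> V l0" for u
  proof -
    have "X_norm (lift u) \<le> NE (real_fun_scale (N l0 u) a)"
      by (rule dominated(2)[OF lift_comp[OF u] scale_mem[OF a(1)]])
    also have "\<dots> = N l0 u * NE a" using a u by (simp add: N_scale)
    also have "\<dots> \<le> N l0 u * 1" using a u by (intro mult_left_mono) auto
    finally show ?thesis by simp
  qed
  have lift_add: "lift (u + w) = lift u + lift w" if "u \<in> V l0" "w \<in> V l0" for u w
    using that \<psi> by (auto simp: lift_def fun_eq_iff X.dual_ball_add X.scale_right_distrib
        X.scale_left_distrib distrib_left)
  have lift_scale: "lift (s c u) = fun_scale s c (lift u)" if "u \<in> V l0" for c u
    using that \<psi> by (auto simp: lift_def fun_eq_iff X.dual_ball_scale mult_ac)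
  have lift_e: "lift (e l0) = x" using \<psi> by (auto simp: lift_def x_def fun_eq_iff)
  define rest where "rest w = (\<Sum>l\<in>?H. of_real (B l) * \<phi> l (w l))" for w
  have rest_add: "rest (v + w) = rest v + rest w" if "v \<in> X_sum" "w \<in> X_sum" for v w
    using that by (simp add: rest_def X.dual_ball_add[OF \<phi>(1)] distrib_left sum.distrib)
  have rest_scale: "rest (fun_scale s c w) = c * rest w" if "w \<in> X_sum" for c w
    using that by (simp add: rest_def X.dual_ball_scale[OF \<phi>(1)] sum_distrib_left mult.left_commute)
  have rest_le: "norm (rest w) \<le> (\<Sum>l\<in>?H. \<bar>B l\<bar> * modulus w l)" if "w \<in> X_sum" for w
    unfolding rest_def
  proof (rule order_trans[OF norm_sum], rule sum_mono)
    fix l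
    show "norm (of_real (B l) * \<phi> l (w l)) \<le> \<bar>B l\<bar> * modulus w l"
      using X.dual_ball_le[OF \<phi>(1), of "w l" l] that
      by (simp add: norm_mult modulus_def mult_left_mono)
  qed
  define R where "R u = s (of_real (B l0)) (T (lift u) l0) + s (rest (T (lift u))) q" for u
  have TL: "T (lift u) \<in> X_sum" if "u \<in> V l0" for u using S.operator_mem[OF T(1) lift_mem[OF that]] .
  have R: "R \<in> operators_on s (V l0) (N l0)"
  proof (rule X.operatorI[where K = 1])
    fix u assume u: "u \<in> V l0"
    show "R u \<in> V l0" using TL[OF u] q by (simp add: R_def)
    have "N l0 (R u) \<le> \<bar>B l0\<bar> * modulus (T (lift u)) l0 + norm (rest (T (lift u)))"
      using X.N_triangle[of "s (of_real (B l0)) (T (lift u) l0)" l0 "s (rest (T (lift u))) q"] TL[OF u] q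
      by (simp add: R_def X.N_scale modulus_def)
    also have "\<dots> \<le> (\<Sum>l\<in>H. \<bar>B l\<bar> * modulus (T (lift u)) l)"
      using rest_le[OF TL[OF u]] split by simp
    also have "\<dots> \<le> X_norm (T (lift u))" by (rule B_sum[OF TL[OF u]])
    also have "\<dots> \<le> X_norm (lift u)" by (rule T(2)[OF lift_mem[OF u]])
    also have "\<dots> \<le> 1 * N l0 u" using lift_norm[OF u] by simp
    finally show "N l0 (R u) \<le> 1 * N l0 u" .
  next
    fix u w assume uw: "u \<in> V l0" "w \<in> V l0"
    have "T (lift (u + w)) = T (lift u) + T (lift w)"
      using uw by (simp add: lift_add S.operator_add[OF T(1)] lift_mem)
    then show "R (u + w) = R u + R w"
      using TL uw by (simp add: R_def rest_add X.scale_right_distrib X.scale_left_distrib)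
  next
    fix c u assume u: "u \<in> V l0"
    have "T (lift (s c u)) = fun_scale s c (T (lift u))"
      using u by (simp add: lift_scale S.operator_scale[OF T(1)] lift_mem)
    then show "R (s c u) = s c (R u)"
      using TL u by (simp add: R_def rest_scale X.scale_right_distrib mult.commute)
  qed
  have "R (e l0) = s (of_real (\<Sum>l\<in>H. B l * modulus (T x) l)) q"
  proof -
    have "rest (T x) = of_real (\<Sum>l\<in>?H. B l * modulus (T x) l)"
      by (simp add: rest_def \<phi>(2))
    moreover have "s (of_real (B l0)) (T x l0) = s (of_real (B l0 * modulus (T x) l0)) q"
      by (subst q(3)) (simp add: modulus_def)
    ultimately show ?thesis
      by (simp only: R_def lift_e X.scale_left_distrib[symmetric] of_real_add[symmetric] split)
  qed
  then have NR: "N l0 (R (e l0)) = \<bar>\<Sum>l\<in>H. B l * modulus (T x) l\<bar>"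
    using q by (simp add: X.N_scale del: of_real_sum of_real_mult)
  obtain u h where uh: "(u, h) \<in> state_pairs s (V l0) (N l0)"
    "numerical_index s (V l0) (N l0) * N l0 (R (e l0)) - \<epsilon> < norm (h (R u))"
    using X.state_attaining_index[OF nontrivial_summand R, of "e l0" \<epsilon>] e \<epsilon> by auto
  then have u: "u \<in> V l0" "N l0 u = 1" and h: "h \<in> X.dual_ball l0" "h u = 1"
    by (auto simp: X.state_pairs_iff)
  have hq: "norm (h q) \<le> 1" using X.dual_ball_le[OF h(1) q(1)] q(2) by simp
  define f where "f w = of_real (B l0) * h (w l0) + rest w * h q" for w
  have "f \<in> S.dual_ball"
    unfolding S.dual_ball_def
  proof (intro CollectI conjI ballI allI)
    show "f (v + w) = f v + f w" if "v \<in> X_sum" "w \<in> X_sum" for v w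
      using that h by (simp add: f_def rest_add X.dual_ball_add algebra_simps)
    show "f (fun_scale s c w) = c * f w" if "w \<in> X_sum" for c w
      using that h by (simp add: f_def rest_scale X.dual_ball_scale algebra_simps)
    show "norm (f w) \<le> X_norm w" if w: "w \<in> X_sum" for w
    proof -
      have "norm (f w) \<le> \<bar>B l0\<bar> * norm (h (w l0)) + norm (rest w) * norm (h q)"
        unfolding f_def by (rule order_trans[OF norm_triangle_ineq]) (simp add: norm_mult)
      also have "\<bar>B l0\<bar> * norm (h (w l0)) \<le> \<bar>B l0\<bar> * modulus w l0"
        using X.dual_ball_le[OF h(1), of "w l0"] w by (intro mult_left_mono) (auto simp: modulus_def)
      also have "norm (rest w) * norm (h q) \<le> norm (rest w) * 1"
        using hq by (intro mult_left_mono) auto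
      also have "norm (rest w) * 1 \<le> (\<Sum>l\<in>?H. \<bar>B l\<bar> * modulus w l)" using rest_le[OF w] by simp
      finally show ?thesis using B_sum[OF w] split[of "\<lambda>l. \<bar>B l\<bar> * modulus w l"] by simp
    qed
  qed
  moreover have "f (T (lift u)) = h (R u)"
    using h q TL[OF u(1)] by (simp add: R_def f_def X.dual_ball_add X.dual_ball_scale)
  moreover have "2 * \<bar>a l0 * B l0\<bar> - 1 \<le> norm (f (lift u))"
  proof -
    have "norm (rest (lift u)) \<le> (\<Sum>l\<in>?H. \<bar>B l * a l\<bar>)"
    proof (rule order_trans[OF rest_le[OF lift_mem[OF u(1)]]], rule sum_mono)
      fix l
      show "\<bar>B l\<bar> * modulus (lift u) l \<le> \<bar>B l * a l\<bar>"
        using lift_comp(2)[OF u(1), of l] u(2) by (simp add: modulus_def abs_mult mult_left_mono)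
    qed
    also have "\<dots> \<le> 1 - \<bar>B l0 * a l0\<bar>"
      using dual_ball_abs_sum_le[OF b a(1) H(1)] a(2) split[of "\<lambda>l. \<bar>B l * a l\<bar>"]
      by (simp add: B_def)
    finally have "norm (rest (lift u)) \<le> 1 - \<bar>B l0 * a l0\<bar>" .
    moreover have "norm (rest (lift u) * h q) \<le> norm (rest (lift u)) * 1"
      unfolding norm_mult using hq by (intro mult_left_mono) auto
    moreover have "of_real (B l0) * h (lift u l0) = of_real (B l0 * a l0)"
      using h u by (simp add: lift_def X.dual_ball_scale)
    then have "norm (of_real (B l0) * h (lift u l0)) = \<bar>B l0 * a l0\<bar>" by (simp only: norm_of_real)
    moreover have "norm (of_real (B l0) * h (lift u l0)) - norm (rest (lift u) * h q) \<le> norm (f (lift u))"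
      unfolding f_def using norm_diff_ineq by blast
    ultimately have "\<bar>B l0 * a l0\<bar> - (1 - \<bar>B l0 * a l0\<bar>) \<le> norm (f (lift u))" by linarith
    then show ?thesis by (simp add: mult.commute)
  qed
  ultimately show thesis
    using that[OF lift_mem[OF u(1)], of f] lift_norm[OF u(1)] u(2) uh(2) NR unfolding B_def by simp
qed

end

locale rnp_family_sum = family_sum E NE s V N + absolute_rnp_space E NE
  for E :: "('l \<Rightarrow> real) set" and NE
    and s :: "'k::scalar_field \<Rightarrow> 'a::ab_group_add \<Rightarrow> 'a" and V N +
  assumes index_one: "numerical_index real_fun_scale E NE = 1"
begin

text \<open>
  Start from \<open>x0\<close> and \<open>f0\<close> with \<open>f0 (T x0)\<close> almost \<open>1\<close>. With the unit directions \<open>e\<close> of \<open>x0\<close> fixed, the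
  value \<open>f0 (T x)\<close> depends on the coefficients of \<open>x\<close> through a functional \<open>y\<close> on \<open>E\<close>. So the modulus of
  \<open>x0\<close> may be exchanged for an element \<open>a\<close> of a slice of small diameter on which \<open>y\<close> is still almost \<open>1\<close>.
  The element \<open>b\<close> of the dual ball is then chosen to almost norm the modulus of \<open>T x\<close>.
\<close>

lemma almost_optimal_state:
  assumes T: "T \<in> operators_on (fun_scale s) X_sum X_norm" "op_norm_on X_sum X_norm X_norm T = 1"
    and k: "\<And>l. k \<le> numerical_index s (V l) (N l)" "0 \<le> k" and \<delta>: "0 < \<delta>" "\<delta> < 1 / 4"
  obtains z f where "z \<in> X_sum" "X_norm z \<le> 1" "f \<in> S.dual_ball" "1 - 8 * \<delta> \<le> norm (f z)"
    "k * (1 - 4 * \<delta>) - \<delta> < norm (f (T z))"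
proof -
  have T_le: "X_norm (T x) \<le> X_norm x" if "x \<in> X_sum" for x
    using S.operator_le_op_norm[OF T(1) that] T(2) by simp
  have T_mem: "T x \<in> X_sum" if "x \<in> X_sum" for x using S.operator_mem[OF T(1) that] .
  obtain x0 where x0: "x0 \<in> X_sum" "X_norm x0 \<le> 1" "1 - \<delta> < X_norm (T x0)"
    using S.op_norm_approx[of "1 - \<delta>" T] T(2) \<delta> by auto
  obtain f0 where f0: "f0 \<in> S.dual_ball" "f0 (T x0) = of_real (X_norm (T x0))"
    using S.norming_functional[OF T_mem[OF x0(1)]] .
  have "\<exists>q. q \<in> V l \<and> N l q = 1 \<and> x0 l = s (of_real (N l (x0 l))) q" for l
    using X.unit_direction[OF nontrivial_summand component_mem[OF x0(1), of l]] by metis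
  then obtain e where e: "\<And>l. e l \<in> V l" "\<And>l. N l (e l) = 1" "\<And>l. x0 l = s (of_real (N l (x0 l))) (e l)"
    by metis
  define J where "J w = (\<lambda>l. s (of_real (w l)) (e l))" for w
  have J_comp: "J w l \<in> V l" "N l (J w l) \<le> \<bar>w l\<bar>" for w l
    using e by (simp_all add: J_def X.N_scale)
  have J_mem: "J w \<in> X_sum" and J_norm: "X_norm (J w) \<le> NE w" if "w \<in> E" for w
    using dominated[of "J w" w] J_comp that by auto
  have J_lin: "J (v + w) = J v + J w" "J (real_fun_scale c w) = fun_scale s (of_real c) (J w)" for v w c
    by (simp_all add: J_def fun_eq_iff X.scale_left_distrib)
  have J_x0: "J (modulus x0) = x0" using e(3) by (simp add: J_def modulus_def fun_eq_iff)
  define y where "y w = real_part (f0 (T (J w)))" for w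
  have y_le: "\<bar>y w\<bar> \<le> X_norm (T (J w))" if "w \<in> E" for w
    unfolding y_def using abs_real_part_le[of "f0 (T (J w))"] S.dual_ball_le[OF f0(1) T_mem[OF J_mem[OF that]]]
    by linarith
  have y: "y \<in> functionals"
  proof (rule functionalI[where K = 1])
    show "y (v + w) = y v + y w" if "v \<in> E" "w \<in> E" for v w
      using that f0(1) by (simp add: y_def J_lin S.operator_add[OF T(1)] J_mem S.dual_ball_add T_mem real_part_add)
    show "y (real_fun_scale c w) = c * y w" if "w \<in> E" for c w
      using that f0(1)
      by (simp add: y_def J_lin S.operator_scale[OF T(1)] J_mem S.dual_ball_scale T_mem real_part_scale)
    show "\<bar>y w\<bar> \<le> 1 * NE w" if "w \<in> E" for w
      using y_le[OF that] T_le[OF J_mem[OF that]] J_norm[OF that] by simp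
  qed
  have y0: "1 - \<delta> < y (modulus x0)" using x0(3) f0(2) by (simp add: y_def J_x0)
  have x0_ball: "modulus x0 \<in> unit_ball" using x0 by (simp add: X_norm_eq)
  obtain y' \<beta>' a where y': "y' \<in> functionals" "\<beta>' > 0" and a: "a \<in> near_max unit_ball y' \<beta>'"
    and sub: "near_max unit_ball y' \<beta>' \<subseteq> near_max unit_ball y \<delta>"
    and diam: "\<And>w. w \<in> near_max unit_ball y' \<beta>' \<Longrightarrow> NE (w - a) \<le> \<delta>"
    using near_max_small_diameter[OF y \<delta>(1) \<delta>(1)] by blast
  have a_ball: "a \<in> unit_ball" using a by (rule near_maxD)
  then have aE: "a \<in> E" "NE a \<le> 1" by auto
  have "a \<in> near_max unit_ball y \<delta>" using a sub by blast
  from near_maxD(2)[OF this x0_ball] y0 have ya: "1 - 2 * \<delta> < y a" by simp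
  (* The functional y' is nonzero, because 0 does not almost maximise y. *)
  obtain v0 where v0: "v0 \<in> unit_ball" "y' v0 \<noteq> 0"
  proof (rule ccontr)
    assume "\<not> thesis"
    with that have y'0: "y' v = 0" if "v \<in> unit_ball" for v using \<open>v \<in> unit_ball\<close> by blast
    have "0 \<in> unit_ball" by simp
    with y'0 have "0 \<in> near_max unit_ball y' \<beta>'"
      using y'(2) by (intro near_maxI) auto
    then have "0 \<in> near_max unit_ball y \<delta>" using sub by blast
    from near_maxD(2)[OF this x0_ball] have "1 - \<delta> < y 0 + \<delta>" using y0 by simp
    moreover have "y 0 = 0" using functional_scale[OF y zero_mem, of 0] by simp
    ultimately show False using \<delta> by simp
  qed
  define t where "t = modulus (T (J a))"
  have t: "t \<in> E" using T_mem[OF J_mem[OF aE(1)]] by (simp add: t_def)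
  have Nt: "1 - 2 * \<delta> < NE t"
    using ya y_le[OF aE(1)] by (simp add: t_def X_norm_eq)
  obtain b l0 where b: "b \<in> dual_ball" "NE t - \<delta> \<le> b t" "1 - 4 * \<delta> \<le> \<bar>a l0 * b (unit_vec l0)\<bar>"
    using common_unit_coordinate[OF index_one y' v0 a_ball diam t _ \<delta>] Nt \<delta> by auto
  obtain F where F: "finite F" "NE (cut (- F) t) < \<delta>" using finite_tail_small[OF t \<delta>(1)] .
  define H where "H = insert l0 F"
  have H: "finite H" "l0 \<in> H" using F by (auto simp: H_def)
  have "NE (cut (- H) t) \<le> NE (cut (- F) t)"
    by (rule cut_norm_mono) (use t in \<open>auto simp: H_def\<close>)
  then have "\<bar>b (cut (- H) t)\<bar> < \<delta>"
    using dual_ball_le[OF b(1), of "cut (- H) t"] t F(2) by simp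
  moreover have "b t = b (cut H t) + b (cut (- H) t)"
    using dual_ball_add[OF b(1), of "cut H t" "cut (- H) t"] t by (simp flip: cut_decompose)
  ultimately have "1 - 4 * \<delta> < b (cut H t)" using b(2) Nt by linarith
  then have sum: "1 - 4 * \<delta> \<le> \<bar>\<Sum>l\<in>H. b (unit_vec l) * modulus (T (J a)) l\<bar>"
    unfolding dual_ball_cut[OF b(1) H(1)] t_def by (simp add: mult.commute)
  obtain z f where zf: "z \<in> X_sum" "X_norm z \<le> 1" "f \<in> S.dual_ball"
    "2 * \<bar>a l0 * b (unit_vec l0)\<bar> - 1 \<le> norm (f z)"
    "numerical_index s (V l0) (N l0) * \<bar>\<Sum>l\<in>H. b (unit_vec l) * modulus (T (J a)) l\<bar> - \<delta> < norm (f (T z))"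
    using compression_to_summand[OF T(1) T_le aE e(1,2) b(1) H \<delta>(1)] unfolding J_def by blast
  have "k * (1 - 4 * \<delta>) \<le>
      numerical_index s (V l0) (N l0) * \<bar>\<Sum>l\<in>H. b (unit_vec l) * modulus (T (J a)) l\<bar>"
    using k(1)[of l0] k(2) sum \<delta> by (intro mult_mono) (auto intro: order_trans)
  with zf(5) have "k * (1 - 4 * \<delta>) - \<delta> < norm (f (T z))" by linarith
  moreover have "1 - 8 * \<delta> \<le> norm (f z)" using zf(4) b(3) by linarith
  ultimately show thesis using that zf by blast
qed

lemma lower_bound_le_radius:
  assumes T: "T \<in> operators_on (fun_scale s) X_sum X_norm" "op_norm_on X_sum X_norm X_norm T = 1"
    and k: "\<And>l. k \<le> numerical_index s (V l) (N l)" "0 \<le> k"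
  shows "k \<le> numerical_radius (fun_scale s) X_sum X_norm T"
proof (rule ccontr)
  let ?v = "numerical_radius (fun_scale s) X_sum X_norm T"
  assume "\<not> k \<le> ?v"
  then have gap: "k - ?v > 0" by simp
  have v: "0 \<le> ?v" "?v \<le> 1"
    using S.numerical_radius_nonneg[OF X_sum_nontrivial T(1)]
      S.numerical_radius_le[OF X_sum_nontrivial, of T 1] S.state_value_le[OF T(1)] T(2) by auto
  define e where "e = min (1 / 2) ((k - ?v) / (2 * (4 + k)))"
  have e: "0 < e" "e \<le> 1 / 2" "e * (4 + k) < k - ?v"
  proof -
    show "0 < e" using gap k(2) by (simp add: e_def)
    show "e \<le> 1 / 2" unfolding e_def by (rule min.cobounded1)
    have "e * (4 + k) \<le> (k - ?v) / (2 * (4 + k)) * (4 + k)"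
      using k(2) by (intro mult_right_mono) (auto simp: e_def)
    also have "\<dots> = (k - ?v) / 2"
    proof -
      have "x / (2 * c) * c = x / 2" if "c > 0" for x c :: real using that by simp
      then show ?thesis using k(2) by (metis add_pos_nonneg zero_less_numeral)
    qed
    also have "\<dots> < k - ?v" using gap by simp
    finally show "e * (4 + k) < k - ?v" .
  qed
  have e2: "e\<^sup>2 \<le> e" using e by (simp add: power2_eq_square mult_left_le)
  (* The defect 8 * \<delta> of the approximate state is then e\<^sup>2, which costs only 3 * e in its value. *)
  define \<delta> where "\<delta> = e\<^sup>2 / 8"
  have \<delta>: "0 < \<delta>" "\<delta> < 1 / 4" using e e2 by (auto simp: \<delta>_def)
  obtain z f where z: "z \<in> X_sum" "X_norm z \<le> 1" and f: "f \<in> S.dual_ball" "1 - 8 * \<delta> \<le> norm (f z)"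
    and Tz: "k * (1 - 4 * \<delta>) - \<delta> < norm (f (T z))"
    using almost_optimal_state[OF T k \<delta>] by blast
  have "norm (f (T z)) \<le> ?v + 3 * e"
  proof (rule S.almost_state_value[where T = T and x = z and e = e])
    show "1 - e\<^sup>2 \<le> norm (f z)" using f(2) by (simp add: \<delta>_def)
    show "norm (g (T x)) \<le> ?v" if "(x, g) \<in> state_pairs (fun_scale s) X_sum X_norm" for x g
      by (rule S.state_value_le_radius[OF T(1) that])
  qed (use T v z f(1) e in auto)
  moreover have "4 * \<delta> * k \<le> e * k" using e2 e(1) k(2) by (intro mult_right_mono) (auto simp: \<delta>_def)
  moreover have "\<delta> \<le> e" using e2 e(1) by (auto simp: \<delta>_def)
  ultimately have "k - ?v \<le> e * (4 + k)" using Tz by (simp add: algebra_simps)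
  with e(3) show False by simp
qed

theorem index_sum_eq_Inf:
  "numerical_index (fun_scale s) X_sum X_norm = (INF l. numerical_index s (V l) (N l))"
proof (rule antisym)
  show "numerical_index (fun_scale s) X_sum X_norm \<le> (INF l. numerical_index s (V l) (N l))"
    by (intro cINF_greatest index_sum_le_summand) simp
  have nonneg: "0 \<le> numerical_index s (V l) (N l)" for l
    by (rule X.numerical_index_nonneg[OF nontrivial_summand])
  show "(INF l. numerical_index s (V l) (N l)) \<le> numerical_index (fun_scale s) X_sum X_norm"
  proof (rule S.numerical_index_ge[OF X_sum_nontrivial lower_bound_le_radius])
    show "(INF l. numerical_index s (V l) (N l)) \<le> numerical_index s (V l) (N l)" for l
      using nonneg by (intro cINF_lower bdd_belowI2[where m = 0]) auto
    show "0 \<le> (INF l. numerical_index s (V l) (N l))"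
      using nonneg by (intro cINF_greatest) auto
  qed
qed

end

lemma sum_index:
  fixes E :: "('l \<Rightarrow> real) set" and s :: "'k::scalar_field \<Rightarrow> 'a::ab_group_add \<Rightarrow> 'a"
  assumes "absolute_norm E NE" "radon_nikodym_property real_fun_scale E NE"
    "numerical_index real_fun_scale E NE = 1"
    and "\<forall>l. banach_space_on s (V l) (N l) \<and> V l \<noteq> {0}"
  shows "numerical_index (fun_scale s) (esum E V N) (esum_norm NE N) =
    (INF l. numerical_index s (V l) (N l))"
proof -
  interpret rnp_family_sum E NE s V N
    using assms by unfold_locales (auto simp: banach_space_on_def)
  show ?thesis by (rule index_sum_eq_Inf)
qed

theorem corollary2p8:
  fixes E :: "('l \<Rightarrow> real) set" and NE :: "('l \<Rightarrow> real) \<Rightarrow> real"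
  assumes "absolute_norm E NE"
    and "radon_nikodym_property real_fun_scale E NE"
    and "numerical_index real_fun_scale E NE = 1"
  shows "(\<forall>(s :: real \<Rightarrow> 'a::ab_group_add \<Rightarrow> 'a) (V :: 'l \<Rightarrow> 'a set) (N :: 'l \<Rightarrow> 'a \<Rightarrow> real).
            (\<forall>l. banach_space_on s (V l) (N l) \<and> V l \<noteq> {0}) \<longrightarrow>
            numerical_index (fun_scale s) (esum E V N) (esum_norm NE N) =
              (INF l. numerical_index s (V l) (N l))) \<and>
         (\<forall>(s :: complex \<Rightarrow> 'b::ab_group_add \<Rightarrow> 'b) (V :: 'l \<Rightarrow> 'b set) (N :: 'l \<Rightarrow> 'b \<Rightarrow> real).
            (\<forall>l. banach_space_on s (V l) (N l) \<and> V l \<noteq> {0}) \<longrightarrow>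
            numerical_index (fun_scale s) (esum E V N) (esum_norm NE N) =
              (INF l. numerical_index s (V l) (N l)))"
  by (intro conjI allI impI) (rule sum_index[OF assms], assumption)+

end
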